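(* Let $P$ be the data augmentation (DA) Markov operator on $L^2(\pi_U)$ with transition density $$p(u,u')=\int_{S_V}\pi_{U|V}(u'|v)\,\pi_{V|U}(v|u)\,\nu(dv).$$ Then $P$ is trace-class if and only if $$\int_{S_U}p(u,u)\,\mu(du)<\infty .$$ If this condition holds, then for every positive integer $k$, $$s_k:=\sum_{i=0}^{\kappa}\lambda_i^k=\int_{S_U}p^{(k)}(u,u)\,\mu(du),$$ where $\{\lambda_i\}_{i=0}^{\kappa}$, $0\le\kappa\le\infty$, are the strictly positive eigenvalues of $P$ in decreasing order, counted with multiplicity, and $p^{(k)}$ is the $k$-step transition density.
   Context: $(S_U,\mathcal{U},\mu)$ and $(S_V,\mathcal{V},\nu)$ are $\sigma$-finite measure spaces with $\mathcal{U}$ and $\mathcal{V}$ countably generated. $(U,V)$ is a random element of $S_U\times S_V$ with joint density $\pi_{U,V}$ with respect to $\mu\times\nu$ and marginal densities $\pi_U,\pi_V$; the conditional densities $\pi_{U|V}(u|v)=\pi_{U,V}(u,v)/\pi_V(v)$ and $\pi_{V|U}(v|u)=\pi_{U,V}(u,v)/\pi_U(u)$ are well defined almost everywhere on $S_U\times S_V$. The DA chain with transition density $p$ is reversible with respect to $\pi_U$, and is assumed to be Harris ergodic (irreducible, aperiodic, Harris recurrent). $L^2(\pi_U)$ is the complex Hilbert space of functions $f:S_U\to\mathbb{C}$ with $\int|f|^2\pi_U\,d\mu<\infty$, with inner product $\langle f,g\rangle=\int f\overline g\,\pi_U\,d\mu$. The operator is $Pf(u)=\int_{S_U}p(u,u')f(u')\,\mu(du')$;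 it is self-adjoint and non-negative. Trace-class means $\sum_i\langle Pg_i,g_i\rangle<\infty$ for an orthonormal basis $\{g_i\}$ of $L^2(\pi_U)$; equivalently, $P$ is compact with summable eigenvalues. The $k$-step density is $p^{(1)}=p$, $p^{(k)}(u,u'')=\int_{S_U}p^{(k-1)}(u,u')p(u',u'')\,\mu(du')$ for $k>1$. *)

theory Defs
  imports "HOL-Probability.Probability"
begin

section \<open>Data augmentation densities\<close>

definition countably_generated :: "'a measure \<Rightarrow> bool" where
  "countably_generated M \<longleftrightarrow>
     (\<exists>G. countable G \<and> G \<subseteq> Pow (space M) \<and> sets M = sigma_sets (space M) G)"

text \<open>
  Densities take values in \<^typ>\<open>ennreal\<close>. This matters for the transition density: as an integral
  of nonnegative functions it may be infinite at many points, in particular on the whole diagonal,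
  and a Bochner integral would replace such values by 0. The conditional densities are quotients in
  \<^typ>\<open>ennreal\<close>; they are meaningful where the marginal in the denominator is positive and finite.
\<close>

definition marginal_U :: "'b measure \<Rightarrow> ('a \<times> 'b \<Rightarrow> ennreal) \<Rightarrow> 'a \<Rightarrow> ennreal" where
  "marginal_U N f u = (\<integral>\<^sup>+ v. f (u, v) \<partial>N)"

definition marginal_V :: "'a measure \<Rightarrow> ('a \<times> 'b \<Rightarrow> ennreal) \<Rightarrow> 'b \<Rightarrow> ennreal" where
  "marginal_V M f v = (\<integral>\<^sup>+ u. f (u, v) \<partial>M)"

definition cond_U_given_V :: "'a measure \<Rightarrow> ('a \<times> 'b \<Rightarrow> ennreal) \<Rightarrow> 'a \<Rightarrow> 'b \<Rightarrow> ennreal" where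
  "cond_U_given_V M f u v = f (u, v) / marginal_V M f v"

definition cond_V_given_U :: "'b measure \<Rightarrow> ('a \<times> 'b \<Rightarrow> ennreal) \<Rightarrow> 'b \<Rightarrow> 'a \<Rightarrow> ennreal" where
  "cond_V_given_U N f v u = f (u, v) / marginal_U N f u"

definition da_density ::
    "'a measure \<Rightarrow> 'b measure \<Rightarrow> ('a \<times> 'b \<Rightarrow> ennreal) \<Rightarrow> 'a \<Rightarrow> 'a \<Rightarrow> ennreal" where
  "da_density M N f u u' = (\<integral>\<^sup>+ v. cond_U_given_V M f u' v * cond_V_given_U N f v u \<partial>N)"

text \<open>The \<open>k\<close>-step density; it is left unspecified for \<open>k = 0\<close>.\<close>

fun step_density :: "'a measure \<Rightarrow> ('a \<Rightarrow> 'a \<Rightarrow> ennreal) \<Rightarrow> nat \<Rightarrow> 'a \<Rightarrow> 'a \<Rightarrow> ennreal" where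
  "step_density M p (Suc 0) u u'' = p u u''"
| "step_density M p (Suc (Suc n)) u u'' =
     (\<integral>\<^sup>+ u'. step_density M p (Suc n) u u' * p u' u'' \<partial>M)"


section \<open>Harris ergodicity of a Markov kernel\<close>

text \<open>
  The law on path space of the time-homogeneous Markov chain with transition kernel \<open>K\<close> started
  at \<open>x\<close>, given by the Ionescu-Tulcea construction.
\<close>

definition chain_law :: "'a measure \<Rightarrow> ('a \<Rightarrow> 'a measure) \<Rightarrow> 'a \<Rightarrow> (nat \<Rightarrow> 'a) measure" where
  "chain_law M K x =
     projective_family.lim UNIV
       (Ionescu_Tulcea.CI
          (\<lambda>i \<omega>. if i = 0 then return M x else K (\<omega> (i - 1))) (\<lambda>_. M))
       (\<lambda>_. M)"

lemma Ionescu_Tulcea_chain: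
  assumes K: "K \<in> M \<rightarrow>\<^sub>M prob_algebra M" and x: "x \<in> space M"
  shows "Ionescu_Tulcea (\<lambda>i \<omega>. if i = 0 then return M x else K (\<omega> (i - 1))) (\<lambda>_. M)"
proof (rule Ionescu_Tulcea.intro)
  have K': "K \<in> M \<rightarrow>\<^sub>M subprob_algebra M"
    by (rule measurable_prob_algebraD[OF K])
  show "(\<lambda>\<omega>. if i = 0 then return M x else K (\<omega> (i - 1)))
          \<in> PiM {0..<i} (\<lambda>_. M) \<rightarrow>\<^sub>M subprob_algebra M" for i :: nat
  proof (cases i)
    case 0
    have "return M x \<in> space (subprob_algebra M)"
      by (rule measurable_space[OF return_measurable x])
    with 0 show ?thesis by simp
  next
    case (Suc n)
    have "(\<lambda>\<omega>. \<omega> n) \<in> PiM {0..<i} (\<lambda>_. M) \<rightarrow>\<^sub>M M"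
      using Suc by (intro measurable_component_singleton) auto
    from measurable_compose[OF this K'] Suc show ?thesis by (simp del: One_nat_def)
  qed
  show "prob_space (if i = 0 then return M x else K (\<omega> (i - 1)))"
    if \<omega>: "\<omega> \<in> space (PiM {0..<i} (\<lambda>_. M))" for i :: nat and \<omega>
  proof (cases i)
    case 0
    with x show ?thesis by (simp add: prob_space_return)
  next
    case (Suc n)
    have "\<omega> n \<in> space M" using \<omega> Suc by (auto simp: space_PiM PiE_iff)
    with measurable_space[OF K this] Suc show ?thesis by (simp add: space_prob_algebra)
  qed
qed

definition irreducible_kernel :: "'a measure \<Rightarrow> ('a \<Rightarrow> 'a measure) \<Rightarrow> bool" where
  "irreducible_kernel M K \<longleftrightarrow>
     (\<exists>\<phi>. sigma_finite_measure \<phi> \<and> sets \<phi> = sets M \<and> emeasure \<phi> (space M) > 0 \<and>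
        (\<forall>A\<in>sets M. emeasure \<phi> A > 0 \<longrightarrow>
           (\<forall>x\<in>space M. \<exists>n\<ge>1.
              emeasure (chain_law M K x) {\<omega>\<in>space (chain_law M K x). \<omega> n \<in> A} > 0)))"

text \<open>
  In the next two definitions \<open>Q\<close> is the stationary distribution of the chain. Aperiodicity
  says that there is no cyclic decomposition into \<open>d \<ge> 2\<close> disjoint pieces, the first (hence each)
  of positive stationary measure.
\<close>

definition aperiodic_kernel :: "'a measure \<Rightarrow> ('a \<Rightarrow> 'a measure) \<Rightarrow> bool" where
  "aperiodic_kernel Q K \<longleftrightarrow>
     \<not> (\<exists>d::nat. d \<ge> 2 \<and>
          (\<exists>D. (\<forall>i<d. D i \<in> sets Q) \<and> disjoint_family_on D {..<d} \<and> emeasure Q (D 0) > 0 \<and>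
               (\<forall>i<d. \<forall>x\<in>D i. emeasure (K x) (D (Suc i mod d)) = 1)))"

definition Harris_recurrent_kernel ::
    "'a measure \<Rightarrow> 'a measure \<Rightarrow> ('a \<Rightarrow> 'a measure) \<Rightarrow> bool" where
  "Harris_recurrent_kernel M Q K \<longleftrightarrow>
     (\<forall>A\<in>sets M. emeasure Q A > 0 \<longrightarrow>
        (\<forall>x\<in>space M. AE \<omega> in chain_law M K x. \<exists>\<^sub>\<infinity>n. \<omega> n \<in> A))"

definition Harris_ergodic_kernel ::
    "'a measure \<Rightarrow> 'a measure \<Rightarrow> ('a \<Rightarrow> 'a measure) \<Rightarrow> bool" where
  "Harris_ergodic_kernel M Q K \<longleftrightarrow>
     irreducible_kernel M K \<and> aperiodic_kernel Q K \<and> Harris_recurrent_kernel M Q K"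

text \<open>
  A transition density determines the transition probabilities only for almost every starting
  point: where the density of \<open>U\<close> vanishes, the formula for \<open>p(u, \<cdot>)\<close> does not give a probability
  density. The kernel of the chain may be any Markov kernel on those exceptional points.
\<close>

definition is_kernel_of_density ::
    "'a measure \<Rightarrow> ('a \<Rightarrow> 'a \<Rightarrow> ennreal) \<Rightarrow> ('a \<Rightarrow> 'a measure) \<Rightarrow> bool" where
  "is_kernel_of_density M p K \<longleftrightarrow>
     K \<in> M \<rightarrow>\<^sub>M prob_algebra M \<and> (AE u in M. K u = density M (p u))"


section \<open>Operators on complex \<open>L\<^sup>2\<close> spaces\<close>

text \<open>
  Elements of \<open>L\<^sup>2(Q)\<close> are represented by functions, and equality in \<open>L\<^sup>2(Q)\<close> is equality
  \<open>Q\<close>-almost everywhere.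
\<close>

definition L2 :: "'a measure \<Rightarrow> ('a \<Rightarrow> complex) set" where
  "L2 Q = {f \<in> borel_measurable Q. integrable Q (\<lambda>x. (cmod (f x))\<^sup>2)}"

definition L2_inner :: "'a measure \<Rightarrow> ('a \<Rightarrow> complex) \<Rightarrow> ('a \<Rightarrow> complex) \<Rightarrow> complex" where
  "L2_inner Q f g = (\<integral>x. f x * cnj (g x) \<partial>Q)"

definition orthonormal_basis :: "'a measure \<Rightarrow> ('a \<Rightarrow> complex) set \<Rightarrow> bool" where
  "orthonormal_basis Q B \<longleftrightarrow>
     B \<subseteq> L2 Q \<and>
     (\<forall>g\<in>B. \<forall>h\<in>B. L2_inner Q g h = (if g = h then 1 else 0)) \<and>
     (\<forall>f\<in>L2 Q. (\<forall>g\<in>B. L2_inner Q f g = 0) \<longrightarrow> (AE x in Q. f x = 0))"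

text \<open>This notion of trace class is meant for non-negative self-adjoint operators only.\<close>

definition trace_class :: "'a measure \<Rightarrow> (('a \<Rightarrow> complex) \<Rightarrow> 'a \<Rightarrow> complex) \<Rightarrow> bool" where
  "trace_class Q T \<longleftrightarrow>
     (\<exists>B. orthonormal_basis Q B \<and> (\<lambda>g. L2_inner Q (T g) g) summable_on B)"

text \<open>
  The operator with kernel \<open>p\<close>. For a transition density, \<open>p(u, \<cdot>)\<close> is finite almost everywhere
  for almost every \<open>u\<close>, so that \<^const>\<open>enn2real\<close> does not change the integral.
\<close>

definition kernel_operator ::
    "'a measure \<Rightarrow> ('a \<Rightarrow> 'a \<Rightarrow> ennreal) \<Rightarrow> ('a \<Rightarrow> complex) \<Rightarrow> 'a \<Rightarrow> complex" where
  "kernel_operator M p f u = (\<integral>u'. complex_of_real (enn2real (p u u')) * f u' \<partial>M)"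

definition eigenspace ::
    "'a measure \<Rightarrow> (('a \<Rightarrow> complex) \<Rightarrow> 'a \<Rightarrow> complex) \<Rightarrow> real \<Rightarrow> ('a \<Rightarrow> complex) set" where
  "eigenspace Q T x = {f \<in> L2 Q. AE u in Q. T f u = complex_of_real x * f u}"

text \<open>
  Linear independence of \<open>g 0, \<dots>, g (n - 1)\<close> over the complex numbers, as elements of \<open>L\<^sup>2(Q)\<close>.
\<close>

definition AE_independent :: "'a measure \<Rightarrow> nat \<Rightarrow> (nat \<Rightarrow> 'a \<Rightarrow> complex) \<Rightarrow> bool" where
  "AE_independent Q n g \<longleftrightarrow>
     (\<forall>c::nat \<Rightarrow> complex. (AE u in Q. (\<Sum>i<n. c i * g i u) = 0) \<longrightarrow> (\<forall>i<n. c i = 0))"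

text \<open>The dimension of the eigenspace; it is 0 exactly if \<open>x\<close> is not an eigenvalue.\<close>

definition multiplicity_of ::
    "'a measure \<Rightarrow> (('a \<Rightarrow> complex) \<Rightarrow> 'a \<Rightarrow> complex) \<Rightarrow> real \<Rightarrow> enat" where
  "multiplicity_of Q T x =
     Sup {enat n | n. \<exists>g. (\<forall>i<n. g i \<in> eigenspace Q T x) \<and> AE_independent Q n g}"

text \<open>
  \<open>lam 0 \<ge> lam 1 \<ge> \<dots>\<close>, with indices \<open>i \<le> \<kappa>\<close>, lists the strictly positive eigenvalues of \<open>T\<close>,
  each as often as its multiplicity.
\<close>

definition enumerates_positive_eigenvalues ::
    "'a measure \<Rightarrow> (('a \<Rightarrow> complex) \<Rightarrow> 'a \<Rightarrow> complex) \<Rightarrow> enat \<Rightarrow> (nat \<Rightarrow> real) \<Rightarrow> bool" where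
  "enumerates_positive_eigenvalues Q T \<kappa> lam \<longleftrightarrow>
     (\<forall>i. enat i \<le> \<kappa> \<longrightarrow> lam i > 0) \<and>
     (\<forall>i j. i \<le> j \<and> enat j \<le> \<kappa> \<longrightarrow> lam j \<le> lam i) \<and>
     (\<forall>x>0. finite {i. enat i \<le> \<kappa> \<and> lam i = x} \<and>
            enat (card {i. enat i \<le> \<kappa> \<and> lam i = x}) = multiplicity_of Q T x)"

end

theory Submission
  imports Defs "HOL-Library.Diagonal_Subsequence"
begin

text \<open>
  Let \<open>Q\<close> and \<open>R\<close> be the laws of \<open>U\<close> and \<open>V\<close>, and let \<open>h\<close> be the density of the joint law with
  respect to \<open>Q \<Otimes> R\<close>. The conditional expectation \<open>A x = E[x(U) | V]\<close> is the operator from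
  \<open>L\<^sup>2(Q)\<close> to \<open>L\<^sup>2(R)\<close> with kernel \<open>h\<close>, and the data augmentation operator is \<open>P = A* A\<close>. Hence
  the trace of \<open>P\<close> over any orthonormal basis is the squared Hilbert--Schmidt norm of \<open>A\<close>, that is
  \<open>\<integral>\<integral> h\<^sup>2 dQ dR\<close>, which by Tonelli equals \<open>\<integral> p(u, u) du\<close>. If this is finite, \<open>A\<close> is compact, and the
  maximum principle yields an orthonormal basis of eigenfunctions \<open>g\<close> of \<open>P\<close> with eigenvalues \<open>l g\<close>.
  For \<open>k \<ge> 2\<close>, Parseval's identity for the slices of the iterated kernels gives
  \<open>\<Sum> (l g)^k |g(u)|\<^sup>2\<close> as the diagonal of the \<open>k\<close>-step kernel; integrating over \<open>u\<close> proves the formula.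
\<close>

section \<open>Geometry of complex \<open>L\<^sup>2\<close> spaces\<close>

text \<open>The diagonal of the state space may be a null set for the product measure, and the
  operator sees p only up to null sets, so nothing about p(u, u) can follow from the operator alone.
  The argument works because p is given pointwise as an integral over v: every diagonal identity is
  proved for this version of the density, in \<open>ennreal\<close>, before anything is known to be
  finite. Countable generation is what makes it possible: it provides countably many test sets that
  determine an integrable function, and it makes every orthonormal set countable, so that sums, null
  sets and diagonal sequences can be handled. The case k = 1 stands apart because the two slices
  whose product gives p(u, u) live on the space of V. For k >= 2 they live on the space of U, where
  the eigenfunctions form a basis.\<close>

definition L2_sq :: "'a measure \<Rightarrow> ('a \<Rightarrow> complex) \<Rightarrow> real" where
  "L2_sq Q x = (\<integral>u. (cmod (x u))\<^sup>2 \<partial>Q)"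

lemma borel_measurable_cnj [measurable (raw)]:
  assumes "x \<in> borel_measurable Q"
  shows "(\<lambda>u. cnj (x u)) \<in> borel_measurable Q"
  using measurable_compose[OF assms borel_measurable_continuous_onI[OF continuous_on_cnj[OF continuous_on_id]]]
  by simp

lemma L2D:
  assumes "x \<in> L2 Q"
  shows "x \<in> borel_measurable Q" "integrable Q (\<lambda>u. (cmod (x u))\<^sup>2)"
  using assms by (auto simp: L2_def)

lemma L2_iff_nn_integral:
  assumes "x \<in> borel_measurable Q"
  shows "x \<in> L2 Q \<longleftrightarrow> (\<integral>\<^sup>+u. ennreal ((cmod (x u))\<^sup>2) \<partial>Q) < \<infinity>"
  using assms by (auto simp: L2_def integrable_iff_bounded)

lemma L2_sq_nn_integral:
  assumes "x \<in> L2 Q"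
  shows "(\<integral>\<^sup>+u. ennreal ((cmod (x u))\<^sup>2) \<partial>Q) = ennreal (L2_sq Q x)"
  unfolding L2_sq_def using L2D[OF assms] by (intro nn_integral_eq_integral) auto

lemma L2_sq_nonneg [simp]: "0 \<le> L2_sq Q x"
  unfolding L2_sq_def by (rule Bochner_Integration.integral_nonneg) simp

lemma L2_sq_eq_0_iff:
  assumes "x \<in> L2 Q"
  shows "L2_sq Q x = 0 \<longleftrightarrow> (AE u in Q. x u = 0)"
proof -
  have "L2_sq Q x = 0 \<longleftrightarrow> (AE u in Q. (cmod (x u))\<^sup>2 = 0)"
    unfolding L2_sq_def using L2D[OF assms] by (intro integral_nonneg_eq_0_iff_AE) auto
  then show ?thesis by simp
qed

lemma two_mult_le_squares: "2 * (a * b) \<le> a\<^sup>2 + (b::real)\<^sup>2"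
  using sum_squares_bound[of a b] by simp

lemma L2_integrable_norm_mult:
  assumes "x \<in> L2 Q" "y \<in> L2 Q"
  shows "integrable Q (\<lambda>u. cmod (x u) * cmod (y u))"
proof (rule Bochner_Integration.integrable_bound)
  show "integrable Q (\<lambda>u. (cmod (x u))\<^sup>2 + (cmod (y u))\<^sup>2)"
    using L2D[OF assms(1)] L2D[OF assms(2)] by simp
  show "(\<lambda>u. cmod (x u) * cmod (y u)) \<in> borel_measurable Q"
    using L2D(1)[OF assms(1)] L2D(1)[OF assms(2)] by measurable
  have "cmod (x u) * cmod (y u) \<le> (cmod (x u))\<^sup>2 + (cmod (y u))\<^sup>2" for u
    using two_mult_le_squares[of "cmod (x u)" "cmod (y u)"]
      mult_nonneg_nonneg[OF norm_ge_zero norm_ge_zero, of "x u" "y u"] by linarith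
  then show "AE u in Q. norm (cmod (x u) * cmod (y u))
      \<le> norm ((cmod (x u))\<^sup>2 + (cmod (y u))\<^sup>2)"
    by simp
qed

lemma L2_integrable_mult:
  assumes "x \<in> L2 Q" "y \<in> L2 Q"
  shows "integrable Q (\<lambda>u. x u * y u)" "integrable Q (\<lambda>u. x u * cnj (y u))"
proof -
  note [measurable] = L2D(1)[OF assms(1)] L2D(1)[OF assms(2)]
  show "integrable Q (\<lambda>u. x u * y u)" "integrable Q (\<lambda>u. x u * cnj (y u))"
    by (rule Bochner_Integration.integrable_bound[OF L2_integrable_norm_mult[OF assms]];
        simp add: norm_mult; measurable)+
qed

lemma L2_zero: "(\<lambda>u. 0) \<in> L2 Q"
  by (simp add: L2_def)

lemma L2_add:
  assumes "x \<in> L2 Q" "y \<in> L2 Q"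
  shows "(\<lambda>u. x u + y u) \<in> L2 Q"
proof -
  note [measurable] = L2D(1)[OF assms(1)] L2D(1)[OF assms(2)]
  have "integrable Q (\<lambda>u. (cmod (x u + y u))\<^sup>2)"
  proof (rule Bochner_Integration.integrable_bound)
    show "integrable Q (\<lambda>u. 2 * (cmod (x u))\<^sup>2 + 2 * (cmod (y u))\<^sup>2)"
      using L2D[OF assms(1)] L2D[OF assms(2)] by simp
    have "(cmod (x u + y u))\<^sup>2 \<le> 2 * (cmod (x u))\<^sup>2 + 2 * (cmod (y u))\<^sup>2" for u
    proof -
      have "(cmod (x u + y u))\<^sup>2 \<le> (cmod (x u) + cmod (y u))\<^sup>2"
        by (intro power_mono norm_triangle_ineq) simp
      then show ?thesis
        using two_mult_le_squares[of "cmod (x u)" "cmod (y u)"] by (simp add: power2_sum)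
    qed
    then show "AE u in Q. norm ((cmod (x u + y u))\<^sup>2)
        \<le> norm (2 * (cmod (x u))\<^sup>2 + 2 * (cmod (y u))\<^sup>2)"
      by simp
  qed measurable
  then show ?thesis by (simp add: L2_def)
qed

lemma L2_scale:
  assumes "x \<in> L2 Q"
  shows "(\<lambda>u. c * x u) \<in> L2 Q"
proof -
  note [measurable] = L2D(1)[OF assms(1)]
  show ?thesis
    using L2D[OF assms] by (simp add: L2_def norm_mult power_mult_distrib)
qed

lemma L2_diff:
  assumes "x \<in> L2 Q" "y \<in> L2 Q"
  shows "(\<lambda>u. x u - y u) \<in> L2 Q"
  using L2_add[OF assms(1) L2_scale[OF assms(2), of "-1"]] by simp

lemma L2_sum:
  assumes "\<And>g. g \<in> F \<Longrightarrow> X g \<in> L2 Q"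
  shows "(\<lambda>u. \<Sum>g\<in>F. X g u) \<in> L2 Q"
  using assms by (induction F rule: infinite_finite_induct) (auto intro: L2_zero L2_add)

lemma L2_cong_AE:
  assumes "x \<in> L2 Q" "AE u in Q. x u = y u" "y \<in> borel_measurable Q"
  shows "y \<in> L2 Q"
proof -
  note [measurable] = L2D(1)[OF assms(1)] assms(3)
  have "AE u in Q. (cmod (x u))\<^sup>2 = (cmod (y u))\<^sup>2" using assms(2) by auto
  then have "integrable Q (\<lambda>u. (cmod (y u))\<^sup>2)"
    using L2D(2)[OF assms(1)] by (subst integrable_cong_AE[symmetric]) auto
  then show ?thesis using assms(3) by (simp add: L2_def)
qed

lemma L2_sq_cong_AE:
  assumes "x \<in> borel_measurable Q" "y \<in> borel_measurable Q" "AE u in Q. x u = y u"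
  shows "L2_sq Q x = L2_sq Q y"
proof -
  note [measurable] = assms(1,2)
  show ?thesis unfolding L2_sq_def using assms(3) by (intro integral_cong_AE) auto
qed

lemma L2_inner_cong_AE:
  assumes "x \<in> borel_measurable Q" "y \<in> borel_measurable Q" "AE u in Q. x u = y u"
    and "x' \<in> borel_measurable Q" "y' \<in> borel_measurable Q" "AE u in Q. x' u = y' u"
  shows "L2_inner Q x x' = L2_inner Q y y'"
proof -
  note [measurable] = assms(1,2,4,5)
  show ?thesis unfolding L2_inner_def using assms(3,6) by (intro integral_cong_AE) auto
qed

lemma L2_inner_commute: "L2_inner Q y x = cnj (L2_inner Q x y)"
proof -
  have "cnj (L2_inner Q x y) = (\<integral>u. cnj (x u * cnj (y u)) \<partial>Q)"
    unfolding L2_inner_def by (rule Bochner_Integration.integral_cnj[symmetric])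
  also have "\<dots> = L2_inner Q y x"
    unfolding L2_inner_def by (intro Bochner_Integration.integral_cong) (auto simp: mult.commute)
  finally show ?thesis by simp
qed

lemma L2_inner_self: "L2_inner Q x x = of_real (L2_sq Q x)"
  unfolding L2_inner_def L2_sq_def by (simp add: complex_norm_square[symmetric] flip: of_real_power)

lemma L2_inner_add_left:
  assumes "x \<in> L2 Q" "y \<in> L2 Q" "z \<in> L2 Q"
  shows "L2_inner Q (\<lambda>u. x u + y u) z = L2_inner Q x z + L2_inner Q y z"
  unfolding L2_inner_def using L2_integrable_mult(2)[OF assms(1,3)] L2_integrable_mult(2)[OF assms(2,3)]
  by (simp add: distrib_right)

lemma L2_inner_scale_left: "L2_inner Q (\<lambda>u. c * x u) z = c * L2_inner Q x z"
  unfolding L2_inner_def by (simp add: mult.assoc)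

lemma L2_inner_diff_left:
  assumes "x \<in> L2 Q" "y \<in> L2 Q" "z \<in> L2 Q"
  shows "L2_inner Q (\<lambda>u. x u - y u) z = L2_inner Q x z - L2_inner Q y z"
  unfolding L2_inner_def using L2_integrable_mult(2)[OF assms(1,3)] L2_integrable_mult(2)[OF assms(2,3)]
  by (simp add: left_diff_distrib)

lemma L2_inner_zero_left [simp]: "L2_inner Q (\<lambda>u. 0) z = 0"
  by (simp add: L2_inner_def)

lemma L2_inner_sum_left:
  assumes "\<And>g. g \<in> F \<Longrightarrow> X g \<in> L2 Q" "z \<in> L2 Q"
  shows "L2_inner Q (\<lambda>u. \<Sum>g\<in>F. X g u) z = (\<Sum>g\<in>F. L2_inner Q (X g) z)"
  using assms
  by (induction F rule: infinite_finite_induct) (auto simp: L2_inner_add_left L2_sum)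

lemma L2_inner_add_right:
  assumes "x \<in> L2 Q" "y \<in> L2 Q" "z \<in> L2 Q"
  shows "L2_inner Q z (\<lambda>u. x u + y u) = L2_inner Q z x + L2_inner Q z y"
  using L2_inner_add_left[OF assms] by (simp add: L2_inner_commute[of Q z])

lemma L2_inner_diff_right:
  assumes "x \<in> L2 Q" "y \<in> L2 Q" "z \<in> L2 Q"
  shows "L2_inner Q z (\<lambda>u. x u - y u) = L2_inner Q z x - L2_inner Q z y"
  using L2_inner_diff_left[OF assms] by (simp add: L2_inner_commute[of Q z])

lemma L2_inner_scale_right: "L2_inner Q z (\<lambda>u. c * x u) = cnj c * L2_inner Q z x"
  by (simp add: L2_inner_commute[of Q z] L2_inner_scale_left)

lemma L2_inner_sum_right:
  assumes "\<And>g. g \<in> F \<Longrightarrow> X g \<in> L2 Q" "z \<in> L2 Q"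
  shows "L2_inner Q z (\<lambda>u. \<Sum>g\<in>F. X g u) = (\<Sum>g\<in>F. L2_inner Q z (X g))"
  using L2_inner_sum_left[of F X Q z] assms by (simp add: L2_inner_commute[of Q z])

lemma L2_sq_scale: "L2_sq Q (\<lambda>u. c * x u) = (cmod c)\<^sup>2 * L2_sq Q x"
  by (simp add: L2_sq_def norm_mult power_mult_distrib)

lemma L2_sq_minus_commute: "L2_sq Q (\<lambda>u. x u - y u) = L2_sq Q (\<lambda>u. y u - x u)"
  by (simp add: L2_sq_def norm_minus_commute)

lemma L2_sq_add:
  assumes "x \<in> L2 Q" "y \<in> L2 Q"
  shows "L2_sq Q (\<lambda>u. x u + y u) = L2_sq Q x + L2_sq Q y + 2 * Re (L2_inner Q x y)"
proof -
  note xy = L2_add[OF assms]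
  have "complex_of_real (L2_sq Q (\<lambda>u. x u + y u))
      = of_real (L2_sq Q x) + of_real (L2_sq Q y) + (L2_inner Q x y + cnj (L2_inner Q x y))"
    unfolding L2_inner_self[symmetric]
    by (simp add: L2_inner_add_left[OF assms xy] L2_inner_add_right[OF assms] assms
        L2_inner_commute[of Q x y])
  also have "\<dots> = of_real (L2_sq Q x + L2_sq Q y + 2 * Re (L2_inner Q x y))"
    by (simp add: complex_add_cnj)
  finally show ?thesis using of_real_eq_iff by blast
qed

lemma L2_sq_diff:
  assumes "x \<in> L2 Q" "y \<in> L2 Q"
  shows "L2_sq Q (\<lambda>u. x u - y u) = L2_sq Q x + L2_sq Q y - 2 * Re (L2_inner Q x y)"
  using L2_sq_add[OF assms(1) L2_scale[OF assms(2), of "-1"]]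
  by (simp add: L2_sq_scale[of Q "-1" y, simplified] L2_inner_scale_right[of Q x "-1" y, simplified])

lemma L2_Cauchy_Schwarz:
  assumes "x \<in> L2 Q" "y \<in> L2 Q"
  shows "(cmod (L2_inner Q x y))\<^sup>2 \<le> L2_sq Q x * L2_sq Q y"
proof (cases "L2_sq Q y = 0")
  case True
  then have "AE u in Q. y u = 0" using L2_sq_eq_0_iff[OF assms(2)] by simp
  then have "L2_inner Q x y = L2_inner Q x (\<lambda>u. 0)"
    by (intro L2_inner_cong_AE) (use L2D(1)[OF assms(1)] L2D(1)[OF assms(2)] in auto)
  then show ?thesis using True by (simp add: L2_inner_def)
next
  case False
  define s where "s = L2_sq Q y"
  define c where "c = L2_inner Q x y"
  have s: "s > 0" using False L2_sq_nonneg[of Q y] unfolding s_def by linarith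
  \<comment> \<open>This vector is \<open>s\<close> times the component of \<open>x\<close>
    orthogonal to \<open>y\<close>; the factor \<open>s\<close> postpones the division to the
    end.\<close>
  have "0 \<le> L2_sq Q (\<lambda>u. of_real s * x u - c * y u)" by simp
  also have "\<dots> = s\<^sup>2 * L2_sq Q x + (cmod c)\<^sup>2 * s
      - 2 * Re (L2_inner Q (\<lambda>u. of_real s * x u) (\<lambda>u. c * y u))"
    by (simp add: L2_sq_diff L2_scale assms L2_sq_scale s_def)
  also have "L2_inner Q (\<lambda>u. of_real s * x u) (\<lambda>u. c * y u) = of_real (s * (cmod c)\<^sup>2)"
    by (simp add: L2_inner_scale_left L2_inner_scale_right c_def[symmetric] complex_norm_square
        mult.commute mult.left_commute flip: of_real_power)
  finally have "0 \<le> s * (s * L2_sq Q x - (cmod c)\<^sup>2)"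
    by (simp add: algebra_simps power2_eq_square)
  then have "0 \<le> s * L2_sq Q x - (cmod c)\<^sup>2"
    using s by (simp add: zero_le_mult_iff)
  then show ?thesis by (simp add: s_def c_def mult.commute)
qed

section \<open>Norm convergence and completeness\<close>

lemma L2_inner_tendsto:
  assumes "\<And>n. X n \<in> L2 Q" "x \<in> L2 Q" "z \<in> L2 Q"
    and "(\<lambda>n. L2_sq Q (\<lambda>u. X n u - x u)) \<longlonglongrightarrow> 0"
  shows "(\<lambda>n. L2_inner Q (X n) z) \<longlonglongrightarrow> L2_inner Q x z"
proof -
  have "(\<lambda>n. L2_inner Q (X n) z - L2_inner Q x z) \<longlonglongrightarrow> 0"
  proof (rule tendsto_norm_zero_cancel, rule Lim_null_comparison)
    show "(\<lambda>n. sqrt (L2_sq Q (\<lambda>u. X n u - x u) * L2_sq Q z)) \<longlonglongrightarrow> 0"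
      using tendsto_real_sqrt[OF tendsto_mult_left_zero[OF assms(4)]] by simp
    show "\<forall>\<^sub>F n in sequentially. norm (norm (L2_inner Q (X n) z - L2_inner Q x z))
        \<le> sqrt (L2_sq Q (\<lambda>u. X n u - x u) * L2_sq Q z)"
      using L2_Cauchy_Schwarz[OF L2_diff[OF assms(1,2)] assms(3)] assms
      by (intro always_eventually) (auto simp: L2_inner_diff_left intro!: real_le_rsqrt)
  qed
  then show ?thesis by (simp add: LIM_zero_iff)
qed

lemma L2_sq_tendsto:
  assumes "\<And>n. X n \<in> L2 Q" "x \<in> L2 Q"
    and "(\<lambda>n. L2_sq Q (\<lambda>u. X n u - x u)) \<longlonglongrightarrow> 0"
  shows "(\<lambda>n. L2_sq Q (X n)) \<longlonglongrightarrow> L2_sq Q x"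
proof -
  have "L2_sq Q (X n) = 2 * Re (L2_inner Q (X n) x) + L2_sq Q (\<lambda>u. X n u - x u) - L2_sq Q x" for n
    using L2_sq_diff[OF assms(1,2)] by simp
  moreover have "(\<lambda>n. 2 * Re (L2_inner Q (X n) x) + L2_sq Q (\<lambda>u. X n u - x u) - L2_sq Q x)
      \<longlonglongrightarrow> 2 * Re (L2_inner Q x x) + 0 - L2_sq Q x"
    by (intro tendsto_intros L2_inner_tendsto assms)
  ultimately show ?thesis by (simp add: L2_inner_self)
qed

text \<open>Fatou's lemma: the integral of the lower limit of |X n - x|^2 is 0. The function
  \<open>z\<close> may fail to be measurable, so it enters only pointwise, after the
  integration.\<close>

lemma L2_lim_unique_AE:
  assumes "\<And>n. X n \<in> L2 Q" "x \<in> L2 Q"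
    and "(\<lambda>n. L2_sq Q (\<lambda>u. X n u - x u)) \<longlonglongrightarrow> 0"
    and "AE u in Q. (\<lambda>n. X n u) \<longlonglongrightarrow> z u"
  shows "AE u in Q. x u = z u"
proof -
  note [measurable] = L2D(1)[OF assms(1)] L2D(1)[OF assms(2)]
  have "(\<integral>\<^sup>+u. liminf (\<lambda>n. ennreal ((cmod (X n u - x u))\<^sup>2)) \<partial>Q)
      \<le> liminf (\<lambda>n. \<integral>\<^sup>+u. ennreal ((cmod (X n u - x u))\<^sup>2) \<partial>Q)"
    by (rule nn_integral_liminf) measurable
  also have "\<dots> = liminf (\<lambda>n. ennreal (L2_sq Q (\<lambda>u. X n u - x u)))"
    by (simp add: L2_sq_nn_integral L2_diff assms(1,2))
  also have "\<dots> = 0"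
    using lim_imp_Liminf[OF _ tendsto_ennrealI[OF assms(3)]] by simp
  finally have "AE u in Q. liminf (\<lambda>n. ennreal ((cmod (X n u - x u))\<^sup>2)) = 0"
    by (subst nn_integral_0_iff_AE[symmetric]) auto
  then show ?thesis
    using assms(4)
  proof eventually_elim
    case (elim u)
    have "(\<lambda>n. ennreal ((cmod (X n u - x u))\<^sup>2)) \<longlonglongrightarrow> ennreal ((cmod (z u - x u))\<^sup>2)"
      by (intro tendsto_intros elim(2))
    from lim_imp_Liminf[OF _ this] elim(1) show ?case by simp
  qed
qed

text \<open>A subsequence with fast decaying increments converges almost everywhere. Fatou's lemma
  then shows that its pointwise limit is the norm limit of the whole sequence.\<close>

lemma L2_complete:
  assumes X: "\<And>n. X n \<in> L2 Q"
    and Cauchy: "\<And>e. e > 0 \<Longrightarrow> \<exists>N::nat. \<forall>m\<ge>N. \<forall>n\<ge>N. L2_sq Q (\<lambda>u. X m u - X n u) < e"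
  obtains x where "x \<in> L2 Q" "(\<lambda>n. L2_sq Q (\<lambda>u. X n u - x u)) \<longlonglongrightarrow> 0"
proof -
  note [measurable] = L2D(1)[OF X]
  \<comment> \<open>With squared increments below (1/8)^k, the weight 4^k still leaves a geometric
    series of ratio 1/2. Finiteness of the weighted sum at a point bounds the increments there by a
    multiple of (1/2)^k.\<close>
  have "\<exists>N. \<forall>k::nat. \<forall>m\<ge>N k. \<forall>n\<ge>N k. L2_sq Q (\<lambda>u. X m u - X n u) < (1/8)^k"
    by (intro choice allI Cauchy) simp
  then obtain N :: "nat \<Rightarrow> nat"
    where N: "\<And>k m n. m \<ge> N k \<Longrightarrow> n \<ge> N k \<Longrightarrow> L2_sq Q (\<lambda>u. X m u - X n u) < (1/8)^k"
    by blast
  \<comment> \<open>The sum makes \<open>r\<close> monotone with \<open>r k \<ge> N k\<close>; the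
    summand \<open>k\<close> makes it unbounded.\<close>
  define r where "r k = (\<Sum>i\<le>k. N i) + k" for k
  have r_N: "r k \<ge> N k" for k
    unfolding r_def using member_le_sum[of k "{..k}" N] by simp
  have r_Suc: "r (Suc k) \<ge> r k" for k
    unfolding r_def by simp
  have r_ge: "r k \<ge> k" for k
    unfolding r_def by simp
  define d where "d k u = X (r (Suc k)) u - X (r k) u" for k u
  have d_L2: "d k \<in> L2 Q" for k
    unfolding d_def by (intro L2_diff X)
  note [measurable] = L2D(1)[OF d_L2]
  have d_sq: "L2_sq Q (d k) \<le> (1/8)^k" for k
    unfolding d_def using N[of k "r (Suc k)" "r k"] r_N[of k] r_Suc[of k] by simp
  have "(\<integral>\<^sup>+u. (\<Sum>k. ennreal (4^k * (cmod (d k u))\<^sup>2)) \<partial>Q)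
      = (\<Sum>k. \<integral>\<^sup>+u. ennreal (4^k * (cmod (d k u))\<^sup>2) \<partial>Q)"
    by (intro nn_integral_suminf) measurable
  also have "\<dots> = (\<Sum>k. ennreal (4^k * L2_sq Q (d k)))"
    by (simp add: ennreal_mult nn_integral_cmult L2_sq_nn_integral[OF d_L2])
  also have "\<dots> \<le> (\<Sum>k. ennreal ((1/2)^k))"
  proof (intro suminf_le allI ennreal_leI)
    fix k
    have "4^k * L2_sq Q (d k) \<le> 4^k * (1/8)^k"
      by (intro mult_left_mono d_sq) simp
    also have "\<dots> = (4 * (1/8))^k"
      by (rule power_mult_distrib[symmetric])
    also have "\<dots> = (1/2)^k"
      by simp
    finally show "4^k * L2_sq Q (d k) \<le> (1/2)^k" .
  qed auto
  also have "\<dots> < \<infinity>"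
    by (subst suminf_ennreal2) (auto simp: summable_geometric)
  finally have "AE u in Q. (\<Sum>k. ennreal (4^k * (cmod (d k u))\<^sup>2)) \<noteq> \<infinity>"
    by (intro nn_integral_PInf_AE) auto
  then have conv: "AE u in Q. convergent (\<lambda>k. X (r k) u)"
  proof eventually_elim
    case (elim u)
    have "summable (\<lambda>k. 4^k * (cmod (d k u))\<^sup>2)"
      by (rule summable_suminf_not_top) (use elim in auto)
    then have "Bseq (\<lambda>k. 4^k * (cmod (d k u))\<^sup>2)"
      using summable_LIMSEQ_zero convergent_imp_Bseq convergentI by blast
    then obtain K where K: "K > 0" "\<And>k. norm (4^k * (cmod (d k u))\<^sup>2) \<le> K"
      unfolding Bseq_def by blast
    have "norm (d k u) \<le> sqrt K * (1/2)^k" for k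
    proof -
      have "(2^k * cmod (d k u))\<^sup>2 \<le> K"
      proof -
        have "(2::real)^k * 2^k = 4^k"
          by (simp flip: power_mult_distrib)
        then have "(2^k * cmod (d k u))\<^sup>2 = 4^k * (cmod (d k u))\<^sup>2"
          by (simp add: power2_eq_square algebra_simps)
        then show ?thesis using K(2)[of k] by simp
      qed
      then have "2^k * cmod (d k u) \<le> sqrt K"
        by (rule real_le_rsqrt)
      then have "2^k * cmod (d k u) * (1/2)^k \<le> sqrt K * (1/2)^k"
        by (rule mult_right_mono) simp
      then show ?thesis by (simp add: power_one_over)
    qed
    then have "summable (\<lambda>k. d k u)"
      using summable_comparison_test[of "\<lambda>k. d k u" "\<lambda>k. sqrt K * (1/2)^k"]
        summable_mult[OF summable_geometric[of "1/2::real"], of "sqrt K"] by auto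
    then have "(\<lambda>n. X (r 0) u + (\<Sum>k<n. d k u)) \<longlonglongrightarrow> X (r 0) u + (\<Sum>k. d k u)"
      by (intro tendsto_intros summable_LIMSEQ)
    moreover have "X (r 0) u + (\<Sum>k<n. d k u) = X (r n) u" for n
      unfolding d_def using sum_lessThan_telescope[of "\<lambda>k. X (r k) u" n] by simp
    ultimately show ?case by (auto simp: convergent_def)
  qed
  define x where "x u = lim (\<lambda>k. X (r k) u)" for u
  have x_meas [measurable]: "x \<in> borel_measurable Q"
    unfolding x_def by measurable
  have lim: "AE u in Q. (\<lambda>k. X (r k) u) \<longlonglongrightarrow> x u"
    using conv unfolding x_def by eventually_elim (simp add: convergent_LIMSEQ_iff)
  \<comment> \<open>The nonnegative integral is essential here: \<open>L2_sq\<close> is 0 by default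
    outside \<open>L2 Q\<close>, and membership of \<open>x\<close> is derived from this very
    bound.\<close>
  have bound: "\<exists>M. \<forall>n\<ge>M. (\<integral>\<^sup>+u. ennreal ((cmod (X n u - x u))\<^sup>2) \<partial>Q) \<le> ennreal e"
    if e: "e > 0" for e
  proof -
    obtain M where M: "\<And>m n. m \<ge> M \<Longrightarrow> n \<ge> M \<Longrightarrow> L2_sq Q (\<lambda>u. X m u - X n u) < e"
      using Cauchy[OF e] by blast
    have "(\<integral>\<^sup>+u. ennreal ((cmod (X n u - x u))\<^sup>2) \<partial>Q) \<le> ennreal e" if n: "n \<ge> M" for n
    proof -
      have "(\<integral>\<^sup>+u. ennreal ((cmod (X n u - x u))\<^sup>2) \<partial>Q)
          = (\<integral>\<^sup>+u. liminf (\<lambda>k. ennreal ((cmod (X n u - X (r k) u))\<^sup>2)) \<partial>Q)"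
      proof (rule nn_integral_cong_AE)
        show "AE u in Q. ennreal ((cmod (X n u - x u))\<^sup>2)
            = liminf (\<lambda>k. ennreal ((cmod (X n u - X (r k) u))\<^sup>2))"
          using lim
          by eventually_elim
            (rule lim_imp_Liminf[symmetric], simp, intro tendsto_intros, assumption)
      qed
      also have "\<dots> \<le> liminf (\<lambda>k. \<integral>\<^sup>+u. ennreal ((cmod (X n u - X (r k) u))\<^sup>2) \<partial>Q)"
        by (rule nn_integral_liminf) measurable
      also have "\<dots> = liminf (\<lambda>k. ennreal (L2_sq Q (\<lambda>u. X n u - X (r k) u)))"
        by (simp add: L2_sq_nn_integral L2_diff X)
      also have "\<dots> \<le> ennreal e"
      proof (rule Liminf_le)
        have "\<forall>\<^sub>F k in sequentially. k \<ge> M" by (rule eventually_ge_at_top)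
        then show "\<forall>\<^sub>F k in sequentially. ennreal (L2_sq Q (\<lambda>u. X n u - X (r k) u)) \<le> ennreal e"
        proof eventually_elim
          case (elim k)
          then have "r k \<ge> M" using r_ge[of k] by simp
          from M[OF n this] show ?case by (simp add: ennreal_leI)
        qed
      qed simp
      finally show ?thesis .
    qed
    then show ?thesis by blast
  qed
  obtain M1 where M1: "(\<integral>\<^sup>+u. ennreal ((cmod (X M1 u - x u))\<^sup>2) \<partial>Q) \<le> ennreal 1"
    using bound[of 1] by auto
  have "(\<lambda>u. X M1 u - x u) \<in> L2 Q"
    using M1 by (subst L2_iff_nn_integral) (auto intro: le_less_trans)
  from L2_diff[OF X[of M1] this] have x_L2: "x \<in> L2 Q" by simp
  have "(\<lambda>n. L2_sq Q (\<lambda>u. X n u - x u)) \<longlonglongrightarrow> 0"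
  proof (rule LIMSEQ_I)
    fix e :: real assume e: "e > 0"
    from bound[of "e/2"] e obtain M
      where M: "\<And>n. n \<ge> M \<Longrightarrow> (\<integral>\<^sup>+u. ennreal ((cmod (X n u - x u))\<^sup>2) \<partial>Q) \<le> ennreal (e/2)"
      by auto
    have "norm (L2_sq Q (\<lambda>u. X n u - x u) - 0) < e" if "n \<ge> M" for n
      using M[OF that] e by (simp add: L2_sq_nn_integral L2_diff X x_L2)
    then show "\<exists>M. \<forall>n\<ge>M. norm (L2_sq Q (\<lambda>u. X n u - x u) - 0) < e" by blast
  qed
  with x_L2 show ?thesis by (rule that)
qed


section \<open>Orthonormal systems\<close>

definition orthonormal :: "'a measure \<Rightarrow> ('a \<Rightarrow> complex) set \<Rightarrow> bool" where
  "orthonormal Q B \<longleftrightarrow>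
     B \<subseteq> L2 Q \<and> (\<forall>g\<in>B. \<forall>h\<in>B. L2_inner Q g h = (if g = h then 1 else 0))"

lemma orthonormal_L2: "orthonormal Q B \<Longrightarrow> g \<in> B \<Longrightarrow> g \<in> L2 Q"
  by (auto simp: orthonormal_def)

lemma orthonormal_sq: "orthonormal Q B \<Longrightarrow> g \<in> B \<Longrightarrow> L2_sq Q g = 1"
  using L2_inner_self[of Q g] by (auto simp: orthonormal_def)

lemma orthonormal_insert:
  assumes "orthonormal Q B" "x \<in> L2 Q" "L2_sq Q x = 1" "\<And>g. g \<in> B \<Longrightarrow> L2_inner Q x g = 0"
  shows "orthonormal Q (insert x B)"
proof -
  have "L2_inner Q g x = 0" if "g \<in> B" for g
    using assms(4)[OF that] L2_inner_commute[of Q g x] by simp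
  then show ?thesis
    using assms L2_inner_self[of Q x] by (auto simp: orthonormal_def)
qed

lemma orthonormal_basis_iff:
  "orthonormal_basis Q B \<longleftrightarrow> orthonormal Q B \<and>
     (\<forall>x\<in>L2 Q. (\<forall>g\<in>B. L2_inner Q x g = 0) \<longrightarrow> (AE u in Q. x u = 0))"
  by (auto simp: orthonormal_basis_def orthonormal_def)

lemma orthonormal_inner_combination:
  assumes "orthonormal Q B" "finite F" "F \<subseteq> B" "g \<in> B"
  shows "L2_inner Q (\<lambda>u. \<Sum>h\<in>F. a h * h u) g = (if g \<in> F then a g else 0)"
proof -
  have "L2_inner Q (\<lambda>u. \<Sum>h\<in>F. a h * h u) g = (\<Sum>h\<in>F. L2_inner Q (\<lambda>u. a h * h u) g)"
    using assms by (intro L2_inner_sum_left L2_scale) (auto intro: orthonormal_L2)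
  also have "\<dots> = (\<Sum>h\<in>F. if h = g then a h else 0)"
    using assms by (intro sum.cong) (auto simp: L2_inner_scale_left orthonormal_def)
  also have "\<dots> = (if g \<in> F then a g else 0)"
    using assms(2) by simp
  finally show ?thesis .
qed

lemma orthonormal_combination_L2:
  assumes "orthonormal Q B" "F \<subseteq> B"
  shows "(\<lambda>u. \<Sum>h\<in>F. a h * h u) \<in> L2 Q"
  using assms by (intro L2_sum L2_scale) (auto intro: orthonormal_L2)

lemma orthonormal_sq_combination:
  assumes "orthonormal Q B" "finite F" "F \<subseteq> B"
  shows "L2_sq Q (\<lambda>u. \<Sum>h\<in>F. a h * h u) = (\<Sum>h\<in>F. (cmod (a h))\<^sup>2)"
proof -
  let ?y = "\<lambda>u. \<Sum>h\<in>F. a h * h u"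
  have "complex_of_real (L2_sq Q ?y) = (\<Sum>h\<in>F. L2_inner Q ?y (\<lambda>u. a h * h u))"
    unfolding L2_inner_self[symmetric] using assms
    by (intro L2_inner_sum_right L2_scale orthonormal_combination_L2) (auto intro: orthonormal_L2)
  also have "\<dots> = (\<Sum>h\<in>F. of_real ((cmod (a h))\<^sup>2))"
  proof (intro sum.cong refl)
    fix h assume "h \<in> F"
    then have "L2_inner Q ?y h = a h"
      using orthonormal_inner_combination[OF assms, of h a] assms(3) by auto
    then show "L2_inner Q ?y (\<lambda>u. a h * h u) = of_real ((cmod (a h))\<^sup>2)"
      unfolding L2_inner_scale_right by (simp add: complex_norm_square mult.commute del: of_real_power)
  qed
  finally have "complex_of_real (L2_sq Q ?y) = of_real (\<Sum>h\<in>F. (cmod (a h))\<^sup>2)"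
    by simp
  then show ?thesis unfolding of_real_eq_iff .
qed

lemma Bessel:
  assumes "orthonormal Q B" "finite F" "F \<subseteq> B" "x \<in> L2 Q"
  shows "(\<Sum>g\<in>F. (cmod (L2_inner Q x g))\<^sup>2) \<le> L2_sq Q x"
proof -
  let ?y = "\<lambda>u. \<Sum>g\<in>F. L2_inner Q x g * g u"
  have "L2_inner Q x ?y = (\<Sum>g\<in>F. L2_inner Q x (\<lambda>u. L2_inner Q x g * g u))"
    using assms by (intro L2_inner_sum_right L2_scale) (auto intro: orthonormal_L2)
  also have "\<dots> = of_real (\<Sum>g\<in>F. (cmod (L2_inner Q x g))\<^sup>2)"
    unfolding L2_inner_scale_right
    by (simp add: complex_norm_square mult.commute del: of_real_power)
  finally have "Re (L2_inner Q x ?y) = (\<Sum>g\<in>F. (cmod (L2_inner Q x g))\<^sup>2)"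
    by simp
  moreover have "0 \<le> L2_sq Q (\<lambda>u. x u - ?y u)" by simp
  ultimately show ?thesis
    using orthonormal_combination_L2[OF assms(1,3)] orthonormal_sq_combination[OF assms(1-3)] assms(4)
    by (simp add: L2_sq_diff)
qed

text \<open>
  Countable orthonormal systems, finite or not, are summed along their initial segments in
  the order given by \<^const>\<open>to_nat_on\<close>.
\<close>

definition initial_part :: "'i set \<Rightarrow> nat \<Rightarrow> 'i set" where
  "initial_part B n = {g \<in> B. to_nat_on B g < n}"

lemma finite_initial_part:
  assumes "countable B"
  shows "finite (initial_part B n)"
proof (rule finite_imageD)
  show "finite (to_nat_on B ` initial_part B n)"
    by (rule finite_subset[of _ "{..<n}"]) (auto simp: initial_part_def)
  show "inj_on (to_nat_on B) (initial_part B n)"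
    using inj_on_to_nat_on[OF assms] by (rule inj_on_subset) (auto simp: initial_part_def)
qed

lemma initial_part_subset: "initial_part B n \<subseteq> B"
  by (auto simp: initial_part_def)

lemma initial_part_mono: "m \<le> n \<Longrightarrow> initial_part B m \<subseteq> initial_part B n"
  by (auto simp: initial_part_def)

lemma eventually_initial_part:
  assumes "g \<in> B"
  shows "\<forall>\<^sub>F n in sequentially. g \<in> initial_part B n"
  using eventually_gt_at_top[of "to_nat_on B g"] assms by (auto simp: initial_part_def)

lemma eventually_initial_part_superset:
  assumes "finite F" "F \<subseteq> B"
  shows "\<forall>\<^sub>F n in sequentially. F \<subseteq> initial_part B n"
  unfolding subset_eq using assms
  by (auto simp: eventually_ball_finite_distrib intro!: eventually_initial_part)

text \<open>Three faces of one nonnegative sum: the count space integral gives Tonelli's theorem,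
  the limit compares with limits in the Hilbert space, and the supremum gives measurability.\<close>

lemma nn_integral_count_space_eq_infsum:
  fixes f :: "'i \<Rightarrow> ennreal"
  assumes "countable B"
  shows "(\<integral>\<^sup>+g. f g \<partial>count_space B) = infsum f B"
    "(\<lambda>n. \<Sum>g\<in>initial_part B n. f g) \<longlonglongrightarrow> infsum f B"
    "infsum f B = (SUP n. \<Sum>g\<in>initial_part B n. f g)"
proof -
  note fin = finite_initial_part[OF assms]
  have incseq: "incseq (\<lambda>n g. f g * indicator (initial_part B n) g)"
    by (auto simp: incseq_def le_fun_def indicator_def initial_part_def)
  have SUP: "(SUP n. f g * indicator (initial_part B n) g) = f g" if g: "g \<in> B" for g
  proof -
    from g have "f g * indicator (initial_part B (Suc (to_nat_on B g))) g = f g"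
      by (auto simp: initial_part_def)
    then show ?thesis
      by (intro antisym SUP_least SUP_upper2[of "Suc (to_nat_on B g)"]) (auto simp: indicator_def)
  qed
  have part: "(\<integral>\<^sup>+g. f g * indicator (initial_part B n) g \<partial>count_space B) = (\<Sum>g\<in>initial_part B n. f g)" for n
    using fin by (subst nn_integral_count_space'[of "initial_part B n"])
      (auto simp: initial_part_subset)
  have "(\<integral>\<^sup>+g. f g \<partial>count_space B)
      = (\<integral>\<^sup>+g. (SUP n. f g * indicator (initial_part B n) g) \<partial>count_space B)"
    using SUP by (intro nn_integral_cong) simp
  also have "\<dots> = (SUP n. \<Sum>g\<in>initial_part B n. f g)"
    unfolding part[symmetric] using incseq by (intro nn_integral_monotone_convergence_SUP) auto
  finally have 1: "(\<integral>\<^sup>+g. f g \<partial>count_space B) = (SUP n. \<Sum>g\<in>initial_part B n. f g)" .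
  have 2: "infsum f B = (SUP n. \<Sum>g\<in>initial_part B n. f g)"
    unfolding nonneg_infsum_complete[OF zero_le]
  proof (rule antisym)
    show "(SUP F\<in>{F. finite F \<and> F \<subseteq> B}. sum f F) \<le> (SUP n. \<Sum>g\<in>initial_part B n. f g)"
    proof (rule SUP_least)
      fix F assume "F \<in> {F. finite F \<and> F \<subseteq> B}"
      then obtain n where "F \<subseteq> initial_part B n"
        using eventually_initial_part_superset[of F B] by (auto simp: eventually_sequentially)
      then show "sum f F \<le> (SUP n. \<Sum>g\<in>initial_part B n. f g)"
        by (intro SUP_upper2[of n]) (auto intro!: sum_mono2 fin)
    qed
    show "(SUP n. \<Sum>g\<in>initial_part B n. f g) \<le> (SUP F\<in>{F. finite F \<and> F \<subseteq> B}. sum f F)"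
      by (rule SUP_least, rule SUP_upper) (auto simp: fin initial_part_subset[THEN subsetD])
  qed
  show "(\<integral>\<^sup>+g. f g \<partial>count_space B) = infsum f B"
    unfolding 1 2 ..
  show "(\<lambda>n. \<Sum>g\<in>initial_part B n. f g) \<longlonglongrightarrow> infsum f B"
    unfolding 2 by (rule LIMSEQ_SUP) (auto simp: incseq_def intro!: sum_mono2 fin initial_part_mono)
  show "infsum f B = (SUP n. \<Sum>g\<in>initial_part B n. f g)" by (fact 2)
qed

lemma borel_measurable_infsum_ennreal:
  fixes f :: "'i \<Rightarrow> 'a \<Rightarrow> ennreal"
  assumes "countable B" "\<And>g. g \<in> B \<Longrightarrow> f g \<in> borel_measurable Q"
  shows "(\<lambda>u. \<Sum>\<^sub>\<infinity>g\<in>B. f g u) \<in> borel_measurable Q"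
  unfolding nn_integral_count_space_eq_infsum(3)[OF assms(1)]
  using assms(2) initial_part_subset[of B]
  by (intro borel_measurable_SUP borel_measurable_sum) auto

lemma nn_integral_infsum:
  fixes f :: "'i \<Rightarrow> 'a \<Rightarrow> ennreal"
  assumes "countable B" "\<And>g. g \<in> B \<Longrightarrow> f g \<in> borel_measurable Q"
  shows "(\<integral>\<^sup>+u. (\<Sum>\<^sub>\<infinity>g\<in>B. f g u) \<partial>Q) = (\<Sum>\<^sub>\<infinity>g\<in>B. \<integral>\<^sup>+u. f g u \<partial>Q)"
  unfolding nn_integral_count_space_eq_infsum(1)[OF assms(1), symmetric]
  using assms by (rule nn_integral_count_space_nn_integral)

section \<open>Expansions in an orthonormal system\<close>

lemma borel_measurable_cmod_sq:
  assumes "x \<in> L2 Q"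
  shows "(\<lambda>u. ennreal ((cmod (x u))\<^sup>2)) \<in> borel_measurable Q"
proof -
  note [measurable] = L2D(1)[OF assms]
  show ?thesis by measurable
qed

text \<open>By orthonormality the squared distance of two partial sums is a difference of two values
  of the bounded monotone sequence \<open>S\<close>, so the partial sums are Cauchy.\<close>

lemma Riesz_Fischer:
  assumes "orthonormal Q B" "countable B"
    and bdd: "\<And>F. finite F \<Longrightarrow> F \<subseteq> B \<Longrightarrow> (\<Sum>g\<in>F. (cmod (a g))\<^sup>2) \<le> C"
  obtains x where "x \<in> L2 Q" "\<And>g. g \<in> B \<Longrightarrow> L2_inner Q x g = a g"
    "(\<lambda>n. L2_sq Q (\<lambda>u. (\<Sum>g\<in>initial_part B n. a g * g u) - x u)) \<longlonglongrightarrow> 0"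
proof -
  note fin = finite_initial_part[OF assms(2)]
  define X where "X n u = (\<Sum>g\<in>initial_part B n. a g * g u)" for n u
  have X: "X n \<in> L2 Q" for n
    unfolding X_def by (rule orthonormal_combination_L2[OF assms(1) initial_part_subset])
  define S where "S n = (\<Sum>g\<in>initial_part B n. (cmod (a g))\<^sup>2)" for n
  have X_diff: "L2_sq Q (\<lambda>u. X n u - X m u) = S n - S m" if "m \<le> n" for m n
  proof -
    have "X n u - X m u = (\<Sum>g\<in>initial_part B n - initial_part B m. a g * g u)" for u
      unfolding X_def using fin initial_part_mono[OF that, of B] by (subst sum_diff) auto
    then have "L2_sq Q (\<lambda>u. X n u - X m u) = (\<Sum>g\<in>initial_part B n - initial_part B m. (cmod (a g))\<^sup>2)"
      using orthonormal_sq_combination[OF assms(1), of "initial_part B n - initial_part B m" a] fin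
      by (auto simp: initial_part_def)
    also have "\<dots> = S n - S m"
      unfolding S_def using fin initial_part_mono[OF that, of B] by (subst sum_diff) auto
    finally show ?thesis .
  qed
  have "convergent S"
  proof (rule Bseq_mono_convergent)
    show "\<forall>m n. m \<le> n \<longrightarrow> S m \<le> S n"
      unfolding S_def using fin by (auto intro!: sum_mono2 initial_part_mono)
    have "\<bar>S n\<bar> \<le> C" for n
      using bdd[OF fin initial_part_subset] by (simp add: S_def sum_nonneg)
    then show "Bseq S" by (intro BseqI'[of _ C]) simp
  qed
  then have CS: "Cauchy S" by (rule convergent_Cauchy)
  have "\<exists>N. \<forall>m\<ge>N. \<forall>n\<ge>N. L2_sq Q (\<lambda>u. X m u - X n u) < e" if e: "e > 0" for e
  proof -
    obtain N where N: "\<And>m n. m \<ge> N \<Longrightarrow> n \<ge> N \<Longrightarrow> \<bar>S m - S n\<bar> < e"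
      using CauchyD[OF CS e] by auto
    have "L2_sq Q (\<lambda>u. X m u - X n u) < e" if "m \<ge> N" "n \<ge> N" for m n
    proof (cases "m \<le> n")
      case True
      then show ?thesis
        using N[OF that] X_diff[of m n] by (subst L2_sq_minus_commute) simp
    next
      case False
      then show ?thesis using N[OF that] X_diff[of n m] by simp
    qed
    then show ?thesis by blast
  qed
  from L2_complete[OF X this] obtain x
    where x: "x \<in> L2 Q" "(\<lambda>n. L2_sq Q (\<lambda>u. X n u - x u)) \<longlonglongrightarrow> 0"
    by blast
  have "L2_inner Q x g = a g" if g: "g \<in> B" for g
  proof (rule LIMSEQ_unique)
    show "(\<lambda>n. L2_inner Q (X n) g) \<longlonglongrightarrow> L2_inner Q x g"
      using orthonormal_L2[OF assms(1) g] by (intro L2_inner_tendsto X x)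
    have "\<forall>\<^sub>F n in sequentially. L2_inner Q (X n) g = a g"
      using eventually_initial_part[OF g]
      unfolding X_def orthonormal_inner_combination[OF assms(1) fin initial_part_subset g]
      by eventually_elim simp
    then show "(\<lambda>n. L2_inner Q (X n) g) \<longlonglongrightarrow> a g"
      by (rule tendsto_eventually)
  qed
  with x show ?thesis unfolding X_def by (intro that) auto
qed

text \<open>The expansion converges to some \<open>y\<close> with the same coefficients as
  \<open>x\<close>; completeness of the basis, applied to \<open>y - x\<close>, identifies the two
  almost everywhere.\<close>

lemma orthonormal_basis_expansion:
  assumes "orthonormal_basis Q B" "countable B" "x \<in> L2 Q"
  shows "(\<lambda>n. L2_sq Q (\<lambda>u. (\<Sum>g\<in>initial_part B n. L2_inner Q x g * g u) - x u)) \<longlonglongrightarrow> 0"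
proof -
  have B: "orthonormal Q B" using assms(1) by (simp add: orthonormal_basis_iff)
  obtain y where y: "y \<in> L2 Q" "\<And>g. g \<in> B \<Longrightarrow> L2_inner Q y g = L2_inner Q x g"
    "(\<lambda>n. L2_sq Q (\<lambda>u. (\<Sum>g\<in>initial_part B n. L2_inner Q x g * g u) - y u)) \<longlonglongrightarrow> 0"
    using Riesz_Fischer[OF B assms(2), of "L2_inner Q x" "L2_sq Q x"] Bessel[OF B _ _ assms(3)] by blast
  have "AE u in Q. y u - x u = 0"
    using assms(1) L2_diff[OF y(1) assms(3)] y(2) orthonormal_L2[OF B]
    by (auto simp: orthonormal_basis_iff L2_inner_diff_left y(1) assms(3))
  then have "L2_sq Q (\<lambda>u. (\<Sum>g\<in>initial_part B n. L2_inner Q x g * g u) - y u)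
      = L2_sq Q (\<lambda>u. (\<Sum>g\<in>initial_part B n. L2_inner Q x g * g u) - x u)" for n
    using orthonormal_combination_L2[OF B initial_part_subset] y(1) assms(3)
    by (intro L2_sq_cong_AE L2D(1) L2_diff) auto
  with y(3) show ?thesis by simp
qed

lemma Parseval_inner:
  assumes "orthonormal_basis Q B" "countable B" "x \<in> L2 Q" "y \<in> L2 Q"
  shows "(\<lambda>n. \<Sum>g\<in>initial_part B n. L2_inner Q x g * L2_inner Q g y) \<longlonglongrightarrow> L2_inner Q x y"
proof -
  have B: "orthonormal Q B" using assms(1) by (simp add: orthonormal_basis_iff)
  have "L2_inner Q (\<lambda>u. \<Sum>g\<in>initial_part B n. L2_inner Q x g * g u) y
      = (\<Sum>g\<in>initial_part B n. L2_inner Q x g * L2_inner Q g y)" for n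
    using orthonormal_L2[OF B] initial_part_subset[of B n] assms(4)
    by (subst L2_inner_sum_left) (auto simp: L2_inner_scale_left intro!: L2_scale)
  moreover have "(\<lambda>n. L2_inner Q (\<lambda>u. \<Sum>g\<in>initial_part B n. L2_inner Q x g * g u) y)
      \<longlonglongrightarrow> L2_inner Q x y"
    by (intro L2_inner_tendsto orthonormal_combination_L2[OF B initial_part_subset] assms
        orthonormal_basis_expansion)
  ultimately show ?thesis by simp
qed

lemma infsum_ennreal_eqI:
  assumes "countable B" "\<And>g. g \<in> B \<Longrightarrow> 0 \<le> f g"
    and "(\<lambda>n. \<Sum>g\<in>initial_part B n. f g) \<longlonglongrightarrow> L"
  shows "(\<Sum>\<^sub>\<infinity>g\<in>B. ennreal (f g)) = ennreal L"
proof (rule LIMSEQ_unique[OF nn_integral_count_space_eq_infsum(2)[OF assms(1)]])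
  have "(\<Sum>g\<in>initial_part B n. ennreal (f g)) = ennreal (\<Sum>g\<in>initial_part B n. f g)" for n
    using assms(2) initial_part_subset[of B n] by (intro sum_ennreal) auto
  then show "(\<lambda>n. \<Sum>g\<in>initial_part B n. ennreal (f g)) \<longlonglongrightarrow> ennreal L"
    using tendsto_ennrealI[OF assms(3)] by simp
qed

lemma Parseval:
  assumes "orthonormal_basis Q B" "countable B" "x \<in> L2 Q"
  shows "(\<Sum>\<^sub>\<infinity>g\<in>B. ennreal ((cmod (L2_inner Q x g))\<^sup>2)) = ennreal (L2_sq Q x)"
proof (rule infsum_ennreal_eqI[OF assms(2)])
  have "(\<Sum>g\<in>initial_part B n. L2_inner Q x g * L2_inner Q g x)
      = of_real (\<Sum>g\<in>initial_part B n. (cmod (L2_inner Q x g))\<^sup>2)" for n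
    by (simp add: complex_norm_square L2_inner_commute[of Q _ x] del: of_real_power)
  then show "(\<lambda>n. \<Sum>g\<in>initial_part B n. (cmod (L2_inner Q x g))\<^sup>2) \<longlonglongrightarrow> L2_sq Q x"
    using Parseval_inner[OF assms assms(3)] by (simp only: L2_inner_self tendsto_of_real_iff)
qed simp

text \<open>Zorn's lemma, with a constraint \<open>D\<close> that serves two purposes:
  \<open>UNIV\<close> yields an orthonormal basis, the set of eigenfunctions yields an
  eigenbasis.\<close>

lemma maximal_orthonormal_subset:
  obtains B where "orthonormal Q B" "B \<subseteq> D"
    "\<And>x. x \<in> L2 Q \<Longrightarrow> x \<in> D \<Longrightarrow> L2_sq Q x = 1 \<Longrightarrow> (\<And>g. g \<in> B \<Longrightarrow> L2_inner Q x g = 0) \<Longrightarrow> False"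
proof -
  define \<A> where "\<A> = {B. orthonormal Q B \<and> B \<subseteq> D}"
  have "\<exists>B\<in>\<A>. \<forall>X\<in>\<A>. B \<subseteq> X \<longrightarrow> X = B"
  proof (rule subset_Zorn')
    fix C assume C: "subset.chain \<A> C"
    then have sub: "C \<subseteq> \<A>" and chain: "\<And>X Y. X \<in> C \<Longrightarrow> Y \<in> C \<Longrightarrow> X \<subseteq> Y \<or> Y \<subseteq> X"
      by (auto simp: subset_chain_def)
    have "L2_inner Q g h = (if g = h then 1 else 0)" if "g \<in> \<Union>C" "h \<in> \<Union>C" for g h
    proof -
      from that obtain X Y where "X \<in> C" "Y \<in> C" "g \<in> X" "h \<in> Y" by blast
      with chain[of X Y] obtain Z where "Z \<in> C" "g \<in> Z" "h \<in> Z" by blast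
      with sub show ?thesis by (auto simp: \<A>_def orthonormal_def)
    qed
    with sub show "\<Union>C \<in> \<A>" by (auto simp: \<A>_def orthonormal_def)
  qed
  then obtain B where B: "B \<in> \<A>" "\<And>X. X \<in> \<A> \<Longrightarrow> B \<subseteq> X \<Longrightarrow> X = B" by blast
  show ?thesis
  proof (rule that[of B])
    show "orthonormal Q B" "B \<subseteq> D" using B(1) by (auto simp: \<A>_def)
    fix x assume x: "x \<in> L2 Q" "x \<in> D" "L2_sq Q x = 1" "\<And>g. g \<in> B \<Longrightarrow> L2_inner Q x g = 0"
    have "insert x B \<in> \<A>"
      using orthonormal_insert[OF _ x(1,3,4)] B(1) x(2) by (auto simp: \<A>_def)
    with B(2)[of "insert x B"] have "x \<in> B" by blast
    with x(4)[of x] x(3) L2_inner_self[of Q x] show False by simp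
  qed
qed

lemma L2_normalize:
  assumes "x \<in> L2 Q" "\<not> (AE u in Q. x u = 0)"
  defines "y \<equiv> \<lambda>u. of_real (1 / sqrt (L2_sq Q x)) * x u"
  shows "y \<in> L2 Q" "L2_sq Q y = 1"
proof -
  show "y \<in> L2 Q" unfolding y_def by (rule L2_scale[OF assms(1)])
  have "L2_sq Q x \<noteq> 0" using assms by (simp add: L2_sq_eq_0_iff)
  then show "L2_sq Q y = 1"
    unfolding y_def L2_sq_scale norm_of_real by (simp add: power_divide)
qed

lemma ex_orthonormal_basis: "\<exists>B. orthonormal_basis Q B"
proof -
  obtain B where B: "orthonormal Q B"
    "\<And>x. x \<in> L2 Q \<Longrightarrow> L2_sq Q x = 1 \<Longrightarrow> (\<And>g. g \<in> B \<Longrightarrow> L2_inner Q x g = 0) \<Longrightarrow> False"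
    using maximal_orthonormal_subset[of Q UNIV] by auto
  have "AE u in Q. x u = 0" if x: "x \<in> L2 Q" "\<forall>g\<in>B. L2_inner Q x g = 0" for x
  proof (rule ccontr)
    assume "\<not> (AE u in Q. x u = 0)"
    note y = L2_normalize[OF x(1) this]
    show False by (rule B(2)[OF y], unfold L2_inner_scale_left) (simp add: x(2))
  qed
  with B(1) have "orthonormal_basis Q B" by (simp add: orthonormal_basis_iff)
  then show ?thesis ..
qed

section \<open>Countably generated probability spaces\<close>

text \<open>Dynkin's argument: the sets over which a fixed integrable function integrates to 0 are
  closed under complements and countable disjoint unions once the whole space is among them. Hence
  the countable pi-system of finite intersections of generators decides.\<close>

lemma countable_determining_class:
  assumes "finite_measure Q" "countably_generated Q"
  obtains C where "countable C" "C \<subseteq> sets Q"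
    "\<And>x :: 'a \<Rightarrow> complex. integrable Q x \<Longrightarrow> (\<And>c. c \<in> C \<Longrightarrow> (\<integral>u. x u * indicator c u \<partial>Q) = 0)
       \<Longrightarrow> AE u in Q. x u = 0"
proof -
  interpret finite_measure Q by fact
  obtain G where G: "countable G" "G \<subseteq> Pow (space Q)" "sets Q = sigma_sets (space Q) G"
    using assms(2) by (auto simp: countably_generated_def)
  \<comment> \<open>The intersection with \<open>space Q\<close> lets the empty family contribute
    the whole space, which the complement step needs.\<close>
  define C where "C = (\<lambda>F. space Q \<inter> \<Inter>F) ` {F. finite F \<and> F \<subseteq> G}"
  have C_countable: "countable C"
    unfolding C_def using countable_Collect_finite_subset[OF G(1)]
    by (intro countable_image) (simp add: conj_commute)
  have G_sets: "G \<subseteq> sets Q"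
    using G(3) by auto
  have C_sets: "C \<subseteq> sets Q"
  proof
    fix c assume "c \<in> C"
    then obtain F where F: "finite F" "F \<subseteq> G" "c = space Q \<inter> \<Inter>F" by (auto simp: C_def)
    show "c \<in> sets Q"
    proof (cases "F = {}")
      case False
      then have "(\<Inter>a\<in>F. a) \<in> sets Q" using F G_sets by (intro sets.finite_INT) auto
      then show ?thesis using F(3) by simp
    qed (use F in simp)
  qed
  have C_stable: "Int_stable C"
  proof (rule Int_stableI)
    fix a b assume "a \<in> C" "b \<in> C"
    then obtain F F' where "finite F" "F \<subseteq> G" "a = space Q \<inter> \<Inter>F"
      "finite F'" "F' \<subseteq> G" "b = space Q \<inter> \<Inter>F'" by (auto simp: C_def)
    then show "a \<inter> b \<in> C"
      unfolding C_def by (intro image_eqI[where x="F \<union> F'"]) auto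
  qed
  have "G \<subseteq> C"
  proof
    fix g assume "g \<in> G"
    then show "g \<in> C" unfolding C_def using G(2) by (intro image_eqI[where x="{g}"]) auto
  qed
  then have C_gen: "sets Q = sigma_sets (space Q) C"
    using G(3) C_sets sets.sigma_sets_subset[OF C_sets] sigma_sets_mono'[of G C "space Q"] by blast
  have "AE u in Q. x u = 0"
    if x: "integrable Q x" and 0: "\<And>c. c \<in> C \<Longrightarrow> (\<integral>u. x u * indicator c u \<partial>Q) = 0"
    for x :: "'a \<Rightarrow> complex"
  proof (rule density_zero[OF x])
    have set_int: "set_lebesgue_integral Q A x = (\<integral>u. x u * indicator A u \<partial>Q)" for A
      unfolding set_lebesgue_integral_def
      by (intro Bochner_Integration.integral_cong) (auto simp: indicator_def)
    fix A assume "A \<in> sets Q"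
    then have A: "A \<in> sigma_sets (space Q) C" using C_gen by simp
    have "space Q \<in> C" unfolding C_def by (intro image_eqI[where x="{}"]) auto
    from 0[OF this] have space: "set_lebesgue_integral Q (space Q) x = 0" by (simp add: set_int)
    have int: "set_integrable Q A x" if "A \<in> sets Q" for A
      unfolding set_integrable_def by (rule integrable_mult_indicator[OF that x])
    have "C \<subseteq> Pow (space Q)" using C_sets sets.sets_into_space by blast
    with C_stable show "set_lebesgue_integral Q A x = 0" using A
    proof (induction rule: sigma_sets_induct_disjoint)
      case (basic A)
      then show ?case using 0 by (simp add: set_int)
    next
      case empty
      then show ?case by (simp add: set_int)
    next
      case (compl A)
      then have A: "A \<in> sets Q" using C_gen by simp
      have "set_lebesgue_integral Q ((space Q - A) \<union> A) x
          = set_lebesgue_integral Q (space Q - A) x + set_lebesgue_integral Q A x"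
        using A by (intro set_integral_Un int) auto
      also have "(space Q - A) \<union> A = space Q" using sets.sets_into_space[OF A] by blast
      finally show ?case using compl(2) space by simp
    next
      case (union A)
      then have A: "A i \<in> sets Q" for i using C_gen by auto
      have "set_lebesgue_integral Q (\<Union>i. A i) x = (\<Sum>i. set_lebesgue_integral Q (A i) x)"
        using union(1) A
        by (intro lebesgue_integral_countable_add int) (auto simp: disjoint_family_on_def)
      then show ?case using union(3) by simp
    qed
  qed
  with C_countable C_sets show ?thesis by (rule that)
qed

lemma (in finite_measure) L2_indicator:
  assumes [measurable]: "c \<in> sets M"
  shows "indicator c \<in> L2 M"
proof -
  have "integrable M (\<lambda>u. (cmod (indicator c u))\<^sup>2)"
    by (rule integrable_const_bound[of _ 1]) (auto simp: indicator_def)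
  then show ?thesis by (simp add: L2_def)
qed

lemma L2_inner_indicator: "L2_inner Q x (indicator c) = (\<integral>u. x u * indicator c u \<partial>Q)"
  unfolding L2_inner_def by (intro Bochner_Integration.integral_cong) (auto simp: indicator_def)

lemma (in finite_measure) L2_integrable:
  assumes "x \<in> L2 M"
  shows "integrable M x"
proof -
  have "integrable M (\<lambda>u. x u * indicator (space M) u)"
    by (rule L2_integrable_mult(1)[OF assms L2_indicator[OF sets.top]])
  then show ?thesis
    by (subst Bochner_Integration.integrable_cong[of M M x "\<lambda>u. x u * indicator (space M) u"]) auto
qed

text \<open>By Bessel's inequality each test indicator has only countably many nonzero coefficients,
  and an element of \<open>B\<close> orthogonal to all test indicators would vanish almost
  everywhere.\<close>

lemma countable_orthonormal:
  assumes "finite_measure Q" "countably_generated Q" "orthonormal Q B"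
  shows "countable B"
proof -
  interpret finite_measure Q by fact
  obtain C where C: "countable C" "C \<subseteq> sets Q"
    "\<And>x :: 'a \<Rightarrow> complex. integrable Q x \<Longrightarrow> (\<And>c. c \<in> C \<Longrightarrow> (\<integral>u. x u * indicator c u \<partial>Q) = 0)
       \<Longrightarrow> AE u in Q. x u = 0"
    using countable_determining_class[OF assms(1,2)] by blast
  define S where "S c = {g \<in> B. (cmod (L2_inner Q (indicator c) g))\<^sup>2 \<noteq> 0}" for c
  have "countable (S c)" if "c \<in> C" for c
  proof -
    have "indicator c \<in> L2 Q" using L2_indicator C(2) that by auto
    then have "(\<lambda>g. (cmod (L2_inner Q (indicator c) g))\<^sup>2) summable_on B"
      using Bessel[OF assms(3)]
      by (intro nonneg_bdd_above_summable_on) (auto intro!: bdd_aboveI)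
    then show ?thesis unfolding S_def by (rule summable_countable_real)
  qed
  then have "countable (\<Union>c\<in>C. S c)" using C(1) by blast
  moreover have "B \<subseteq> (\<Union>c\<in>C. S c)"
  proof
    fix g assume g: "g \<in> B"
    note gL = orthonormal_L2[OF assms(3) g]
    show "g \<in> (\<Union>c\<in>C. S c)"
    proof (rule ccontr)
      assume "g \<notin> (\<Union>c\<in>C. S c)"
      then have "L2_inner Q (indicator c) g = 0" if "c \<in> C" for c
        using that g by (auto simp: S_def)
      then have "L2_inner Q g (indicator c) = 0" if "c \<in> C" for c
        using that L2_inner_commute[of Q g "indicator c"] by simp
      then have "(\<integral>u. g u * indicator c u \<partial>Q) = 0" if "c \<in> C" for c
        using that by (simp add: L2_inner_indicator)
      then have "AE u in Q. g u = 0" using C(3)[OF L2_integrable[OF gL]] by blast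
      then show False using L2_sq_eq_0_iff[OF gL] orthonormal_sq[OF assms(3) g] by simp
    qed
  qed
  ultimately show ?thesis by (rule countable_subset[rotated])
qed

section \<open>Conditional expectation operators with a density\<close>

text \<open>The value is 0 by default where the integrand is not integrable. For a
  \<open>kernel_pair\<close> and \<open>x\<close> in \<open>L2 Q\<close> this concerns only a null
  set of points \<open>v\<close>.\<close>

definition kernel_int :: "'a measure \<Rightarrow> ('a \<Rightarrow> 'b \<Rightarrow> real) \<Rightarrow> ('a \<Rightarrow> complex) \<Rightarrow> 'b \<Rightarrow> complex" where
  "kernel_int Q h x v = (\<integral>u. of_real (h u v) * x u \<partial>Q)"

text \<open>The assumptions are symmetric in \<open>Q\<close> and \<open>R\<close>, so that each
  fact about the conditional expectation operator transfers to its adjoint. The marginals are 1 only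
  almost everywhere because a quotient of densities is normalized only where its denominator is
  positive and finite.\<close>

locale kernel_pair = Q: prob_space Q + R: prob_space R
  for Q :: "'a measure" and R :: "'b measure" +
  fixes h :: "'a \<Rightarrow> 'b \<Rightarrow> real"
  assumes h_borel: "(\<lambda>w. h (fst w) (snd w)) \<in> borel_measurable (Q \<Otimes>\<^sub>M R)"
    and h_nonneg [simp]: "0 \<le> h u v"
    and h_marginal_R: "AE v in R. (\<integral>\<^sup>+u. ennreal (h u v) \<partial>Q) = 1"
    and h_marginal_Q: "AE u in Q. (\<integral>\<^sup>+v. ennreal (h u v) \<partial>R) = 1"
begin

sublocale pair_sigma_finite Q R ..

lemma h_measurable [measurable (raw)]:
  assumes "f \<in> L \<rightarrow>\<^sub>M Q" "g \<in> L \<rightarrow>\<^sub>M R"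
  shows "(\<lambda>w. h (f w) (g w)) \<in> borel_measurable L"
  using measurable_compose[OF measurable_Pair[OF assms] h_borel] by simp

lemma swap: "kernel_pair R Q (\<lambda>v u. h u v)"
  by unfold_locales (auto simp: h_marginal_Q h_marginal_R)

text \<open>The tower property of conditional expectation, by Tonelli's theorem.\<close>

lemma nn_integral_marginal:
  assumes [measurable]: "a \<in> borel_measurable Q"
  shows "(\<integral>\<^sup>+v. \<integral>\<^sup>+u. ennreal (h u v) * a u \<partial>Q \<partial>R) = (\<integral>\<^sup>+u. a u \<partial>Q)"
proof -
  have "(\<integral>\<^sup>+v. \<integral>\<^sup>+u. ennreal (h u v) * a u \<partial>Q \<partial>R) = (\<integral>\<^sup>+u. \<integral>\<^sup>+v. ennreal (h u v) * a u \<partial>R \<partial>Q)"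
    by (rule Fubini'[of "\<lambda>u v. ennreal (h u v) * a u"]) measurable
  also have "\<dots> = (\<integral>\<^sup>+u. (\<integral>\<^sup>+v. ennreal (h u v) \<partial>R) * a u \<partial>Q)"
    by (simp add: nn_integral_multc cong: nn_integral_cong)
  also have "\<dots> = (\<integral>\<^sup>+u. a u \<partial>Q)"
    using h_marginal_Q by (intro nn_integral_cong_AE) auto
  finally show ?thesis .
qed

abbreviation A where "A \<equiv> kernel_int Q h"

text \<open>Conditional Jensen inequality at a single \<open>v\<close>: write h = sqrt h * sqrt h
  and apply Cauchy-Schwarz, where the factor sqrt h alone has norm 1 by the marginal
  condition.\<close>

lemma A_pointwise:
  assumes v: "v \<in> space R" and x [measurable]: "x \<in> borel_measurable Q"
    and 1: "(\<integral>\<^sup>+u. ennreal (h u v) \<partial>Q) = 1"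
    and fin: "(\<integral>\<^sup>+u. ennreal (h u v) * ennreal ((cmod (x u))\<^sup>2) \<partial>Q) < \<infinity>"
  shows "integrable Q (\<lambda>u. of_real (h u v) * x u)"
    "ennreal ((cmod (A x v))\<^sup>2) \<le> (\<integral>\<^sup>+u. ennreal (h u v) * ennreal ((cmod (x u))\<^sup>2) \<partial>Q)"
proof -
  note [measurable] = v
  define f where "f u = complex_of_real (sqrt (h u v))" for u
  define g where "g u = complex_of_real (sqrt (h u v)) * x u" for u
  have [measurable]: "f \<in> borel_measurable Q" "g \<in> borel_measurable Q"
    unfolding f_def g_def by measurable
  have f_sq: "ennreal ((cmod (f u))\<^sup>2) = ennreal (h u v)" for u
    unfolding f_def by simp
  have g_sq: "ennreal ((cmod (g u))\<^sup>2) = ennreal (h u v) * ennreal ((cmod (x u))\<^sup>2)" for u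
    unfolding g_def by (simp add: norm_mult power_mult_distrib ennreal_mult)
  have f: "f \<in> L2 Q" using 1 by (subst L2_iff_nn_integral) (auto simp: f_sq)
  have g: "g \<in> L2 Q" using fin by (subst L2_iff_nn_integral) (auto simp: g_sq)
  have fg: "g u * cnj (f u) = of_real (h u v) * x u" for u
    unfolding f_def g_def by (simp add: mult.left_commute mult.assoc flip: of_real_mult)
  show "integrable Q (\<lambda>u. of_real (h u v) * x u)"
    using L2_integrable_mult(2)[OF g f] by (simp add: fg)
  have A: "A x v = L2_inner Q g f"
    unfolding kernel_int_def L2_inner_def by (simp add: fg)
  have "ennreal (L2_sq Q f) = 1" using L2_sq_nn_integral[OF f] 1 by (simp add: f_sq)
  then have "L2_sq Q f = 1" by simp
  then have "(cmod (A x v))\<^sup>2 \<le> L2_sq Q g"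
    using L2_Cauchy_Schwarz[OF g f] by (simp add: A)
  then have "ennreal ((cmod (A x v))\<^sup>2) \<le> ennreal (L2_sq Q g)" by (rule ennreal_leI)
  also have "\<dots> = (\<integral>\<^sup>+u. ennreal (h u v) * ennreal ((cmod (x u))\<^sup>2) \<partial>Q)"
    using L2_sq_nn_integral[OF g] by (simp add: g_sq)
  finally show "ennreal ((cmod (A x v))\<^sup>2) \<le> (\<integral>\<^sup>+u. ennreal (h u v) * ennreal ((cmod (x u))\<^sup>2) \<partial>Q)" .
qed

lemma A_measurable [measurable]:
  assumes [measurable]: "x \<in> borel_measurable Q"
  shows "A x \<in> borel_measurable R"
  unfolding kernel_int_def by measurable

lemma AE_second_moment:
  assumes "x \<in> L2 Q"
  shows "AE v in R. (\<integral>\<^sup>+u. ennreal (h u v) * ennreal ((cmod (x u))\<^sup>2) \<partial>Q) < \<infinity>"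
proof -
  note [measurable] = L2D(1)[OF assms]
  have "(\<integral>\<^sup>+v. \<integral>\<^sup>+u. ennreal (h u v) * ennreal ((cmod (x u))\<^sup>2) \<partial>Q \<partial>R) \<noteq> \<infinity>"
    by (subst nn_integral_marginal) (auto simp: L2_sq_nn_integral[OF assms])
  then have "AE v in R. (\<integral>\<^sup>+u. ennreal (h u v) * ennreal ((cmod (x u))\<^sup>2) \<partial>Q) \<noteq> \<infinity>"
    by (intro nn_integral_PInf_AE) auto
  then show ?thesis by eventually_elim (simp add: less_top)
qed

lemma A_AE_integrable:
  assumes "x \<in> L2 Q"
  shows "AE v in R. integrable Q (\<lambda>u. of_real (h u v) * x u)"
  using AE_second_moment[OF assms] h_marginal_R AE_space
  by eventually_elim (intro A_pointwise(1) L2D(1)[OF assms])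

lemma
  assumes "x \<in> L2 Q"
  shows A_L2: "A x \<in> L2 R" and A_contraction: "L2_sq R (A x) \<le> L2_sq Q x"
proof -
  note [measurable] = L2D(1)[OF assms]
  have "(\<integral>\<^sup>+v. ennreal ((cmod (A x v))\<^sup>2) \<partial>R)
      \<le> (\<integral>\<^sup>+v. \<integral>\<^sup>+u. ennreal (h u v) * ennreal ((cmod (x u))\<^sup>2) \<partial>Q \<partial>R)"
    by (intro nn_integral_mono_AE)
      (use AE_second_moment[OF assms] h_marginal_R AE_space in
        \<open>eventually_elim, intro A_pointwise(2) L2D(1)[OF assms]\<close>)
  also have "\<dots> = ennreal (L2_sq Q x)"
    by (subst nn_integral_marginal) (auto simp: L2_sq_nn_integral[OF assms])
  finally have le: "(\<integral>\<^sup>+v. ennreal ((cmod (A x v))\<^sup>2) \<partial>R) \<le> ennreal (L2_sq Q x)" .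
  show "A x \<in> L2 R"
    using le by (subst L2_iff_nn_integral) (auto intro: le_less_trans)
  from le show "L2_sq R (A x) \<le> L2_sq Q x"
    by (simp add: L2_sq_nn_integral[OF \<open>A x \<in> L2 R\<close>])
qed

text \<open>Scaling and conjugation respect even the default value of a divergent integral, so they
  hold at every \<open>v\<close>. Sums and differences require integrability and therefore hold only
  almost everywhere.\<close>

lemma A_scale: "A (\<lambda>u. c * x u) v = c * A x v"
proof -
  have "A (\<lambda>u. c * x u) v = (\<integral>u. c * (of_real (h u v) * x u) \<partial>Q)"
    unfolding kernel_int_def by (simp add: mult.left_commute)
  also have "\<dots> = c * A x v" unfolding kernel_int_def by simp
  finally show ?thesis .
qed

lemma A_cnj: "A (\<lambda>u. cnj (x u)) v = cnj (A x v)"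
proof -
  have "A (\<lambda>u. cnj (x u)) v = (\<integral>u. cnj (of_real (h u v) * x u) \<partial>Q)"
    unfolding kernel_int_def by simp
  also have "\<dots> = cnj (A x v)" unfolding kernel_int_def by (rule Bochner_Integration.integral_cnj)
  finally show ?thesis .
qed

text \<open>The equality holds at every \<open>v\<close> and not only almost everywhere, since the
  exceptional \<open>Q\<close>-null set does not depend on \<open>v\<close>.\<close>

lemma A_cong_AE:
  assumes "x \<in> borel_measurable Q" "y \<in> borel_measurable Q" "AE u in Q. x u = y u" "v \<in> space R"
  shows "A x v = A y v"
proof -
  note [measurable] = assms(1,2,4)
  show ?thesis unfolding kernel_int_def using assms(3) by (intro integral_cong_AE) auto
qed

lemma A_sum:
  assumes "finite F" "\<And>g. g \<in> F \<Longrightarrow> X g \<in> L2 Q"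
  shows "AE v in R. A (\<lambda>u. \<Sum>g\<in>F. X g u) v = (\<Sum>g\<in>F. A (X g) v)"
proof -
  have "AE v in R. \<forall>g\<in>F. integrable Q (\<lambda>u. of_real (h u v) * X g u)"
    using assms by (intro AE_finite_allI A_AE_integrable)
  then show ?thesis
    by eventually_elim (simp add: kernel_int_def sum_distrib_left)
qed

lemma A_add:
  assumes "x \<in> L2 Q" "y \<in> L2 Q"
  shows "AE v in R. A (\<lambda>u. x u + y u) v = A x v + A y v"
  using A_AE_integrable[OF assms(1)] A_AE_integrable[OF assms(2)]
  by eventually_elim (simp add: kernel_int_def distrib_left)

lemma A_diff:
  assumes "x \<in> L2 Q" "y \<in> L2 Q"
  shows "AE v in R. A (\<lambda>u. x u - y u) v = A x v - A y v"
  using A_AE_integrable[OF assms(1)] A_AE_integrable[OF assms(2)]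
  by eventually_elim (simp add: kernel_int_def right_diff_distrib)

lemma A_tendsto:
  assumes "\<And>n. X n \<in> L2 Q" "x \<in> L2 Q" "(\<lambda>n. L2_sq Q (\<lambda>u. X n u - x u)) \<longlonglongrightarrow> 0"
  shows "(\<lambda>n. L2_sq R (\<lambda>v. A (X n) v - A x v)) \<longlonglongrightarrow> 0"
proof (rule tendsto_sandwich[OF _ _ tendsto_const assms(3)])
  have "L2_sq R (\<lambda>v. A (X n) v - A x v) = L2_sq R (A (\<lambda>u. X n u - x u))" for n
    using assms(1,2) A_diff[OF assms(1,2), of n]
    by (intro L2_sq_cong_AE L2D(1) L2_diff A_L2) auto
  then show "\<forall>\<^sub>F n in sequentially. L2_sq R (\<lambda>v. A (X n) v - A x v) \<le> L2_sq Q (\<lambda>u. X n u - x u)"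
    using A_contraction[OF L2_diff[OF assms(1,2)]] by simp
qed simp

end

section \<open>The adjoint operator\<close>

abbreviation (in kernel_pair) B where "B \<equiv> kernel_int R (\<lambda>v u. h u v)"

context kernel_pair
begin

interpretation swapped: kernel_pair R Q "\<lambda>v u. h u v" by (rule swap)

text \<open>Fubini's theorem applies because |x(u)| |k(v)| is at most |x(u)|^2 + |k(v)|^2, and each
  square, integrated against \<open>h\<close>, reduces to a norm by one of the two marginal
  conditions.\<close>

lemma adjoint:
  assumes "x \<in> L2 Q" "k \<in> L2 R"
  shows "L2_inner R (A x) k = L2_inner Q x (B k)"
proof -
  note [measurable] = L2D(1)[OF assms(1)] L2D(1)[OF assms(2)]
  have int: "integrable (Q \<Otimes>\<^sub>M R) (\<lambda>(u, v). of_real (h u v) * x u * cnj (k v))"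
  proof (rule integrableI_bounded)
    let ?a = "\<lambda>u. ennreal ((cmod (x u))\<^sup>2)" and ?b = "\<lambda>v. ennreal ((cmod (k v))\<^sup>2)"
    have le: "ennreal (norm (case w of (u, v) \<Rightarrow> of_real (h u v) * x u * cnj (k v)))
        \<le> (case w of (u, v) \<Rightarrow> ennreal (h u v) * ?a u + ennreal (h u v) * ?b v)" for w
    proof (cases w)
      case (Pair u v)
      have "cmod (x u) * cmod (k v) \<le> (cmod (x u))\<^sup>2 + (cmod (k v))\<^sup>2"
        using two_mult_le_squares[of "cmod (x u)" "cmod (k v)"]
          mult_nonneg_nonneg[OF norm_ge_zero norm_ge_zero, of "x u" "k v"] by linarith
      then have "h u v * (cmod (x u) * cmod (k v)) \<le> h u v * ((cmod (x u))\<^sup>2 + (cmod (k v))\<^sup>2)"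
        by (intro mult_left_mono) auto
      then have "ennreal (h u v * (cmod (x u) * cmod (k v)))
          \<le> ennreal (h u v * ((cmod (x u))\<^sup>2 + (cmod (k v))\<^sup>2))"
        by (rule ennreal_leI)
      also have "\<dots> = ennreal (h u v) * ?a u + ennreal (h u v) * ?b v"
        by (simp add: ennreal_mult distrib_left)
      finally show ?thesis using Pair by (simp add: norm_mult mult.assoc)
    qed
    have "(\<integral>\<^sup>+w. ennreal (norm (case w of (u, v) \<Rightarrow> of_real (h u v) * x u * cnj (k v))) \<partial>(Q \<Otimes>\<^sub>M R))
        \<le> (\<integral>\<^sup>+w. (case w of (u, v) \<Rightarrow> ennreal (h u v) * ?a u + ennreal (h u v) * ?b v) \<partial>(Q \<Otimes>\<^sub>M R))"
      by (intro nn_integral_mono le)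
    also have "\<dots> = (\<integral>\<^sup>+w. (case w of (u, v) \<Rightarrow> ennreal (h u v) * ?a u) \<partial>(Q \<Otimes>\<^sub>M R))
        + (\<integral>\<^sup>+w. (case w of (u, v) \<Rightarrow> ennreal (h u v) * ?b v) \<partial>(Q \<Otimes>\<^sub>M R))"
      by (subst nn_integral_add[symmetric]) (auto simp: split_beta')
    also have "(\<integral>\<^sup>+w. (case w of (u, v) \<Rightarrow> ennreal (h u v) * ?a u) \<partial>(Q \<Otimes>\<^sub>M R))
        = (\<integral>\<^sup>+v. \<integral>\<^sup>+u. ennreal (h u v) * ?a u \<partial>Q \<partial>R)"
      by (subst nn_integral_snd[symmetric]) (auto simp: split_beta')
    also have "\<dots> = ennreal (L2_sq Q x)"
      by (subst nn_integral_marginal) (auto simp: L2_sq_nn_integral[OF assms(1)])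
    also have "(\<integral>\<^sup>+w. (case w of (u, v) \<Rightarrow> ennreal (h u v) * ?b v) \<partial>(Q \<Otimes>\<^sub>M R))
        = (\<integral>\<^sup>+u. \<integral>\<^sup>+v. ennreal (h u v) * ?b v \<partial>R \<partial>Q)"
      by (subst R.nn_integral_fst[symmetric]) (auto simp: split_beta')
    also have "\<dots> = ennreal (L2_sq R k)"
      by (subst swapped.nn_integral_marginal) (auto simp: L2_sq_nn_integral[OF assms(2)])
    also have "ennreal (L2_sq Q x) + ennreal (L2_sq R k) < \<infinity>"
      by (simp add: less_top)
    finally show "(\<integral>\<^sup>+w. ennreal (norm (case w of (u, v) \<Rightarrow> of_real (h u v) * x u * cnj (k v))) \<partial>(Q \<Otimes>\<^sub>M R)) < \<infinity>" .
  qed (simp add: split_beta')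
  have "L2_inner R (A x) k = (\<integral>v. \<integral>u. of_real (h u v) * x u * cnj (k v) \<partial>Q \<partial>R)"
    unfolding L2_inner_def kernel_int_def by simp
  also have "\<dots> = (\<integral>u. \<integral>v. of_real (h u v) * x u * cnj (k v) \<partial>R \<partial>Q)"
    using int by (rule Fubini_integral)
  also have "\<dots> = L2_inner Q x (B k)"
    unfolding L2_inner_def
  proof (intro Bochner_Integration.integral_cong refl)
    fix u
    have "x u * cnj (B k u) = x u * B (\<lambda>v. cnj (k v)) u"
      by (simp add: swapped.A_cnj)
    also have "\<dots> = (\<integral>v. x u * (of_real (h u v) * cnj (k v)) \<partial>R)"
      unfolding kernel_int_def by simp
    also have "\<dots> = (\<integral>v. of_real (h u v) * x u * cnj (k v) \<partial>R)"
      by (simp only: ac_simps)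
    finally show "(\<integral>v. of_real (h u v) * x u * cnj (k v) \<partial>R) = x u * cnj (B k u)"
      by (rule sym)
  qed
  finally show ?thesis .
qed

end

section \<open>Slices of the density and the Hilbert--Schmidt norm\<close>

context kernel_pair
begin

text \<open>
  The squared Hilbert--Schmidt norm of \<^term>\<open>A\<close>, and hence the trace of \<open>B \<circ> A\<close>.
\<close>

definition HS :: ennreal where
  "HS = (\<integral>\<^sup>+v. \<integral>\<^sup>+u. ennreal ((h u v)\<^sup>2) \<partial>Q \<partial>R)"

text \<open>The values \<open>A g v\<close>, up to conjugation, are the Fourier coefficients of the
  slice of \<open>h\<close> at \<open>v\<close>; this is what connects the trace with Parseval's
  identity.\<close>

lemma inner_slice: "L2_inner Q (\<lambda>u. of_real (h u v)) x = cnj (A x v)"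
  unfolding L2_inner_def using A_cnj[of x v] by (simp add: kernel_int_def)

lemma infsum_slice:
  assumes "orthonormal_basis Q E" "countable E" "(\<lambda>u. complex_of_real (h u v)) \<in> L2 Q"
  shows "(\<Sum>\<^sub>\<infinity>g\<in>E. ennreal ((cmod (A g v))\<^sup>2)) = (\<integral>\<^sup>+u. ennreal ((h u v)\<^sup>2) \<partial>Q)"
  using Parseval[OF assms] L2_sq_nn_integral[OF assms(3)] by (simp add: inner_slice)

lemma AE_slice_L2_HS:
  assumes "HS < \<infinity>"
  shows "AE v in R. (\<lambda>u. complex_of_real (h u v)) \<in> L2 Q"
proof -
  have "AE v in R. (\<integral>\<^sup>+u. ennreal ((h u v)\<^sup>2) \<partial>Q) \<noteq> \<infinity>"
    using assms unfolding HS_def by (intro nn_integral_PInf_AE) auto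
  then show ?thesis using AE_space
  proof eventually_elim
    case (elim v)
    note [measurable] = elim(2)
    show ?case using elim(1) by (subst L2_iff_nn_integral) (auto simp: less_top)
  qed
qed

lemma infsum_L2_sq_A:
  assumes "countable E" "E \<subseteq> L2 Q"
  shows "(\<Sum>\<^sub>\<infinity>g\<in>E. ennreal (L2_sq R (A g))) = (\<integral>\<^sup>+v. (\<Sum>\<^sub>\<infinity>g\<in>E. ennreal ((cmod (A g v))\<^sup>2)) \<partial>R)"
proof -
  have "(\<Sum>\<^sub>\<infinity>g\<in>E. ennreal (L2_sq R (A g))) = (\<Sum>\<^sub>\<infinity>g\<in>E. \<integral>\<^sup>+v. ennreal ((cmod (A g v))\<^sup>2) \<partial>R)"
    using assms(2) by (intro infsum_cong) (auto simp: L2_sq_nn_integral A_L2)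
  also have "\<dots> = (\<integral>\<^sup>+v. (\<Sum>\<^sub>\<infinity>g\<in>E. ennreal ((cmod (A g v))\<^sup>2)) \<partial>R)"
    using assms by (intro nn_integral_infsum[symmetric] borel_measurable_cmod_sq A_L2) auto
  finally show ?thesis .
qed

text \<open>
  A slice of \<open>h\<close> is a priori only integrable, so that it cannot be expanded in the basis. It is
  identified with the element of \<open>L\<^sup>2(Q)\<close> that has the same coefficients by testing on the sets of a
  countable determining class.
\<close>

lemma AE_slice_L2_infsum:
  assumes E: "orthonormal_basis Q E" "countable E" and Q: "countably_generated Q"
    and fin: "(\<Sum>\<^sub>\<infinity>g\<in>E. ennreal (L2_sq R (A g))) < \<infinity>"
  shows "AE v in R. (\<lambda>u. complex_of_real (h u v)) \<in> L2 Q"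
proof -
  have on: "orthonormal Q E" using E(1) by (simp add: orthonormal_basis_iff)
  have E_L2: "E \<subseteq> L2 Q" using on by (simp add: orthonormal_def)
  note part = finite_initial_part[OF E(2)]
  obtain C where C: "countable C" "C \<subseteq> sets Q"
    "\<And>x :: 'a \<Rightarrow> complex. integrable Q x \<Longrightarrow> (\<And>c. c \<in> C \<Longrightarrow> (\<integral>u. x u * indicator c u \<partial>Q) = 0)
       \<Longrightarrow> AE u in Q. x u = 0"
    using countable_determining_class[OF Q.finite_measure_axioms Q] by blast
  have ind: "indicator c \<in> L2 Q" if "c \<in> C" for c
    using that C(2) Q.L2_indicator by blast
  have meas: "(\<lambda>v. \<Sum>\<^sub>\<infinity>g\<in>E. ennreal ((cmod (A g v))\<^sup>2)) \<in> borel_measurable R"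
    using E_L2 by (intro borel_measurable_infsum_ennreal E(2) borel_measurable_cmod_sq A_L2) auto
  have "AE v in R. (\<Sum>\<^sub>\<infinity>g\<in>E. ennreal ((cmod (A g v))\<^sup>2)) \<noteq> \<infinity>"
    using fin meas unfolding infsum_L2_sq_A[OF E(2) E_L2] by (intro nn_integral_PInf_AE) auto
  \<comment> \<open>For such \<open>v\<close> the would-be coefficients of the slice are square
    summable, so \<open>Riesz_Fischer\<close> supplies an element of \<open>L2 Q\<close> that has
    them.\<close>
  then have bdd: "AE v in R. \<exists>K. \<forall>F. finite F \<longrightarrow> F \<subseteq> E \<longrightarrow> (\<Sum>g\<in>F. (cmod (cnj (A g v)))\<^sup>2) \<le> K"
  proof eventually_elim
    case (elim v)
    let ?S = "\<Sum>\<^sub>\<infinity>g\<in>E. ennreal ((cmod (A g v))\<^sup>2)"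
    have "(\<Sum>g\<in>F. (cmod (cnj (A g v)))\<^sup>2) \<le> enn2real ?S" if "finite F" "F \<subseteq> E" for F
    proof -
      have "ennreal (\<Sum>g\<in>F. (cmod (A g v))\<^sup>2) = (\<Sum>g\<in>F. ennreal ((cmod (A g v))\<^sup>2))"
        by (rule sum_ennreal[symmetric]) simp
      also have "\<dots> \<le> ?S"
        unfolding nonneg_infsum_complete[OF zero_le] using that by (intro SUP_upper) auto
      also have "\<dots> = ennreal (enn2real ?S)" using elim by (simp add: less_top)
      finally show ?thesis by simp
    qed
    then show ?case by blast
  qed
  \<comment> \<open>Partial Parseval sums for the pairing of \<open>indicator c\<close> with the
    unknown slice. They do not mention the element built from the coefficients, which varies with
    \<open>v\<close>.\<close>
  define Z where "Z c n v = (\<Sum>g\<in>initial_part E n. L2_inner Q (indicator c) g * A g v)" for c n v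
  have Z_lim: "(\<lambda>n. Z c n v) \<longlonglongrightarrow> L2_inner Q (indicator c) x"
    if "c \<in> C" "x \<in> L2 Q" "\<And>g. g \<in> E \<Longrightarrow> L2_inner Q x g = cnj (A g v)" for c v x
  proof -
    have "(\<lambda>n. \<Sum>g\<in>initial_part E n. L2_inner Q (indicator c) g * L2_inner Q g x)
        \<longlonglongrightarrow> L2_inner Q (indicator c) x"
      by (intro Parseval_inner E ind that)
    moreover have "L2_inner Q g x = A g v" if "g \<in> initial_part E n" for g n
      using that(1) \<open>\<And>g. g \<in> E \<Longrightarrow> L2_inner Q x g = cnj (A g v)\<close>[of g] initial_part_subset[of E n]
        L2_inner_commute[of Q g x] by auto
    ultimately show ?thesis by (simp add: Z_def)
  qed
  \<comment> \<open>The functions \<open>Z c n\<close> converge to \<open>A (indicator c)\<close> in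
    \<open>L2 R\<close> by continuity of \<open>A\<close>, and at almost every \<open>v\<close> they
    converge to some number by \<open>Z_lim\<close>. The two limits agree almost everywhere.\<close>
  have Z_A: "AE v in R. (\<lambda>n. Z c n v) \<longlonglongrightarrow> A (indicator c) v" if c: "c \<in> C" for c
  proof -
    let ?X = "\<lambda>n u. \<Sum>g\<in>initial_part E n. L2_inner Q (indicator c) g * g u"
    have X: "?X n \<in> L2 Q" for n
      by (rule orthonormal_combination_L2[OF on initial_part_subset])
    have "(\<lambda>n. L2_sq R (\<lambda>v. A (?X n) v - A (indicator c) v)) \<longlonglongrightarrow> 0"
      by (intro A_tendsto X ind c orthonormal_basis_expansion E)
    moreover have "AE v in R. \<forall>n. A (?X n) v = Z c n v"
    proof (rule AE_all_countable[THEN iffD2], rule allI)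
      fix n
      have "AE v in R. A (?X n) v = (\<Sum>g\<in>initial_part E n. A (\<lambda>u. L2_inner Q (indicator c) g * g u) v)"
        using E_L2 initial_part_subset[of E n] by (intro A_sum part L2_scale) auto
      then show "AE v in R. A (?X n) v = Z c n v" by (simp add: A_scale Z_def)
    qed
    then have "AE v in R. (\<lambda>n. A (?X n) v) \<longlonglongrightarrow> lim (\<lambda>n. Z c n v)"
      using bdd
    proof eventually_elim
      case (elim v)
      then obtain K where "\<And>F. finite F \<Longrightarrow> F \<subseteq> E \<Longrightarrow> (\<Sum>g\<in>F. (cmod (cnj (A g v)))\<^sup>2) \<le> K" by blast
      from Riesz_Fischer[OF on E(2), of "\<lambda>g. cnj (A g v)", OF this]
      obtain x where "x \<in> L2 Q" "\<And>g. g \<in> E \<Longrightarrow> L2_inner Q x g = cnj (A g v)" by blast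
      from Z_lim[OF c this] elim(1) show ?case
        by (simp add: convergentI convergent_LIMSEQ_iff[symmetric])
    qed
    ultimately have "AE v in R. A (indicator c) v = lim (\<lambda>n. Z c n v)"
      by (intro L2_lim_unique_AE[where X="\<lambda>n. A (?X n)"] A_L2 X ind c)
    then show ?thesis using bdd
    proof eventually_elim
      case (elim v)
      then obtain K where "\<And>F. finite F \<Longrightarrow> F \<subseteq> E \<Longrightarrow> (\<Sum>g\<in>F. (cmod (cnj (A g v)))\<^sup>2) \<le> K" by blast
      from Riesz_Fischer[OF on E(2), of "\<lambda>g. cnj (A g v)", OF this]
      obtain x where "x \<in> L2 Q" "\<And>g. g \<in> E \<Longrightarrow> L2_inner Q x g = cnj (A g v)" by blast
      from Z_lim[OF c this] elim(1) show ?case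
        by (simp add: convergentI convergent_LIMSEQ_iff[symmetric])
    qed
  qed
  \<comment> \<open>Countability of \<open>C\<close> provides one null set for all test
    sets.\<close>
  have "AE v in R. \<forall>c\<in>C. (\<lambda>n. Z c n v) \<longlonglongrightarrow> A (indicator c) v"
    using Z_A by (subst AE_ball_countable[OF C(1)]) blast
  then show ?thesis
    using bdd h_marginal_R AE_space
  proof eventually_elim
    case (elim v)
    note [measurable] = elim(4)
    from elim(2) obtain K where "\<And>F. finite F \<Longrightarrow> F \<subseteq> E \<Longrightarrow> (\<Sum>g\<in>F. (cmod (cnj (A g v)))\<^sup>2) \<le> K" by blast
    from Riesz_Fischer[OF on E(2), of "\<lambda>g. cnj (A g v)", OF this]
    obtain x where x: "x \<in> L2 Q" "\<And>g. g \<in> E \<Longrightarrow> L2_inner Q x g = cnj (A g v)" by blast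
    note [measurable] = L2D(1)[OF x(1)]
    have h_int: "integrable Q (\<lambda>u. complex_of_real (h u v))"
      using elim(3) by (intro integrableI_bounded) auto
    have "AE u in Q. complex_of_real (h u v) - x u = 0"
    proof (rule C(3))
      show "integrable Q (\<lambda>u. complex_of_real (h u v) - x u)"
        using h_int Q.L2_integrable[OF x(1)] by simp
      fix c assume c: "c \<in> C"
      then have [measurable]: "c \<in> sets Q" using C(2) by blast
      have "L2_inner Q (indicator c) x = A (indicator c) v"
        using Z_lim[OF c x] elim(1) c LIMSEQ_unique by blast
      then have "L2_inner Q x (indicator c) = L2_inner Q (\<lambda>u. of_real (h u v)) (indicator c)"
        by (simp add: inner_slice L2_inner_commute[of Q x])
      then have "(\<integral>u. x u * indicator c u \<partial>Q) = (\<integral>u. of_real (h u v) * indicator c u \<partial>Q)"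
        by (simp add: L2_inner_indicator)
      moreover have int: "integrable Q (\<lambda>u. y u * indicator c u)" if "integrable Q y" for y :: "'a \<Rightarrow> complex"
      proof -
        have "(\<lambda>u. y u * indicator c u) = (\<lambda>u. indicator c u *\<^sub>R y u)"
          by (auto simp: fun_eq_iff indicator_def)
        then show ?thesis using integrable_mult_indicator[OF \<open>c \<in> sets Q\<close> that] by simp
      qed
      moreover note int[OF h_int] int[OF Q.L2_integrable[OF x(1)]]
      ultimately show "(\<integral>u. (complex_of_real (h u v) - x u) * indicator c u \<partial>Q) = 0"
        by (simp add: left_diff_distrib)
    qed
    then have "AE u in Q. x u = complex_of_real (h u v)" by auto
    from L2_cong_AE[OF x(1) this] show ?case by measurable
  qed
qed

text \<open>As soon as one side is finite, almost every slice lies in \<open>L2 Q\<close>, and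
  Parseval's identity for the slices is integrated over \<open>v\<close>; otherwise both sides are
  infinite. In particular the sum does not depend on the basis.\<close>

theorem infsum_L2_sq_A_basis:
  assumes E: "orthonormal_basis Q E" and Q: "countably_generated Q"
  shows "(\<Sum>\<^sub>\<infinity>g\<in>E. ennreal (L2_sq R (A g))) = HS"
proof (cases "HS < \<infinity> \<or> (\<Sum>\<^sub>\<infinity>g\<in>E. ennreal (L2_sq R (A g))) < \<infinity>")
  case True
  have on: "orthonormal Q E" using E(1) by (simp add: orthonormal_basis_iff)
  then have cE: "countable E" by (rule countable_orthonormal[OF Q.finite_measure_axioms Q])
  have "AE v in R. (\<lambda>u. complex_of_real (h u v)) \<in> L2 Q"
    using True AE_slice_L2_HS AE_slice_L2_infsum[OF E cE Q] by blast
  then have "AE v in R. (\<Sum>\<^sub>\<infinity>g\<in>E. ennreal ((cmod (A g v))\<^sup>2)) = (\<integral>\<^sup>+u. ennreal ((h u v)\<^sup>2) \<partial>Q)"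
    by eventually_elim (rule infsum_slice[OF E cE])
  then show ?thesis
    unfolding HS_def using on infsum_L2_sq_A[OF cE] by (auto simp: orthonormal_def intro: nn_integral_cong_AE)
next
  case False
  then show ?thesis by (simp add: less_top[symmetric])
qed

end

section \<open>The spectral theorem for the composition with the adjoint\<close>

context kernel_pair
begin

interpretation swapped: kernel_pair R Q "\<lambda>v u. h u v" by (rule swap)

lemma B_A_L2: "x \<in> L2 Q \<Longrightarrow> B (A x) \<in> L2 Q"
  by (intro A_L2 swapped.A_L2)

lemma inner_B_A:
  assumes "x \<in> L2 Q" "y \<in> L2 Q"
  shows "L2_inner Q (B (A x)) y = L2_inner R (A x) (A y)"
  using adjoint[OF assms(2) A_L2[OF assms(1)]]
  by (simp add: L2_inner_commute[of Q "B (A x)" y] L2_inner_commute[of R "A x" "A y"])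

lemma inner_B_A_self:
  assumes "x \<in> L2 Q"
  shows "L2_inner Q (B (A x)) x = of_real (L2_sq R (A x))"
  using inner_B_A[OF assms assms] by (simp add: L2_inner_self)

lemma B_A_selfadjoint:
  assumes "x \<in> L2 Q" "y \<in> L2 Q"
  shows "L2_inner Q (B (A x)) y = L2_inner Q x (B (A y))"
  using adjoint[OF assms(1) A_L2[OF assms(2)]] inner_B_A[OF assms] by simp

text \<open>Compactness in the form needed for the maximum principle. At almost every
  \<open>v\<close>, evaluation of \<open>A\<close> is an inner product with a slice in
  \<open>L2 Q\<close>, so weak convergence gives pointwise convergence; the squared norm of the
  slice is an integrable majorant.\<close>

lemma A_weak_tendsto:
  assumes HS: "HS < \<infinity>"
    and X: "\<And>n. X n \<in> L2 Q" "\<And>n. L2_sq Q (X n) \<le> 1" and x: "x \<in> L2 Q"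
    and weak: "\<And>y. y \<in> L2 Q \<Longrightarrow> (\<lambda>n. L2_inner Q (X n) y) \<longlonglongrightarrow> L2_inner Q x y"
  shows "(\<lambda>n. L2_sq R (A (X n))) \<longlonglongrightarrow> L2_sq R (A x)"
proof -
  note [measurable] = L2D(1)[OF A_L2[OF X(1)]] L2D(1)[OF A_L2[OF x]]
  define H where "H v = enn2real (\<integral>\<^sup>+u. ennreal ((h u v)\<^sup>2) \<partial>Q)" for v
  have fin: "AE v in R. (\<integral>\<^sup>+u. ennreal ((h u v)\<^sup>2) \<partial>Q) \<noteq> \<infinity>"
    using HS unfolding HS_def by (intro nn_integral_PInf_AE) auto
  have H_meas: "H \<in> borel_measurable R"
    unfolding H_def by measurable
  have H_int: "integrable R H"
  proof (rule integrableI_bounded)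
    have "(\<integral>\<^sup>+v. ennreal (norm (H v)) \<partial>R) \<le> HS"
      unfolding HS_def H_def by (intro nn_integral_mono) (simp add: ennreal_enn2real_if)
    then show "(\<integral>\<^sup>+v. ennreal (norm (H v)) \<partial>R) < \<infinity>" using HS by (rule le_less_trans)
  qed (rule H_meas)
  have A_eq: "A y v = L2_inner Q y (\<lambda>u. of_real (h u v))" for y v
    by (simp add: L2_inner_commute[of Q y] inner_slice)
  show ?thesis
    unfolding L2_sq_def
  proof (rule integral_dominated_convergence[where w=H])
    show "AE v in R. (\<lambda>n. (cmod (A (X n) v))\<^sup>2) \<longlonglongrightarrow> (cmod (A x v))\<^sup>2"
      using AE_slice_L2_HS[OF HS]
    proof eventually_elim
      case (elim v)
      show ?case unfolding A_eq by (intro tendsto_intros weak elim)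
    qed
    show "AE v in R. norm ((cmod (A (X n) v))\<^sup>2) \<le> H v" for n
      using AE_slice_L2_HS[OF HS] fin
    proof eventually_elim
      case (elim v)
      have "(cmod (A (X n) v))\<^sup>2 \<le> L2_sq Q (X n) * L2_sq Q (\<lambda>u. of_real (h u v))"
        unfolding A_eq by (rule L2_Cauchy_Schwarz[OF X(1) elim(1)])
      also have "\<dots> \<le> 1 * L2_sq Q (\<lambda>u. of_real (h u v))"
        by (intro mult_right_mono X(2)) simp
      also have "L2_sq Q (\<lambda>u. of_real (h u v)) = H v"
        unfolding H_def using L2_sq_nn_integral[OF elim(1)] by simp
      finally show ?case by simp
    qed
  qed (simp_all add: H_int)
qed

end

text \<open>A diagonal subsequence makes all coefficients in a countable basis converge. The limits
  inherit Bessel's inequality and hence are the coefficients of some \<open>x\<close>.\<close>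

lemma L2_weak_compact:
  assumes Q: "finite_measure Q" "countably_generated Q"
    and X: "\<And>n::nat. X n \<in> L2 Q" "\<And>n. L2_sq Q (X n) \<le> 1"
  obtains r x where "strict_mono r" "x \<in> L2 Q" "L2_sq Q x \<le> 1"
    "\<And>y. y \<in> L2 Q \<Longrightarrow> (\<lambda>n. L2_inner Q (X (r n)) y) \<longlonglongrightarrow> L2_inner Q x y"
proof -
  obtain E where E: "orthonormal_basis Q E" using ex_orthonormal_basis by blast
  then have on: "orthonormal Q E" by (simp add: orthonormal_basis_iff)
  then have cE: "countable E" by (rule countable_orthonormal[OF Q])
  note E_L2 = orthonormal_L2[OF on]
  note part = finite_initial_part[OF cE]
  have CS: "cmod (L2_inner Q (X n) y) \<le> sqrt (L2_sq Q y)" if "y \<in> L2 Q" for n y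
  proof (rule real_le_rsqrt)
    have "(cmod (L2_inner Q (X n) y))\<^sup>2 \<le> L2_sq Q (X n) * L2_sq Q y"
      by (rule L2_Cauchy_Schwarz[OF X(1) that])
    also have "\<dots> \<le> 1 * L2_sq Q y" by (intro mult_right_mono X(2)) simp
    finally show "(cmod (L2_inner Q (X n) y))\<^sup>2 \<le> L2_sq Q y" by simp
  qed
  \<comment> \<open>The diagonal construction requires conditions numbered by natural numbers; the
    condition is vacuous if no basis element has the number \<open>k\<close>, as happens for a
    finite basis.\<close>
  define Cv where "Cv k s \<longleftrightarrow> (\<forall>g\<in>E. to_nat_on E g = k \<longrightarrow> convergent (\<lambda>n. L2_inner Q (X (s n)) g))"
    for k and s :: "nat \<Rightarrow> nat"
  interpret subseqs Cv
  proof
    fix k and s :: "nat \<Rightarrow> nat" assume "strict_mono s"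
    show "\<exists>r. strict_mono r \<and> Cv k (s \<circ> r)"
    proof (cases "\<exists>g\<in>E. to_nat_on E g = k")
      case True
      then obtain g where g: "g \<in> E" "to_nat_on E g = k" by blast
      have "bounded (range (\<lambda>n. L2_inner Q (X (s n)) g))"
        using CS[OF E_L2[OF g(1)]] by (intro boundedI[where B="sqrt (L2_sq Q g)"]) auto
      from bounded_imp_convergent_subsequence[OF this] obtain l r
        where "strict_mono r" "((\<lambda>n. L2_inner Q (X (s n)) g) \<circ> r) \<longlonglongrightarrow> l" by blast
      moreover have "g' = g" if "g' \<in> E" "to_nat_on E g' = k" for g'
        using that g inj_on_to_nat_on[OF cE] by (metis inj_onD)
      ultimately show ?thesis
        unfolding Cv_def by (intro exI[of _ r]) (auto simp: o_def convergent_def)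
    next
      case False
      then show ?thesis unfolding Cv_def using strict_mono_id by blast
    qed
  qed
  \<comment> \<open>The diagonal sequence is a subsequence of the one chosen for \<open>k\<close>
    only from some index on; the shift by \<open>Suc k\<close> discards the terms before it.\<close>
  have Cv: "Cv k (diagseq \<circ> (+) (Suc k))" for k
  proof (rule diagseq_holds)
    fix r s n assume r: "strict_mono (r :: nat \<Rightarrow> nat)" and "Cv n s"
    then show "Cv n (s \<circ> r)"
      unfolding Cv_def using convergent_subseq_convergent[OF _ r] by (auto simp: o_def)
  qed
  have conv: "convergent (\<lambda>n. L2_inner Q (X (diagseq n)) g)" if g: "g \<in> E" for g
  proof -
    let ?k = "Suc (to_nat_on E g)"
    have "convergent (\<lambda>n. L2_inner Q (X ((diagseq \<circ> (+) ?k) n)) g)"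
      using Cv[of "to_nat_on E g"] g unfolding Cv_def by blast
    then have "convergent (\<lambda>n. L2_inner Q (X (diagseq (n + ?k))) g)"
      by (simp only: o_def add.commute)
    then show ?thesis by (rule convergent_ignore_initial_segment[THEN iffD1])
  qed
  define a where "a g = lim (\<lambda>n. L2_inner Q (X (diagseq n)) g)" for g
  have a: "(\<lambda>n. L2_inner Q (X (diagseq n)) g) \<longlonglongrightarrow> a g" if "g \<in> E" for g
    using conv[OF that] unfolding a_def by (simp add: convergent_LIMSEQ_iff)
  have a_le: "(\<Sum>g\<in>F. (cmod (a g))\<^sup>2) \<le> 1" if F: "finite F" "F \<subseteq> E" for F
  proof (rule LIMSEQ_le_const2)
    show "(\<lambda>n. \<Sum>g\<in>F. (cmod (L2_inner Q (X (diagseq n)) g))\<^sup>2) \<longlonglongrightarrow> (\<Sum>g\<in>F. (cmod (a g))\<^sup>2)"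
      using F by (intro tendsto_intros a) auto
    show "\<exists>N. \<forall>n\<ge>N. (\<Sum>g\<in>F. (cmod (L2_inner Q (X (diagseq n)) g))\<^sup>2) \<le> 1"
      using Bessel[OF on F X(1)] X(2) order_trans by blast
  qed
  obtain x where x: "x \<in> L2 Q" "\<And>g. g \<in> E \<Longrightarrow> L2_inner Q x g = a g"
    "(\<lambda>n. L2_sq Q (\<lambda>u. (\<Sum>g\<in>initial_part E n. a g * g u) - x u)) \<longlonglongrightarrow> 0"
    using Riesz_Fischer[OF on cE a_le] by blast
  have x_le: "L2_sq Q x \<le> 1"
  proof (rule LIMSEQ_le_const2)
    show "(\<lambda>n. L2_sq Q (\<lambda>u. \<Sum>g\<in>initial_part E n. a g * g u)) \<longlonglongrightarrow> L2_sq Q x"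
      by (intro L2_sq_tendsto orthonormal_combination_L2[OF on initial_part_subset] x)
    show "\<exists>N. \<forall>n\<ge>N. L2_sq Q (\<lambda>u. \<Sum>g\<in>initial_part E n. a g * g u) \<le> 1"
      using orthonormal_sq_combination[OF on part initial_part_subset] a_le[OF part initial_part_subset]
      by auto
  qed
  have "(\<lambda>n. L2_inner Q (X (diagseq n)) y) \<longlonglongrightarrow> L2_inner Q x y" if y: "y \<in> L2 Q" for y
  proof (rule LIMSEQ_I)
    fix e :: real assume e: "e > 0"
    \<comment> \<open>Truncating the expansion of \<open>y\<close> leaves an error that is uniform
      in \<open>n\<close>, since all vectors involved have norm at most 1. Three errors of
      \<open>e/4\<close> then add up to less than \<open>e\<close>.\<close>
    define Y where "Y m u = (\<Sum>g\<in>initial_part E m. L2_inner Q y g * g u)" for m u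
    have Y: "Y m \<in> L2 Q" for m
      unfolding Y_def by (rule orthonormal_combination_L2[OF on initial_part_subset])
    have "(\<lambda>m. L2_sq Q (\<lambda>u. Y m u - y u)) \<longlonglongrightarrow> 0"
      unfolding Y_def by (rule orthonormal_basis_expansion[OF E cE y])
    from LIMSEQ_D[OF tendsto_real_sqrt[OF this], of "e/4"] e
    obtain m where m: "sqrt (L2_sq Q (\<lambda>u. Y m u - y u)) < e/4" by auto
    have inner_Y: "L2_inner Q z (Y m) = (\<Sum>g\<in>initial_part E m. cnj (L2_inner Q y g) * L2_inner Q z g)"
      if "z \<in> L2 Q" for z
      unfolding Y_def using E_L2 initial_part_subset[of E m] that
      by (subst L2_inner_sum_right) (auto simp: L2_inner_scale_right intro!: L2_scale)
    have "(\<lambda>n. L2_inner Q (X (diagseq n)) (Y m)) \<longlonglongrightarrow> L2_inner Q x (Y m)"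
      unfolding inner_Y[OF X(1)] inner_Y[OF x(1)]
      using initial_part_subset[of E m] by (intro tendsto_intros) (auto simp: x(2) intro!: a)
    from LIMSEQ_D[OF this, of "e/4"] e obtain N
      where N: "\<And>n. n \<ge> N \<Longrightarrow> cmod (L2_inner Q (X (diagseq n)) (Y m) - L2_inner Q x (Y m)) < e/4"
      by auto
    have "cmod (L2_inner Q (X (diagseq n)) y - L2_inner Q x y) < e" if "n \<ge> N" for n
    proof -
      have 1: "cmod (L2_inner Q (X (diagseq n)) (\<lambda>u. Y m u - y u)) < e/4"
        using CS[OF L2_diff[OF Y y]] m by (rule le_less_trans)
      have "(cmod (L2_inner Q x (\<lambda>u. Y m u - y u)))\<^sup>2 \<le> L2_sq Q x * L2_sq Q (\<lambda>u. Y m u - y u)"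
        by (rule L2_Cauchy_Schwarz[OF x(1) L2_diff[OF Y y]])
      also have "\<dots> \<le> 1 * L2_sq Q (\<lambda>u. Y m u - y u)" by (intro mult_right_mono x_le) simp
      finally have "cmod (L2_inner Q x (\<lambda>u. Y m u - y u)) \<le> sqrt (L2_sq Q (\<lambda>u. Y m u - y u))"
        by (intro real_le_rsqrt) simp
      then have 2: "cmod (L2_inner Q x (\<lambda>u. Y m u - y u)) < e/4" using m by (rule le_less_trans)
      let ?a = "L2_inner Q (X (diagseq n)) (Y m) - L2_inner Q x (Y m)"
        and ?b = "L2_inner Q (X (diagseq n)) (\<lambda>u. Y m u - y u)" and ?c = "L2_inner Q x (\<lambda>u. Y m u - y u)"
      have "L2_inner Q (X (diagseq n)) y - L2_inner Q x y = ?a - ?b + ?c"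
        by (simp add: L2_inner_diff_right[OF Y y] X(1) x(1))
      moreover have "cmod (?a - ?b + ?c) \<le> cmod ?a + cmod ?b + cmod ?c"
        using norm_triangle_ineq[of "?a - ?b" ?c] norm_triangle_ineq4[of ?a ?b] by linarith
      ultimately have "cmod (L2_inner Q (X (diagseq n)) y - L2_inner Q x y)
          \<le> cmod ?a + cmod ?b + cmod ?c" by simp
      then show ?thesis using N[OF that] 1 2 e by linarith
    qed
    then show "\<exists>N. \<forall>n\<ge>N. norm (L2_inner Q (X (diagseq n)) y - L2_inner Q x y) < e" by auto
  qed
  with subseq_diagseq x(1) x_le show ?thesis by (rule that)
qed

context kernel_pair
begin

interpretation swapped: kernel_pair R Q "\<lambda>v u. h u v" by (rule swap)

lemma B_A_AE_zero:
  assumes "x \<in> L2 Q" "AE v in R. A x v = 0" "u \<in> space Q"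
  shows "B (A x) u = 0"
  using swapped.A_cong_AE[of "A x" "\<lambda>v. 0" u] L2D(1)[OF A_L2[OF assms(1)]] assms(2,3)
  by (simp add: kernel_int_def)

text \<open>With y = P x - l x, the maximality is tested at x + y. No small step size is required:
  since \<open>A\<close> is a contraction, l <= 1, and the inequality at step size 1 already forces
  the norm of \<open>y\<close> to be 0. Invariance of \<open>V\<close> keeps the test vector
  admissible.\<close>

lemma maximizer_is_eigenvector:
  assumes V: "V \<subseteq> L2 Q" "\<And>x y. x \<in> V \<Longrightarrow> y \<in> V \<Longrightarrow> (\<lambda>u. x u + y u) \<in> V"
    "\<And>c x. x \<in> V \<Longrightarrow> (\<lambda>u. c * x u) \<in> V" "\<And>x. x \<in> V \<Longrightarrow> B (A x) \<in> V"
    and x: "x \<in> V" "L2_sq Q x \<le> 1" "L2_sq R (A x) = l"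
    and max: "\<And>y. y \<in> V \<Longrightarrow> L2_sq R (A y) \<le> l * L2_sq Q y"
  shows "AE u in Q. B (A x) u = of_real l * x u"
proof -
  define y where "y u = B (A x) u + (- of_real l) * x u" for u
  have y: "y \<in> V" unfolding y_def by (intro V x)
  have L: "x \<in> L2 Q" "y \<in> L2 Q" using x y V(1) by auto
  have l: "0 \<le> l" using x(3) L2_sq_nonneg[of R "A x"] by simp
  have l1: "l \<le> 1" using A_contraction[OF L(1)] x(2,3) by simp
  have "L2_inner R (A x) (A y) = L2_inner Q (B (A x)) y" using inner_B_A[OF L] by simp
  then have inner: "L2_inner R (A x) (A y) - of_real l * L2_inner Q x y = of_real (L2_sq Q y)"
    unfolding L2_inner_self[symmetric]
    using L2_inner_add_left[OF B_A_L2[OF L(1)] L2_scale[OF L(1), of "- of_real l"] L(2)]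
      L2_inner_scale_left[of Q "- of_real l" x y]
    by (simp add: y_def[abs_def])
  then have re: "Re (L2_inner R (A x) (A y)) - l * Re (L2_inner Q x y) = L2_sq Q y"
    by (metis Re_complex_of_real minus_complex.simps(1) Re_complex_of_real times_complex.simps(1)
        Im_complex_of_real mult_zero_left diff_zero)
  have "L2_sq R (A (\<lambda>u. x u + y u)) = L2_sq R (\<lambda>v. A x v + A y v)"
    using A_add[OF L] L by (intro L2_sq_cong_AE L2D(1) L2_add A_L2) auto
  also have "\<dots> = l + L2_sq R (A y) + 2 * Re (L2_inner R (A x) (A y))"
    using L2_sq_add[OF A_L2[OF L(1)] A_L2[OF L(2)]] x(3) by simp
  finally have "l + L2_sq R (A y) + 2 * Re (L2_inner R (A x) (A y))
      \<le> l * (L2_sq Q x + L2_sq Q y + 2 * Re (L2_inner Q x y))"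
    using max[OF V(2)[OF x(1) y]] L2_sq_add[OF L] by simp
  then have "l + L2_sq R (A y) + 2 * L2_sq Q y \<le> l * L2_sq Q x + l * L2_sq Q y"
    using re by (simp add: algebra_simps)
  moreover have "l * L2_sq Q x \<le> l" using mult_left_mono[OF x(2) l] by simp
  moreover have "l * L2_sq Q y \<le> L2_sq Q y" using mult_right_mono[OF l1, of "L2_sq Q y"] by simp
  ultimately have "L2_sq Q y \<le> 0" using L2_sq_nonneg[of R "A y"] by linarith
  then have "L2_sq Q y = 0" using L2_sq_nonneg[of Q y] by linarith
  then have "AE u in Q. y u = 0" using L2_sq_eq_0_iff[OF L(2)] by simp
  then show ?thesis by eventually_elim (simp add: y_def)
qed

theorem ex_eigenbasis:
  assumes HS: "HS < \<infinity>" and Q: "countably_generated Q"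
  obtains E where "orthonormal_basis Q E" "countable E"
    "\<And>g. g \<in> E \<Longrightarrow> AE u in Q. B (A g) u = of_real (L2_sq R (A g)) * g u"
proof -
  define D where "D = {x. \<exists>l::real. AE u in Q. B (A x) u = of_real l * x u}"
  obtain E where on: "orthonormal Q E" and "E \<subseteq> D"
    and max: "\<And>x. x \<in> L2 Q \<Longrightarrow> x \<in> D \<Longrightarrow> L2_sq Q x = 1 \<Longrightarrow> (\<And>g. g \<in> E \<Longrightarrow> L2_inner Q x g = 0) \<Longrightarrow> False"
    using maximal_orthonormal_subset[of Q D] by metis
  note E_L2 = orthonormal_L2[OF on]
  define V where "V = {x \<in> L2 Q. \<forall>g\<in>E. L2_inner Q x g = 0}"
  have V_L2: "V \<subseteq> L2 Q" by (auto simp: V_def)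
  have V_add: "(\<lambda>u. x u + y u) \<in> V" if "x \<in> V" "y \<in> V" for x y
    using that E_L2 by (auto simp: V_def L2_add L2_inner_add_left)
  have V_scale: "(\<lambda>u. c * x u) \<in> V" if "x \<in> V" for c x
    using that by (auto simp: V_def L2_scale L2_inner_scale_left)
  have V_P: "B (A x) \<in> V" if x: "x \<in> V" for x
  proof -
    have xL: "x \<in> L2 Q" using x V_L2 by auto
    have "L2_inner Q (B (A x)) g = 0" if g: "g \<in> E" for g
    proof -
      obtain l where l: "AE u in Q. B (A g) u = complex_of_real l * g u"
        using g \<open>E \<subseteq> D\<close> by (auto simp: D_def)
      have "L2_inner Q (B (A x)) g = L2_inner Q x (B (A g))"
        by (rule B_A_selfadjoint[OF xL E_L2[OF g]])
      also have "\<dots> = L2_inner Q x (\<lambda>u. of_real l * g u)"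
        using l by (intro L2_inner_cong_AE L2D(1)[OF xL] L2D(1)[OF L2_scale[OF E_L2[OF g]]]
            L2D(1)[OF B_A_L2[OF E_L2[OF g]]]) auto
      also have "\<dots> = 0" using x g by (simp add: L2_inner_scale_right V_def)
      finally show ?thesis .
    qed
    then show ?thesis using B_A_L2[OF xL] by (auto simp: V_def)
  qed
  have not_eig: "AE u in Q. x u = 0" if x: "x \<in> V" "AE u in Q. B (A x) u = of_real l * x u" for x and l :: real
  proof (rule ccontr)
    assume "\<not> (AE u in Q. x u = 0)"
    have xL: "x \<in> L2 Q" using x V_L2 by auto
    let ?c = "complex_of_real (1 / sqrt (L2_sq Q x))"
    note y = L2_normalize[OF xL \<open>\<not> (AE u in Q. x u = 0)\<close>]
    have "B (A (\<lambda>u. ?c * x u)) u = ?c * B (A x) u" for u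
      unfolding A_scale[abs_def] swapped.A_scale ..
    then have "AE u in Q. B (A (\<lambda>u. ?c * x u)) u = of_real l * (?c * x u)"
      using x(2) by (auto simp: mult.left_commute)
    then have "(\<lambda>u. ?c * x u) \<in> D" unfolding D_def by blast
    with max[OF y(1) _ y(2)] V_scale[OF x(1), of ?c] show False unfolding V_def by blast
  qed
  have "AE u in Q. x u = 0" if x: "x \<in> V" for x
  proof (rule ccontr)
    assume nz: "\<not> (AE u in Q. x u = 0)"
    have xL: "x \<in> L2 Q" using x V_L2 by auto
    \<comment> \<open>The supremum is over the unit ball rather than the sphere, because a weak
      limit of unit vectors may have smaller norm.\<close>
    define S where "S = {L2_sq R (A y) | y. y \<in> V \<and> L2_sq Q y \<le> 1}"
    define l where "l = Sup S"
    have bdd: "bdd_above S"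
      unfolding S_def using A_contraction V_L2 by (intro bdd_aboveI[of _ 1]) fastforce
    have le_l: "L2_sq R (A y) \<le> l * L2_sq Q y" if y: "y \<in> V" for y
    proof -
      have yL: "y \<in> L2 Q" using y V_L2 by auto
      show ?thesis
      proof (cases "AE u in Q. y u = 0")
        case True
        then have "L2_sq Q y = 0" using L2_sq_eq_0_iff[OF yL] by simp
        then show ?thesis using A_contraction[OF yL] by simp
      next
        case False
        then have "L2_sq Q y \<noteq> 0" using L2_sq_eq_0_iff[OF yL] by simp
        then have pos: "L2_sq Q y > 0" using L2_sq_nonneg[of Q y] by linarith
        let ?c = "complex_of_real (1 / sqrt (L2_sq Q y))"
        have "L2_sq R (A (\<lambda>u. ?c * y u)) \<in> S"
          unfolding S_def using V_scale[OF y, of ?c] L2_normalize(2)[OF yL False] by auto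
        then have "L2_sq R (A (\<lambda>u. ?c * y u)) \<le> l"
          unfolding l_def by (rule cSup_upper[OF _ bdd])
        also have "L2_sq R (A (\<lambda>u. ?c * y u)) = L2_sq R (A y) / L2_sq Q y"
          unfolding A_scale[abs_def] L2_sq_scale norm_of_real using pos by (simp add: power_divide)
        finally show ?thesis using pos by (simp add: divide_le_eq)
      qed
    qed
    have "(\<lambda>u. 0) \<in> V" using V_scale[OF x, of 0] by simp
    then have S_ne: "L2_sq R (A (\<lambda>u. 0)) \<in> S" unfolding S_def by (force simp: L2_sq_def)
    have l0: "0 \<le> l"
      unfolding l_def using cSup_upper[OF S_ne bdd] L2_sq_nonneg order_trans by blast
    show False
    proof (cases "l = 0")
      case True
      \<comment> \<open>Here \<open>A\<close> vanishes on \<open>V\<close>, so \<open>x\<close>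
        itself would be an eigenfunction with eigenvalue 0.\<close>
      then have "L2_sq R (A x) = 0" using le_l[OF x] L2_sq_nonneg[of R "A x"] by simp
      then have "AE v in R. A x v = 0" using L2_sq_eq_0_iff[OF A_L2[OF xL]] by simp
      then have "AE u in Q. B (A x) u = of_real 0 * x u"
        using B_A_AE_zero[OF xL] by (intro AE_I2) simp
      from not_eig[OF x this] nz show False by simp
    next
      case False
      have "\<exists>y. y \<in> V \<and> L2_sq Q y \<le> 1 \<and> l - 1 / real (Suc n) < L2_sq R (A y)" for n
      proof -
        have "l - 1 / real (Suc n) < Sup S" unfolding l_def by simp
        then show ?thesis
          using less_cSup_iff[OF _ bdd] S_ne by (auto simp: S_def)
      qed
      then obtain X where X: "\<And>n. X n \<in> V" "\<And>n. L2_sq Q (X n) \<le> 1"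
        "\<And>n. l - 1 / real (Suc n) < L2_sq R (A (X n))"
        by metis
      have XL: "X n \<in> L2 Q" for n using X(1) V_L2 by auto
      obtain r z
        where r: "strict_mono r" and z: "z \<in> L2 Q" "L2_sq Q z \<le> 1"
          and weak: "\<And>y. y \<in> L2 Q \<Longrightarrow> (\<lambda>n. L2_inner Q (X (r n)) y) \<longlonglongrightarrow> L2_inner Q z y"
        by (rule L2_weak_compact[OF Q.finite_measure_axioms Q XL X(2)]) (rule that)
      \<comment> \<open>Orthogonality to \<open>E\<close> passes to weak limits.\<close>
      have "L2_inner Q z g = 0" if "g \<in> E" for g
        using weak[OF E_L2[OF that]] X(1) that by (simp add: V_def LIMSEQ_const_iff)
      then have zV: "z \<in> V" using z by (simp add: V_def)
      have "(\<lambda>n. L2_sq R (A (X (r n)))) \<longlonglongrightarrow> L2_sq R (A z)"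
        by (rule A_weak_tendsto[OF HS XL X(2) z(1) weak])
      moreover have lim_l: "(\<lambda>n. L2_sq R (A (X n))) \<longlonglongrightarrow> l"
      proof (rule tendsto_sandwich)
        show "(\<lambda>n. l - 1 / real (Suc n)) \<longlonglongrightarrow> l"
          using tendsto_diff[OF tendsto_const[of l] LIMSEQ_inverse_real_of_nat]
          by (simp add: inverse_eq_divide)
        have "L2_sq R (A (X n)) \<le> l" for n
          using le_l[OF X(1)[of n]] mult_left_mono[OF X(2)[of n] l0] by simp
        then show "\<forall>\<^sub>F n in sequentially. L2_sq R (A (X n)) \<le> l" by simp
        show "\<forall>\<^sub>F n in sequentially. l - 1 / real (Suc n) \<le> L2_sq R (A (X n))"
          using X(3) by (intro always_eventually allI less_imp_le)
      qed simp
      have "(\<lambda>n. L2_sq R (A (X (r n)))) \<longlonglongrightarrow> l"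
        using LIMSEQ_subseq_LIMSEQ[OF lim_l r] unfolding o_def .
      ultimately have l_eq: "L2_sq R (A z) = l" by (rule LIMSEQ_unique)
      have "AE u in Q. B (A z) u = of_real l * z u"
        by (rule maximizer_is_eigenvector[OF V_L2 V_add V_scale V_P zV z(2) l_eq le_l])
      \<comment> \<open>The weak limit cannot vanish, since its image under \<open>A\<close> has
        squared norm \<open>l\<close> > 0.\<close>
      from not_eig[OF zV this] have "L2_sq Q z = 0" using L2_sq_eq_0_iff[OF z(1)] by simp
      then show False using A_contraction[OF z(1)] l_eq l0 False by simp
    qed
  qed
  then have basis: "orthonormal_basis Q E"
    using on by (auto simp: orthonormal_basis_iff V_def)
  have "AE u in Q. B (A g) u = of_real (L2_sq R (A g)) * g u" if g: "g \<in> E" for g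
  proof -
    obtain l where l: "AE u in Q. B (A g) u = complex_of_real l * g u"
      using g \<open>E \<subseteq> D\<close> by (auto simp: D_def)
    note gL = E_L2[OF g]
    \<comment> \<open>Pairing the eigenvalue equation with the unit vector \<open>g\<close>
      determines the eigenvalue.\<close>
    have "of_real (L2_sq R (A g)) = L2_inner Q (B (A g)) g"
      by (simp add: inner_B_A_self[OF gL])
    also have "\<dots> = L2_inner Q (\<lambda>u. of_real l * g u) g"
      using l by (intro L2_inner_cong_AE L2D(1)[OF gL] L2D(1)[OF L2_scale[OF gL]]
            L2D(1)[OF B_A_L2[OF gL]]) auto
    also have "\<dots> = of_real l"
      unfolding L2_inner_scale_left L2_inner_self by (simp add: orthonormal_sq[OF on g])
    finally have "L2_sq R (A g) = l" by simp
    then show ?thesis using l by simp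
  qed
  with basis countable_orthonormal[OF Q.finite_measure_axioms Q on] show ?thesis by (rule that)
qed

end

section \<open>Traces of the iterated kernels\<close>

context kernel_pair
begin

interpretation swapped: kernel_pair R Q "\<lambda>v u. h u v" by (rule swap)

text \<open>The kernel of the composition of \<open>A\<close> and \<open>B\<close> with respect to
  \<open>Q\<close>. It is symmetric, unlike the transition density with respect to the reference
  measure, and takes values in \<open>ennreal\<close> because it may be infinite on the whole
  diagonal.\<close>

definition q :: "'a \<Rightarrow> 'a \<Rightarrow> ennreal" where
  "q u w = (\<integral>\<^sup>+v. ennreal (h u v) * ennreal (h w v) \<partial>R)"

lemma q_commute: "q u w = q w u"
  by (simp add: q_def mult.commute)

lemma enn2real_q:
  assumes [measurable]: "u \<in> space Q" "w \<in> space Q"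
  shows "enn2real (q u w) = (\<integral>v. h u v * h w v \<partial>R)"
  by (subst integral_eq_nn_integral) (auto simp: q_def ennreal_mult)

lemma q_measurable [measurable (raw)]:
  assumes [measurable]: "f \<in> L \<rightarrow>\<^sub>M Q" "g \<in> L \<rightarrow>\<^sub>M Q"
  shows "(\<lambda>z. q (f z) (g z)) \<in> borel_measurable L"
  unfolding q_def by measurable

lemma step_density_measurable [measurable (raw)]:
  assumes f: "f \<in> L \<rightarrow>\<^sub>M Q" and g: "g \<in> L \<rightarrow>\<^sub>M Q"
  shows "(\<lambda>z. step_density Q q (Suc n) (f z) (g z)) \<in> borel_measurable L"
proof -
  have "(\<lambda>z. step_density Q q (Suc n) (fst z) (snd z)) \<in> borel_measurable (Q \<Otimes>\<^sub>M Q)"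
  proof (induction n)
    case 0
    show ?case unfolding step_density.simps by measurable
  next
    case (Suc n)
    \<comment> \<open>The recursion integrates out a third variable, so measurability is needed for
      functions of triples.\<close>
    have IH: "(\<lambda>z. step_density Q q (Suc n) (f z) (g z)) \<in> borel_measurable L"
      if "f \<in> L \<rightarrow>\<^sub>M Q" "g \<in> L \<rightarrow>\<^sub>M Q" for f g and L :: "(('a \<times> 'a) \<times> 'a) measure"
      using measurable_compose[OF measurable_Pair[OF that] Suc.IH] by simp
    note [measurable (raw)] = IH
    show ?case unfolding step_density.simps by measurable
  qed
  from measurable_compose[OF measurable_Pair[OF f g] this] show ?thesis by simp
qed

text \<open>The set where \<open>H\<close> is finite has full measure if \<open>HS\<close> is
  finite, and on it all iterated kernels are finite with square integrable slices.\<close>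

definition H :: "'a \<Rightarrow> ennreal" where
  "H u = (\<integral>\<^sup>+v. (ennreal (h u v))\<^sup>2 \<partial>R)"

lemma H_measurable [measurable]: "H \<in> borel_measurable Q"
  unfolding H_def by measurable

lemma nn_integral_H: "(\<integral>\<^sup>+u. H u \<partial>Q) = HS"
proof -
  have "HS = (\<integral>\<^sup>+v. \<integral>\<^sup>+u. (ennreal (h u v))\<^sup>2 \<partial>Q \<partial>R)"
    unfolding HS_def by (simp add: ennreal_power)
  also have "\<dots> = (\<integral>\<^sup>+u. H u \<partial>Q)"
    unfolding H_def by (rule Fubini'[of "\<lambda>u v. (ennreal (h u v))\<^sup>2"]) measurable
  finally show ?thesis by simp
qed

lemma nn_integral_q_diagonal: "(\<integral>\<^sup>+u. q u u \<partial>Q) = HS"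
  unfolding nn_integral_H[symmetric] q_def H_def by (simp add: power2_eq_square)

text \<open>Each further step is one application of Cauchy-Schwarz; the two integrals of
  \<open>H\<close> that arise contribute the factor \<open>HS ^ 2\<close>.\<close>

lemma step_density_le:
  assumes "u \<in> space Q" "w \<in> space Q"
  shows "(step_density Q q (Suc n) u w)\<^sup>2 \<le> H u * H w * HS ^ (2 * n)"
  using assms
proof (induction n arbitrary: w)
  case 0
  note [measurable] = 0
  show ?case
    using Cauchy_Schwarz_nn_integral[of "\<lambda>v. ennreal (h u v)" R "\<lambda>v. ennreal (h w v)"]
    by (simp add: q_def H_def)
next
  case (Suc n)
  note [measurable] = Suc.prems
  have "(step_density Q q (Suc (Suc n)) u w)\<^sup>2
      \<le> (\<integral>\<^sup>+z. (step_density Q q (Suc n) u z)\<^sup>2 \<partial>Q) * (\<integral>\<^sup>+z. (q z w)\<^sup>2 \<partial>Q)"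
    unfolding step_density.simps by (rule Cauchy_Schwarz_nn_integral) measurable
  also have "(\<integral>\<^sup>+z. (step_density Q q (Suc n) u z)\<^sup>2 \<partial>Q) \<le> (\<integral>\<^sup>+z. H u * HS ^ (2 * n) * H z \<partial>Q)"
    using Suc.IH[OF Suc.prems(1)] by (intro nn_integral_mono) (simp add: ac_simps)
  also have "\<dots> = H u * HS ^ (2 * n) * HS"
    by (simp add: nn_integral_cmult nn_integral_H)
  also have "(\<integral>\<^sup>+z. (q z w)\<^sup>2 \<partial>Q) \<le> (\<integral>\<^sup>+z. H w * H z \<partial>Q)"
  proof (intro nn_integral_mono)
    fix z assume z: "z \<in> space Q"
    note [measurable] = z
    show "(q z w)\<^sup>2 \<le> H w * H z"
      using Cauchy_Schwarz_nn_integral[of "\<lambda>v. ennreal (h z v)" R "\<lambda>v. ennreal (h w v)"]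
      by (simp add: q_def H_def mult.commute)
  qed
  also have "\<dots> = H w * HS"
    by (simp add: nn_integral_cmult nn_integral_H)
  finally show ?case
    by (simp add: mult_left_mono mult_right_mono ac_simps)
qed

lemma AE_H_finite:
  assumes "HS < \<infinity>"
  shows "AE u in Q. H u < \<infinity>"
proof -
  have "AE u in Q. H u \<noteq> \<infinity>"
    using assms by (intro nn_integral_PInf_AE) (auto simp: nn_integral_H)
  then show ?thesis by eventually_elim (simp add: less_top)
qed

lemma step_density_finite:
  assumes "HS < \<infinity>" "u \<in> space Q" "w \<in> space Q" "H u < \<infinity>" "H w < \<infinity>"
  shows "step_density Q q (Suc n) u w < \<infinity>"
proof -
  have "(step_density Q q (Suc n) u w)\<^sup>2 < \<infinity>"
    by (rule le_less_trans[OF step_density_le[OF assms(2,3)]])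
      (use assms in \<open>simp add: ennreal_mult_less_top power_less_top_ennreal\<close>)
  then show ?thesis by (simp add: power_less_top_ennreal)
qed

lemma step_density_slice_L2:
  assumes "HS < \<infinity>" "u \<in> space Q" "H u < \<infinity>"
  shows "(\<lambda>w. complex_of_real (enn2real (step_density Q q (Suc n) u w))) \<in> L2 Q"
proof -
  note [measurable] = assms(2)
  have "(\<integral>\<^sup>+w. ennreal ((cmod (complex_of_real (enn2real (step_density Q q (Suc n) u w))))\<^sup>2) \<partial>Q)
      \<le> (\<integral>\<^sup>+w. H u * HS ^ (2 * n) * H w \<partial>Q)"
  proof (intro nn_integral_mono)
    fix w assume w: "w \<in> space Q"
    have "ennreal ((cmod (complex_of_real (enn2real (step_density Q q (Suc n) u w))))\<^sup>2)
        = (ennreal (enn2real (step_density Q q (Suc n) u w)))\<^sup>2"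
      by (simp add: ennreal_power)
    also have "\<dots> \<le> (step_density Q q (Suc n) u w)\<^sup>2"
      by (intro power_mono) (auto simp: ennreal_enn2real_if)
    also have "\<dots> \<le> H u * HS ^ (2 * n) * H w"
      using step_density_le[OF assms(2) w, of n] by (simp add: ac_simps)
    finally show "ennreal ((cmod (complex_of_real (enn2real (step_density Q q (Suc n) u w))))\<^sup>2)
        \<le> H u * HS ^ (2 * n) * H w" .
  qed
  also have "\<dots> < \<infinity>"
    using assms by (simp add: nn_integral_cmult nn_integral_H ennreal_mult_less_top power_less_top_ennreal)
  finally show ?thesis by (subst L2_iff_nn_integral) measurable
qed

text \<open>The interchange of integrals requires absolute integrability for almost every
  \<open>u\<close>. This follows by integrating over \<open>u\<close> as well: with both marginals
  equal to 1, the total is the finite integral of |x|. The argument also covers infinite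
  \<open>HS\<close>, as the trace-class criterion demands.\<close>

lemma AE_kernel_operator_q:
  assumes x: "x \<in> L2 Q"
  shows "AE u in Q. kernel_operator Q q x u = B (A x) u"
proof -
  note [measurable] = L2D(1)[OF x]
  define G where "G v = (\<integral>\<^sup>+w. ennreal (h w v) * ennreal (cmod (x w)) \<partial>Q)" for v
  have [measurable]: "G \<in> borel_measurable R" unfolding G_def by measurable
  have "(\<integral>\<^sup>+u. \<integral>\<^sup>+v. ennreal (h u v) * G v \<partial>R \<partial>Q) = (\<integral>\<^sup>+v. G v \<partial>R)"
    by (rule swapped.nn_integral_marginal) measurable
  also have "\<dots> = (\<integral>\<^sup>+u. ennreal (cmod (x u)) \<partial>Q)"
    unfolding G_def by (rule nn_integral_marginal) measurable
  also have "\<dots> < \<infinity>"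
    using Q.L2_integrable[OF x] by (simp add: integrable_iff_bounded)
  finally have "AE u in Q. (\<integral>\<^sup>+v. ennreal (h u v) * G v \<partial>R) \<noteq> \<infinity>"
    by (intro nn_integral_PInf_AE) auto
  then show ?thesis using AE_space
  proof eventually_elim
    case (elim u)
    note [measurable] = elim(2)
    have int: "integrable (Q \<Otimes>\<^sub>M R) (\<lambda>(w, v). of_real (h u v * h w v) * x w)"
    proof (rule integrableI_bounded)
      have "(\<integral>\<^sup>+z. ennreal (norm (case z of (w, v) \<Rightarrow> of_real (h u v * h w v) * x w)) \<partial>(Q \<Otimes>\<^sub>M R))
          = (\<integral>\<^sup>+v. \<integral>\<^sup>+w. ennreal (h u v) * (ennreal (h w v) * ennreal (cmod (x w))) \<partial>Q \<partial>R)"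
        by (subst nn_integral_snd[symmetric]) (auto simp: split_beta' norm_mult ennreal_mult mult.assoc)
      also have "\<dots> = (\<integral>\<^sup>+v. ennreal (h u v) * G v \<partial>R)"
        unfolding G_def by (intro nn_integral_cong nn_integral_cmult) auto
      finally show "(\<integral>\<^sup>+z. ennreal (norm (case z of (w, v) \<Rightarrow> of_real (h u v * h w v) * x w)) \<partial>(Q \<Otimes>\<^sub>M R)) < \<infinity>"
        using elim(1) by (simp add: less_top)
    qed (simp add: split_beta')
    have "kernel_operator Q q x u = (\<integral>w. \<integral>v. of_real (h u v * h w v) * x w \<partial>R \<partial>Q)"
      unfolding kernel_operator_def
      by (intro Bochner_Integration.integral_cong) (simp_all add: enn2real_q elim(2) del: of_real_mult)
    also have "\<dots> = (\<integral>v. \<integral>w. of_real (h u v * h w v) * x w \<partial>Q \<partial>R)"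
      by (rule Fubini_integral[OF int, symmetric])
    also have "\<dots> = B (A x) u"
      unfolding kernel_int_def by (simp add: mult.assoc)
    finally show ?case .
  qed
qed

lemma AE_kernel_operator_step_density:
  assumes HS: "HS < \<infinity>" and x: "x \<in> L2 Q"
    and eigen: "AE u in Q. B (A x) u = of_real l * x u"
  shows "AE u in Q. kernel_operator Q (step_density Q q (Suc n)) x u = of_real (l ^ Suc n) * x u"
proof (induction n)
  case 0
  from AE_kernel_operator_q[OF x] eigen show ?case
    by eventually_elim (simp add: kernel_operator_def)
next
  case (Suc n)
  note [measurable] = L2D(1)[OF x]
  interpret QQ: pair_sigma_finite Q Q ..
  have base: "AE z in Q. kernel_operator Q q x z = of_real l * x z"
    using AE_kernel_operator_q[OF x] eigen by eventually_elim simp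
  show ?case
    using Suc.IH AE_H_finite[OF HS] AE_space
  proof eventually_elim
    case (elim u)
    note [measurable] = elim(3)
    let ?a = "\<lambda>z. enn2real (step_density Q q (Suc n) u z)" and ?b = "\<lambda>z w. enn2real (q z w)"
    have fin: "step_density Q q (Suc n) u z < \<infinity>" if "z \<in> space Q" "H z < \<infinity>" for z
      by (rule step_density_finite[OF HS elim(3) that(1) elim(2) that(2)])
    have fin_q: "q z w < \<infinity>" if "z \<in> space Q" "H z < \<infinity>" "w \<in> space Q" "H w < \<infinity>" for z w
      using step_density_finite[OF HS that(1,3,2,4), of 0] by simp
    \<comment> \<open>Integrating over \<open>z\<close> first leaves at most the slice of the next
      iterate times |x|, a product of two members of \<open>L2 Q\<close>.\<close>
    have int: "integrable (Q \<Otimes>\<^sub>M Q) (\<lambda>(w, z). of_real (?a z * ?b z w) * x w)"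
    proof (rule integrableI_bounded)
      have "(\<integral>\<^sup>+y. ennreal (norm (case y of (w, z) \<Rightarrow> of_real (?a z * ?b z w) * x w)) \<partial>(Q \<Otimes>\<^sub>M Q))
          = (\<integral>\<^sup>+w. \<integral>\<^sup>+z. ennreal (?a z) * ennreal (?b z w) * ennreal (cmod (x w)) \<partial>Q \<partial>Q)"
        by (subst Q.nn_integral_fst[symmetric]) (auto simp: split_beta' norm_mult ennreal_mult)
      also have "\<dots> = (\<integral>\<^sup>+w. (\<integral>\<^sup>+z. ennreal (?a z) * ennreal (?b z w) \<partial>Q) * ennreal (cmod (x w)) \<partial>Q)"
        by (intro nn_integral_cong nn_integral_multc) auto
      also have "\<dots> \<le> (\<integral>\<^sup>+w. step_density Q q (Suc (Suc n)) u w * ennreal (cmod (x w)) \<partial>Q)"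
        unfolding step_density.simps
        by (intro nn_integral_mono mult_right_mono mult_mono) (auto simp: ennreal_enn2real_if)
      also have "\<dots> = (\<integral>\<^sup>+w. ennreal (cmod (of_real (enn2real (step_density Q q (Suc (Suc n)) u w))) * cmod (x w)) \<partial>Q)"
      proof (rule nn_integral_cong_AE)
        show "AE w in Q. step_density Q q (Suc (Suc n)) u w * ennreal (cmod (x w))
            = ennreal (cmod (of_real (enn2real (step_density Q q (Suc (Suc n)) u w))) * cmod (x w))"
          using AE_H_finite[OF HS] AE_space
        proof eventually_elim
          case (elim w)
          then show ?case
            using step_density_finite[OF HS \<open>u \<in> space Q\<close> elim(2) \<open>H u < \<infinity>\<close> elim(1), of "Suc n"]
            by (simp add: ennreal_mult del: step_density.simps)
        qed
      qed
      also have "\<dots> < \<infinity>"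
        using L2_integrable_norm_mult[OF step_density_slice_L2[OF HS elim(3,2)] x, of "Suc n"]
        by (simp add: integrable_iff_bounded del: step_density.simps)
      finally show "(\<integral>\<^sup>+y. ennreal (norm (case y of (w, z) \<Rightarrow> of_real (?a z * ?b z w) * x w)) \<partial>(Q \<Otimes>\<^sub>M Q)) < \<infinity>" .
    qed (simp add: split_beta')
    \<comment> \<open>The passage from \<open>ennreal\<close> to real integrals requires the factors
      to be finite, hence the restriction to points with finite \<open>H\<close>.\<close>
    have step: "enn2real (step_density Q q (Suc (Suc n)) u w) = (\<integral>z. ?a z * ?b z w \<partial>Q)"
      if "w \<in> space Q" "H w < \<infinity>" for w
    proof -
      note [measurable] = that(1)
      have "step_density Q q (Suc (Suc n)) u w = (\<integral>\<^sup>+z. ennreal (?a z * ?b z w) \<partial>Q)"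
        unfolding step_density.simps using AE_H_finite[OF HS] AE_space
        by (intro nn_integral_cong_AE, eventually_elim) (use fin fin_q that in \<open>simp add: ennreal_mult\<close>)
      then show ?thesis by (subst integral_eq_nn_integral) (auto simp del: step_density.simps)
    qed
    have "kernel_operator Q (step_density Q q (Suc (Suc n))) x u
        = (\<integral>w. \<integral>z. of_real (?a z * ?b z w) * x w \<partial>Q \<partial>Q)"
      unfolding kernel_operator_def
    proof (intro integral_cong_AE)
      show "AE w in Q. complex_of_real (enn2real (step_density Q q (Suc (Suc n)) u w)) * x w
          = (\<integral>z. of_real (?a z * ?b z w) * x w \<partial>Q)"
        using AE_H_finite[OF HS] AE_space
        by eventually_elim (simp add: step del: step_density.simps of_real_mult)
    qed measurable
    also have "\<dots> = (\<integral>z. \<integral>w. of_real (?a z * ?b z w) * x w \<partial>Q \<partial>Q)"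
      by (rule QQ.Fubini_integral[OF int, symmetric])
    also have "\<dots> = (\<integral>z. of_real (?a z) * kernel_operator Q q x z \<partial>Q)"
      unfolding kernel_operator_def by (simp add: mult.assoc)
    also have "\<dots> = (\<integral>z. of_real l * (of_real (?a z) * x z) \<partial>Q)"
    proof (intro integral_cong_AE)
      show "(\<lambda>z. of_real (?a z) * kernel_operator Q q x z) \<in> borel_measurable Q"
        unfolding kernel_operator_def by measurable
      show "AE z in Q. of_real (?a z) * kernel_operator Q q x z = of_real l * (of_real (?a z) * x z)"
        using base by eventually_elim simp
    qed measurable
    also have "\<dots> = of_real l * kernel_operator Q (step_density Q q (Suc n)) x u"
      unfolding kernel_operator_def by simp
    also have "\<dots> = of_real (l ^ Suc (Suc n)) * x u"
      using elim(1) by simp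
    finally show ?case .
  qed
qed

text \<open>A diagonal value of a kernel with at least two steps is the inner product of two slices
  in \<open>L2 Q\<close>, one of the kernel with one step fewer and one of \<open>q\<close>. The
  eigenvalue equations, read at the point \<open>u\<close>, give the coefficients of both
  slices.\<close>

theorem nn_integral_step_density_diagonal:
  assumes HS: "HS < \<infinity>" and Q: "countably_generated Q"
    and E: "orthonormal_basis Q E" "countable E"
    and eigen: "\<And>g. g \<in> E \<Longrightarrow> AE u in Q. B (A g) u = of_real (L2_sq R (A g)) * g u"
  shows "(\<integral>\<^sup>+u. step_density Q q (Suc k) u u \<partial>Q) = (\<Sum>\<^sub>\<infinity>g\<in>E. ennreal (L2_sq R (A g) ^ Suc k))"
proof (cases k)
  case 0
  \<comment> \<open>A single step offers no intermediate point in the space of \<open>Q\<close>; its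
    trace is the Hilbert--Schmidt identity.\<close>
  then show ?thesis using nn_integral_q_diagonal infsum_L2_sq_A_basis[OF E(1) Q] by simp
next
  case (Suc n)
  define l where "l g = L2_sq R (A g)" for g
  have l: "0 \<le> l g" for g by (simp add: l_def)
  have on: "orthonormal Q E" using E(1) by (simp add: orthonormal_basis_iff)
  note E_L2 = orthonormal_L2[OF on]
  have op: "AE u in Q. \<forall>g\<in>E. kernel_operator Q (step_density Q q (Suc m)) g u = of_real (l g ^ Suc m) * g u" for m
    unfolding l_def using AE_kernel_operator_step_density[OF HS E_L2 eigen]
    by (subst AE_ball_countable[OF E(2)]) blast
  have "AE u in Q. step_density Q q (Suc (Suc n)) u u
      = (\<Sum>\<^sub>\<infinity>g\<in>E. ennreal (l g ^ Suc (Suc n) * (cmod (g u))\<^sup>2))"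
    using op[of n] op[of 0] AE_H_finite[OF HS] AE_space
  proof eventually_elim
    case (elim u)
    note [measurable] = elim(4)
    let ?a = "\<lambda>z. complex_of_real (enn2real (step_density Q q (Suc n) u z))"
    let ?b = "\<lambda>z. complex_of_real (enn2real (q u z))"
    have a: "?a \<in> L2 Q" by (rule step_density_slice_L2[OF HS elim(4,3)])
    have b: "?b \<in> L2 Q" using step_density_slice_L2[OF HS elim(4,3), of 0] by simp
    \<comment> \<open>The kernel is real, so the coefficient of its slice at \<open>u\<close> is the
      conjugate of the operator applied to \<open>g\<close> at \<open>u\<close>.\<close>
    have ag: "L2_inner Q ?a g = of_real (l g ^ Suc n) * cnj (g u)" if "g \<in> E" for g
    proof -
      have "L2_inner Q ?a g = (\<integral>z. cnj (?a z * g z) \<partial>Q)"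
        unfolding L2_inner_def by simp
      also have "\<dots> = cnj (kernel_operator Q (step_density Q q (Suc n)) g u)"
        unfolding kernel_operator_def by (rule Bochner_Integration.integral_cnj)
      finally show ?thesis using elim(1) that by simp
    qed
    have gb: "L2_inner Q g ?b = of_real (l g) * g u" if "g \<in> E" for g
      using elim(2) that by (simp add: kernel_operator_def L2_inner_def mult.commute)
    have "L2_inner Q ?a g * L2_inner Q g ?b = of_real (l g ^ Suc (Suc n) * (cmod (g u))\<^sup>2)" if "g \<in> E" for g
      unfolding ag[OF that] gb[OF that] by (simp add: complex_norm_square mult.commute mult.left_commute flip: of_real_power)
    then have "(\<Sum>g\<in>initial_part E m. L2_inner Q ?a g * L2_inner Q g ?b)
        = of_real (\<Sum>g\<in>initial_part E m. l g ^ Suc (Suc n) * (cmod (g u))\<^sup>2)" for m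
      using initial_part_subset[of E m] by (subst of_real_sum, intro sum.cong) auto
    then have lim: "(\<lambda>m. complex_of_real (\<Sum>g\<in>initial_part E m. l g ^ Suc (Suc n) * (cmod (g u))\<^sup>2))
        \<longlonglongrightarrow> L2_inner Q ?a ?b"
      using Parseval_inner[OF E a b] by simp
    define s where "s = (\<integral>z. enn2real (step_density Q q (Suc n) u z) * enn2real (q u z) \<partial>Q)"
    have inner: "L2_inner Q ?a ?b = of_real s"
      unfolding L2_inner_def s_def by (simp flip: of_real_mult)
    have "integrable Q (\<lambda>z. enn2real (step_density Q q (Suc n) u z) * enn2real (q u z))"
      using L2_integrable_norm_mult[OF a b] by simp
    then have "ennreal s = (\<integral>\<^sup>+z. ennreal (enn2real (step_density Q q (Suc n) u z) * enn2real (q u z)) \<partial>Q)"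
      unfolding s_def by (intro nn_integral_eq_integral[symmetric]) auto
    \<comment> \<open>Outside the null set of infinite \<open>H\<close> both factors are finite, so
      \<open>enn2real\<close> loses nothing; symmetry of \<open>q\<close> restores the argument
      order of the recursion.\<close>
    also have "\<dots> = (\<integral>\<^sup>+z. step_density Q q (Suc n) u z * q z u \<partial>Q)"
    proof (rule nn_integral_cong_AE)
      show "AE z in Q. ennreal (enn2real (step_density Q q (Suc n) u z) * enn2real (q u z))
          = step_density Q q (Suc n) u z * q z u"
        using AE_H_finite[OF HS] AE_space
      proof eventually_elim
        case (elim z)
        then show ?case
          using step_density_finite[OF HS \<open>u \<in> space Q\<close> elim(2) \<open>H u < \<infinity>\<close> elim(1), of n]
            step_density_finite[OF HS \<open>u \<in> space Q\<close> elim(2) \<open>H u < \<infinity>\<close> elim(1), of 0]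
          by (simp add: ennreal_mult q_commute[of z u] del: step_density.simps(2))
      qed
    qed
    finally have "ennreal s = step_density Q q (Suc (Suc n)) u u" by simp
    moreover have "(\<Sum>\<^sub>\<infinity>g\<in>E. ennreal (l g ^ Suc (Suc n) * (cmod (g u))\<^sup>2)) = ennreal s"
      using lim l unfolding inner tendsto_of_real_iff by (intro infsum_ennreal_eqI E(2)) auto
    ultimately show ?case by simp
  qed
  then have "(\<integral>\<^sup>+u. step_density Q q (Suc (Suc n)) u u \<partial>Q)
      = (\<integral>\<^sup>+u. (\<Sum>\<^sub>\<infinity>g\<in>E. ennreal (l g ^ Suc (Suc n)) * ennreal ((cmod (g u))\<^sup>2)) \<partial>Q)"
    by (intro nn_integral_cong_AE) (simp add: ennreal_mult l del: step_density.simps power_Suc)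
  also have "\<dots> = (\<Sum>\<^sub>\<infinity>g\<in>E. \<integral>\<^sup>+u. ennreal (l g ^ Suc (Suc n)) * ennreal ((cmod (g u))\<^sup>2) \<partial>Q)"
  proof (intro nn_integral_infsum E(2))
    fix g assume "g \<in> E"
    note [measurable] = L2D(1)[OF E_L2[OF this]]
    show "(\<lambda>u. ennreal (l g ^ Suc (Suc n)) * ennreal ((cmod (g u))\<^sup>2)) \<in> borel_measurable Q"
      by measurable
  qed
  also have "\<dots> = (\<Sum>\<^sub>\<infinity>g\<in>E. ennreal (l g ^ Suc (Suc n)))"
  proof (intro infsum_cong)
    fix g assume g: "g \<in> E"
    have "(\<integral>\<^sup>+u. ennreal (l g ^ Suc (Suc n)) * ennreal ((cmod (g u))\<^sup>2) \<partial>Q)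
        = ennreal (l g ^ Suc (Suc n)) * (\<integral>\<^sup>+u. ennreal ((cmod (g u))\<^sup>2) \<partial>Q)"
      by (intro nn_integral_cmult borel_measurable_cmod_sq E_L2 g)
    then show "(\<integral>\<^sup>+u. ennreal (l g ^ Suc (Suc n)) * ennreal ((cmod (g u))\<^sup>2) \<partial>Q)
        = ennreal (l g ^ Suc (Suc n))"
      by (simp add: L2_sq_nn_integral[OF E_L2[OF g]] orthonormal_sq[OF on g])
  qed
  finally show ?thesis by (simp add: Suc l_def)
qed

end

section \<open>Eigenvalues and their multiplicities\<close>

text \<open>Gaussian elimination: the pivot unknown \<open>j\<close> of the equation
  \<open>e\<close> is eliminated from the remaining equations. The lemma serves to bound the
  dimension of an eigenspace.\<close>

lemma ex_nontrivial_homogeneous_solution: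
  fixes a :: "'i \<Rightarrow> 'e \<Rightarrow> complex"
  assumes "finite F" "finite I" "card F < card I"
  shows "\<exists>c. (\<exists>i\<in>I. c i \<noteq> 0) \<and> (\<forall>e\<in>F. (\<Sum>i\<in>I. c i * a i e) = 0)"
  using assms
proof (induction F arbitrary: I a rule: finite_induct)
  case empty
  then have "I \<noteq> {}" by auto
  then show ?case by (intro exI[of _ "\<lambda>_. 1"]) auto
next
  case (insert e F)
  show ?case
  proof (cases "\<forall>i\<in>I. a i e = 0")
    case True
    with insert.IH[of I a] insert.hyps insert.prems show ?thesis by auto
  next
    case False
    then obtain j where j: "j \<in> I" "a j e \<noteq> 0" by blast
    define b where "b i f = a i f - a i e / a j e * a j f" for i f
    have "card F < card (I - {j})"
      using insert.hyps insert.prems j(1) by simp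
    then obtain c where c: "\<exists>i\<in>I - {j}. c i \<noteq> 0" "\<And>f. f \<in> F \<Longrightarrow> (\<Sum>i\<in>I - {j}. c i * b i f) = 0"
      using insert.IH[of "I - {j}" b] insert.prems(1) by blast
    \<comment> \<open>The value of the eliminated unknown \<open>j\<close> that solves the equation
      \<open>e\<close>.\<close>
    define t where "t = - (\<Sum>i\<in>I - {j}. c i * a i e) / a j e"
    define d where "d = c(j := t)"
    have sum_d: "(\<Sum>i\<in>I. d i * a i f) = t * a j f + (\<Sum>i\<in>I - {j}. c i * a i f)" for f
      using insert.prems(1) j(1) by (simp add: sum.remove[of I j] d_def)
    have "(\<Sum>i\<in>I. d i * a i e) = 0"
      unfolding sum_d t_def using j(2) by simp
    moreover have "(\<Sum>i\<in>I. d i * a i f) = 0" if "f \<in> F" for f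
    proof -
      have "(\<Sum>i\<in>I - {j}. c i * b i f)
          = (\<Sum>i\<in>I - {j}. c i * a i f) - (\<Sum>i\<in>I - {j}. c i * a i e) / a j e * a j f"
        by (simp add: b_def right_diff_distrib sum_subtractf sum_distrib_right sum_divide_distrib mult.assoc)
      then show ?thesis unfolding sum_d t_def using c(2)[OF that] by simp
    qed
    moreover have "\<exists>i\<in>I. d i \<noteq> 0" using c(1) by (auto simp: d_def)
    ultimately show ?thesis by (intro exI[of _ d]) auto
  qed
qed

text \<open>Breaking ties by \<open>to_nat_on\<close> makes \<open>less\<close> a total order on
  \<open>S\<close>. The predecessors of an element lie in a finite superlevel set of
  \<open>l\<close>, so ranks are finite and increasing enumeration of the ranks lists
  \<open>S\<close> in decreasing order of \<open>l\<close>.\<close>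

lemma ex_decreasing_enumeration:
  fixes l :: "'i \<Rightarrow> real"
  assumes S: "countable S" "S \<noteq> {}" and pos: "\<And>g. g \<in> S \<Longrightarrow> 0 < l g"
    and fin: "\<And>e. 0 < e \<Longrightarrow> finite {g \<in> S. e \<le> l g}"
  obtains \<kappa> :: enat and b where "bij_betw b {i. enat i \<le> \<kappa>} S"
    "\<And>i j. i \<le> j \<Longrightarrow> enat j \<le> \<kappa> \<Longrightarrow> l (b j) \<le> l (b i)"
proof -
  define less where "less g h \<longleftrightarrow> l h < l g \<or> l h = l g \<and> to_nat_on S g < to_nat_on S h" for g h
  define rank where "rank g = card {h \<in> S. less h g}" for g
  have fin_pred: "finite {h \<in> S. less h g}" if "g \<in> S" for g
    by (rule finite_subset[OF _ fin[OF pos[OF that]]]) (auto simp: less_def)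
  have rank_less: "rank g < rank h" if "g \<in> S" "h \<in> S" "less g h" for g h
    unfolding rank_def
  proof (rule psubset_card_mono[OF fin_pred[OF that(2)]])
    show "{k \<in> S. less k g} \<subset> {k \<in> S. less k h}"
      using that by (auto simp: less_def)
  qed
  have total: "less g h \<or> less h g" if "g \<in> S" "h \<in> S" "g \<noteq> h" for g h
  proof -
    have "to_nat_on S g \<noteq> to_nat_on S h"
      using that inj_on_to_nat_on[OF S(1)] by (simp add: inj_on_eq_iff)
    then show ?thesis
      by (cases "l g" "l h" rule: linorder_cases) (auto simp: less_def)
  qed
  have inj: "inj_on rank S"
    using total rank_less by (intro inj_onI) (metis less_irrefl)
  have l_le: "l h \<le> l g" if "g \<in> S" "h \<in> S" "rank g \<le> rank h" for g h
    using total[of g h] rank_less[of h g] that by (cases "g = h") (auto simp: less_def)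
  define r where "r = inv_into S rank"
  have r: "bij_betw r (rank ` S) S"
    unfolding r_def using bij_betw_inv_into[of rank S "rank ` S"] inj by (simp add: bij_betw_def)
  have rank_r: "rank (r n) = n" if "n \<in> rank ` S" for n
    unfolding r_def using that by (rule f_inv_into_f)
  have r_in: "r n \<in> S" if "n \<in> rank ` S" for n
    using r that by (auto simp: bij_betw_def)
  show ?thesis
  proof (cases "finite S")
    case False
    then have inf: "infinite (rank ` S)" using inj finite_imageD by blast
    have "bij_betw (r \<circ> enumerate (rank ` S)) {i. enat i \<le> \<infinity>} S"
      using bij_betw_trans[OF bij_enumerate[OF inf] r] by simp
    moreover have "l ((r \<circ> enumerate (rank ` S)) j) \<le> l ((r \<circ> enumerate (rank ` S)) i)" if "i \<le> j" for i j
      using enumerate_in_set[OF inf] enumerate_mono_le_iff[OF inf, of i j] that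
      by (simp add: l_le r_in rank_r)
    ultimately show ?thesis by (rule that)
  next
    case True
    let ?S = "rank ` S"
    have fS: "finite ?S" using True by simp
    \<comment> \<open>Indices start at 0 and include \<kappa>, so \<kappa> is one less than the
      number of elements; nonemptiness keeps the truncated subtraction correct.\<close>
    have "card ?S > 0" using True S(2) by (simp add: card_gt_0_iff)
    then have dom: "{i. enat i \<le> enat (card ?S - 1)} = {..<card ?S}" by auto
    have "bij_betw (r \<circ> enumerate ?S) {i. enat i \<le> enat (card ?S - 1)} S"
      unfolding dom using bij_betw_trans[OF finite_bij_enumerate[OF fS] r] .
    moreover have "l ((r \<circ> enumerate ?S) j) \<le> l ((r \<circ> enumerate ?S) i)"
      if "i \<le> j" "enat j \<le> enat (card ?S - 1)" for i j
    proof -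
      have j: "j < card ?S" using that dom by auto
      then have "enumerate ?S i \<le> enumerate ?S j"
        using that(1) finite_enumerate_mono[OF _ fS j, of i] by (cases "i = j") auto
      then show ?thesis
        using finite_enumerate_in_set[OF fS] j that(1) by (simp add: l_le r_in rank_r)
    qed
    ultimately show ?thesis by (rule that)
  qed
qed

text \<open>For an eigenfunction, comparison of coefficients leaves only basis elements with
  eigenvalue \<open>t\<close>, so these span the eigenspace. The condition \<open>coeff\<close>
  replaces linearity and self-adjointness of \<open>T\<close>.\<close>

lemma multiplicity_of_eigenbasis:
  assumes E: "orthonormal_basis Q E"
    and eigen: "\<And>g. g \<in> E \<Longrightarrow> AE u in Q. T g u = of_real (l g) * g u"
    and coeff: "\<And>x g. x \<in> L2 Q \<Longrightarrow> g \<in> E \<Longrightarrow> L2_inner Q (T x) g = of_real (l g) * L2_inner Q x g"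
    and meas: "\<And>x. x \<in> L2 Q \<Longrightarrow> T x \<in> borel_measurable Q"
    and fin: "finite {g \<in> E. l g = t}"
  shows "multiplicity_of Q T t = enat (card {g \<in> E. l g = t})"
proof -
  define F where "F = {g \<in> E. l g = t}"
  define N where "N = {enat n | n. \<exists>g. (\<forall>i<n. g i \<in> eigenspace Q T t) \<and> AE_independent Q n g}"
  have on: "orthonormal Q E" using E by (simp add: orthonormal_basis_iff)
  note E_L2 = orthonormal_L2[OF on]
  have F: "finite F" "F \<subseteq> E" using fin by (auto simp: F_def)
  obtain e where e: "bij_betw e {0..<card F} F" using ex_bij_betw_nat_finite[OF F(1)] by blast
  then have eF: "e i \<in> F" if "i < card F" for i using that by (auto simp: bij_betw_def)
  have "e i \<in> eigenspace Q T t" if "i < card F" for i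
    using eF[OF that] E_L2 eigen by (auto simp: eigenspace_def F_def)
  moreover have "AE_independent Q (card F) e"
    unfolding AE_independent_def
  proof (intro allI impI)
    fix c j assume ae: "AE u in Q. (\<Sum>i<card F. c i * e i u) = 0" and j: "j < card F"
    let ?y = "\<lambda>u. \<Sum>i<card F. c i * e i u"
    have eL: "e i \<in> L2 Q" if "i < card F" for i using eF[OF that] F(2) E_L2 by auto
    have y: "?y \<in> L2 Q" by (intro L2_sum L2_scale eL) auto
    have "L2_inner Q ?y (e j) = L2_inner Q (\<lambda>u. 0) (e j)"
      using ae by (intro L2_inner_cong_AE L2D(1)[OF y] L2D(1)[OF eL[OF j]]) auto
    moreover have "L2_inner Q ?y (e j) = (\<Sum>i<card F. L2_inner Q (\<lambda>u. c i * e i u) (e j))"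
      by (intro L2_inner_sum_left L2_scale eL j) auto
    moreover have "\<dots> = (\<Sum>i<card F. if i = j then c j else 0)"
    proof (intro sum.cong refl)
      fix i assume i: "i \<in> {..<card F}"
      have "e i = e j \<longleftrightarrow> i = j"
        using e i j by (auto simp: bij_betw_def inj_on_def)
      then show "L2_inner Q (\<lambda>u. c i * e i u) (e j) = (if i = j then c j else 0)"
        using on eF[of i] eF[OF j] i F(2) by (auto simp: L2_inner_scale_left orthonormal_def subset_iff)
    qed
    ultimately show "c j = 0" using j by simp
  qed
  ultimately have mem: "enat (card F) \<in> N" unfolding N_def by blast
  have expansion: "AE u in Q. x u = (\<Sum>g\<in>F. L2_inner Q x g * g u)" if x: "x \<in> eigenspace Q T t" for x
  proof -
    have xL: "x \<in> L2 Q" and Tx: "AE u in Q. T x u = of_real t * x u"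
      using x by (auto simp: eigenspace_def)
    let ?y = "\<lambda>u. \<Sum>g\<in>F. L2_inner Q x g * g u"
    have y: "?y \<in> L2 Q" by (rule orthonormal_combination_L2[OF on F(2)])
    have "L2_inner Q (\<lambda>u. x u - ?y u) g = 0" if g: "g \<in> E" for g
    proof -
      have "of_real (l g) * L2_inner Q x g = L2_inner Q (T x) g" using coeff[OF xL g] by simp
      also have "\<dots> = L2_inner Q (\<lambda>u. of_real t * x u) g"
        using Tx by (intro L2_inner_cong_AE meas xL L2D(1)[OF L2_scale[OF xL]] L2D(1)[OF E_L2[OF g]]) auto
      also have "\<dots> = of_real t * L2_inner Q x g" by (rule L2_inner_scale_left)
      finally have "l g = t \<or> L2_inner Q x g = 0" by auto
      then show ?thesis
        using orthonormal_inner_combination[OF on F g, of "L2_inner Q x"] g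
        unfolding L2_inner_diff_left[OF xL y E_L2[OF g]] by (auto simp: F_def)
    qed
    then have "AE u in Q. x u - ?y u = 0"
      using E L2_diff[OF xL y] unfolding orthonormal_basis_iff by blast
    then show ?thesis by eventually_elim simp
  qed
  have "n \<le> card F" if g: "\<forall>i<n. g i \<in> eigenspace Q T t" "AE_independent Q n g" for n g
  proof (rule ccontr)
    assume "\<not> n \<le> card F"
    \<comment> \<open>More than \<open>card F\<close> coefficient vectors of length
      \<open>card F\<close> satisfy a nontrivial linear relation, which the expansion transfers to
      the functions.\<close>
    then obtain c where c: "\<exists>i\<in>{..<n}. c i \<noteq> 0"
      "\<And>e. e \<in> F \<Longrightarrow> (\<Sum>i\<in>{..<n}. c i * L2_inner Q (g i) e) = 0"
      using ex_nontrivial_homogeneous_solution[OF F(1), of "{..<n}" "\<lambda>i. L2_inner Q (g i)"] by auto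
    have "AE u in Q. \<forall>i\<in>{..<n}. g i u = (\<Sum>e\<in>F. L2_inner Q (g i) e * e u)"
      using g(1) by (intro AE_finite_allI expansion) auto
    then have "AE u in Q. (\<Sum>i<n. c i * g i u) = 0"
    proof eventually_elim
      case (elim u)
      then have "(\<Sum>i<n. c i * g i u) = (\<Sum>i<n. \<Sum>e\<in>F. c i * L2_inner Q (g i) e * e u)"
        by (simp add: sum_distrib_left mult.assoc)
      also have "\<dots> = (\<Sum>e\<in>F. (\<Sum>i<n. c i * L2_inner Q (g i) e) * e u)"
        by (subst sum.swap) (simp add: sum_distrib_right)
      also have "\<dots> = 0" using c(2) by simp
      finally show ?case .
    qed
    then show False using g(2) c(1) by (auto simp: AE_independent_def)
  qed
  then have "z \<le> enat (card F)" if "z \<in> N" for z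
    using that unfolding N_def by auto
  then have "Sup N = enat (card F)"
    using mem by (intro antisym Sup_least Sup_upper)
  then show ?thesis by (simp add: multiplicity_of_def N_def F_def)
qed

text \<open>The index set \<open>{i. enat i \<le> \<kappa>}\<close> always contains 0, which is why
  a positive eigenvalue must exist.\<close>

lemma ex_enumeration_of_eigenvalues:
  assumes E: "countable E" "\<And>t. 0 < t \<Longrightarrow> finite {g \<in> E. t \<le> l g}" "\<exists>g\<in>E. 0 < l g"
    and mult: "\<And>t. 0 < t \<Longrightarrow> multiplicity_of Q T t = enat (card {g \<in> E. l g = t})"
  shows "\<exists>\<kappa> lam. enumerates_positive_eigenvalues Q T \<kappa> lam"
proof -
  define S where "S = {g \<in> E. 0 < l g}"
  have S: "countable S" "S \<noteq> {}" "\<And>g. g \<in> S \<Longrightarrow> 0 < l g"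
    using E(1,3) by (auto simp: S_def)
  have S_fin: "finite {g \<in> S. e \<le> l g}" if "0 < e" for e
    by (rule finite_subset[OF _ E(2)[OF that]]) (auto simp: S_def)
  obtain \<kappa> :: enat and b where b: "bij_betw b {i. enat i \<le> \<kappa>} S"
    "\<And>i j. i \<le> j \<Longrightarrow> enat j \<le> \<kappa> \<Longrightarrow> l (b j) \<le> l (b i)"
  proof (rule ex_decreasing_enumeration[OF S(1,2)])
    show "0 < l g" if "g \<in> S" for g using S(3)[OF that] .
    show "finite {g \<in> S. e \<le> l g}" if "0 < e" for e using S_fin[OF that] .
  qed (rule that)
  have b_S: "b i \<in> S" if "enat i \<le> \<kappa>" for i
    using b(1) that by (auto simp: bij_betw_def)
  have level: "bij_betw b {i. enat i \<le> \<kappa> \<and> l (b i) = t} {g \<in> E. l g = t}" if t: "0 < t" for t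
  proof (rule bij_betw_subset[OF b(1)])
    have "{g \<in> E. l g = t} \<subseteq> b ` {i. enat i \<le> \<kappa>}"
      using b(1) t by (auto simp: bij_betw_def S_def)
    then show "b ` {i. enat i \<le> \<kappa> \<and> l (b i) = t} = {g \<in> E. l g = t}"
      using b_S by (auto simp: S_def)
  qed auto
  have "finite {g \<in> E. l g = t}" if "0 < t" for t
    by (rule finite_subset[OF _ E(2)[OF that]]) auto
  then have "enumerates_positive_eigenvalues Q T \<kappa> (\<lambda>i. l (b i))"
    unfolding enumerates_positive_eigenvalues_def
    using b_S b(2) bij_betw_finite[OF level] bij_betw_same_card[OF level] mult
    by (auto simp: S_def)
  then show ?thesis by blast
qed

text \<open>Each level \<open>t > 0\<close> contains as many indices as basis elements, so
  bijections between the levels glue to one bijection. Basis elements with eigenvalue 0 contribute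
  nothing, as the exponent is positive.\<close>

lemma infsum_enumerated_eigenvalues:
  assumes E: "\<And>t. 0 < t \<Longrightarrow> finite {g \<in> E. t \<le> l g}" "\<And>g. g \<in> E \<Longrightarrow> 0 \<le> l g"
    and mult: "\<And>t. 0 < t \<Longrightarrow> multiplicity_of Q T t = enat (card {g \<in> E. l g = t})"
    and enum: "enumerates_positive_eigenvalues Q T \<kappa> lam" and k: "0 < k"
  shows "(\<Sum>\<^sub>\<infinity>i\<in>{i. enat i \<le> \<kappa>}. ennreal (lam i ^ k)) = (\<Sum>\<^sub>\<infinity>g\<in>E. ennreal (l g ^ k))"
proof -
  define I where "I = {i. enat i \<le> \<kappa>}"
  have pos: "0 < lam i" if "i \<in> I" for i
    using enum that by (auto simp: enumerates_positive_eigenvalues_def I_def)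
  have "\<exists>\<beta>. bij_betw \<beta> {i \<in> I. lam i = t} {g \<in> E. l g = t}" if t: "0 < t" for t
  proof (rule finite_same_card_bij)
    show "finite {i \<in> I. lam i = t}" "card {i \<in> I. lam i = t} = card {g \<in> E. l g = t}"
      using enum mult[OF t] t by (auto simp: enumerates_positive_eigenvalues_def I_def)
    show "finite {g \<in> E. l g = t}"
      by (rule finite_subset[OF _ E(1)[OF t]]) auto
  qed
  then obtain \<beta> where \<beta>: "\<And>t. 0 < t \<Longrightarrow> bij_betw (\<beta> t) {i \<in> I. lam i = t} {g \<in> E. l g = t}"
    by metis
  define b where "b i = \<beta> (lam i) i" for i
  have bE: "b i \<in> E" "l (b i) = lam i" if "i \<in> I" for i
    using \<beta>[OF pos[OF that]] that by (auto simp: b_def bij_betw_def)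
  have bij: "bij_betw b I {g \<in> E. 0 < l g}"
    unfolding bij_betw_def
  proof
    show "inj_on b I"
    proof (rule inj_onI)
      fix i j assume ij: "i \<in> I" "j \<in> I" "b i = b j"
      then have "lam i = lam j" using bE(2) by metis
      then show "i = j"
        using ij \<beta>[OF pos[OF ij(1)]] by (auto simp: b_def bij_betw_def inj_on_def)
    qed
    show "b ` I = {g \<in> E. 0 < l g}"
    proof
      show "b ` I \<subseteq> {g \<in> E. 0 < l g}" using bE pos by auto
      show "{g \<in> E. 0 < l g} \<subseteq> b ` I"
      proof
        fix g assume g: "g \<in> {g \<in> E. 0 < l g}"
        then have "g \<in> \<beta> (l g) ` {i \<in> I. lam i = l g}"
          using \<beta>[of "l g"] by (auto simp: bij_betw_def)
        then obtain i where "i \<in> I" "lam i = l g" "g = \<beta> (l g) i" by blast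
        then show "g \<in> b ` I" by (intro image_eqI[of _ _ i]) (auto simp: b_def)
      qed
    qed
  qed
  have "(\<Sum>\<^sub>\<infinity>i\<in>I. ennreal (lam i ^ k)) = (\<Sum>\<^sub>\<infinity>i\<in>I. ennreal (l (b i) ^ k))"
    using bE by (intro infsum_cong) simp
  also have "\<dots> = (\<Sum>\<^sub>\<infinity>g\<in>{g \<in> E. 0 < l g}. ennreal (l g ^ k))"
    by (rule infsum_reindex_bij_betw[OF bij])
  also have "\<dots> = (\<Sum>\<^sub>\<infinity>g\<in>E. ennreal (l g ^ k))"
  proof (rule infsum_cong_neutral)
    fix g assume "g \<in> E - {g \<in> E. 0 < l g}"
    then have "l g = 0" using E(2)[of g] by auto
    then show "ennreal (l g ^ k) = 0" using k by simp
  qed auto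
  finally show ?thesis by (simp add: I_def)
qed

section \<open>The trace-class criterion and the positive eigenvalues\<close>

context kernel_pair
begin

interpretation swapped: kernel_pair R Q "\<lambda>v u. h u v" by (rule swap)

text \<open>The definition of trace-class asks for some basis, but the diagonal sum is
  \<open>HS\<close> for every basis, and a basis exists.\<close>

lemma trace_class_iff:
  assumes Q: "countably_generated Q"
    and T: "\<And>x. x \<in> L2 Q \<Longrightarrow> T x \<in> borel_measurable Q"
      "\<And>x. x \<in> L2 Q \<Longrightarrow> AE u in Q. T x u = B (A x) u"
  shows "trace_class Q T \<longleftrightarrow> HS < \<infinity>"
proof -
  have inner: "L2_inner Q (T g) g = of_real (L2_sq R (A g))" if "orthonormal_basis Q E" "g \<in> E" for E g
  proof -
    have g: "g \<in> L2 Q" using that by (auto simp: orthonormal_basis_def)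
    have "L2_inner Q (T g) g = L2_inner Q (B (A g)) g"
      by (intro L2_inner_cong_AE T g L2D(1)[OF B_A_L2[OF g]] L2D(1)[OF g]) simp
    then show ?thesis by (simp add: inner_B_A_self[OF g])
  qed
  have summable: "(\<lambda>g. L2_inner Q (T g) g) summable_on E \<longleftrightarrow> HS < \<infinity>" if E: "orthonormal_basis Q E" for E
  proof -
    have "(\<lambda>g. L2_inner Q (T g) g) summable_on E \<longleftrightarrow> (\<lambda>g. complex_of_real (L2_sq R (A g))) summable_on E"
      by (intro summable_on_cong inner[OF E])
    also have "\<dots> \<longleftrightarrow> (\<lambda>g. L2_sq R (A g)) summable_on E"
      using summable_on_of_real[of "\<lambda>g. L2_sq R (A g)" E]
        summable_on_bounded_linear[OF bounded_linear_Re, of "\<lambda>g. complex_of_real (L2_sq R (A g))" E]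
      by auto
    also have "\<dots> \<longleftrightarrow> (\<Sum>\<^sub>\<infinity>g\<in>E. ennreal (L2_sq R (A g))) < \<infinity>"
    proof
      assume s: "(\<lambda>g. L2_sq R (A g)) summable_on E"
      have "(\<Sum>\<^sub>\<infinity>g\<in>E. ennreal (L2_sq R (A g))) \<le> ennreal (\<Sum>\<^sub>\<infinity>g\<in>E. L2_sq R (A g))"
        unfolding nonneg_infsum_complete[OF zero_le]
        by (rule SUP_least) (auto intro!: ennreal_leI finite_sum_le_infsum s)
      then show "(\<Sum>\<^sub>\<infinity>g\<in>E. ennreal (L2_sq R (A g))) < \<infinity>"
        by (rule le_less_trans) simp
    next
      assume fin: "(\<Sum>\<^sub>\<infinity>g\<in>E. ennreal (L2_sq R (A g))) < \<infinity>"
      show "(\<lambda>g. L2_sq R (A g)) summable_on E"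
      proof (rule nonneg_bdd_above_summable_on)
        have "(\<Sum>g\<in>F. L2_sq R (A g)) \<le> enn2real (\<Sum>\<^sub>\<infinity>g\<in>E. ennreal (L2_sq R (A g)))"
          if "finite F" "F \<subseteq> E" for F
        proof -
          have "ennreal (\<Sum>g\<in>F. L2_sq R (A g)) = (\<Sum>g\<in>F. ennreal (L2_sq R (A g)))"
            by (rule sum_ennreal[symmetric]) simp
          also have "\<dots> \<le> (\<Sum>\<^sub>\<infinity>g\<in>E. ennreal (L2_sq R (A g)))"
            unfolding nonneg_infsum_complete[OF zero_le] using that by (intro SUP_upper) auto
          also have "\<dots> = ennreal (enn2real (\<Sum>\<^sub>\<infinity>g\<in>E. ennreal (L2_sq R (A g))))"
            using fin by simp
          finally show ?thesis by simp
        qed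
        then show "bdd_above (sum (\<lambda>g. L2_sq R (A g)) ` {F. F \<subseteq> E \<and> finite F})"
          by (intro bdd_aboveI) auto
      qed simp
    qed
    also have "\<dots> \<longleftrightarrow> HS < \<infinity>" by (simp add: infsum_L2_sq_A_basis[OF E Q])
    finally show ?thesis .
  qed
  then show ?thesis using ex_orthonormal_basis[of Q] by (auto simp: trace_class_def)
qed

theorem positive_eigenvalues:
  assumes HS: "HS < \<infinity>" and Q: "countably_generated Q"
    and T: "\<And>x. x \<in> L2 Q \<Longrightarrow> T x \<in> borel_measurable Q"
      "\<And>x. x \<in> L2 Q \<Longrightarrow> AE u in Q. T x u = B (A x) u"
  shows "\<exists>\<kappa> lam. enumerates_positive_eigenvalues Q T \<kappa> lam"
    "enumerates_positive_eigenvalues Q T \<kappa> lam \<Longrightarrow>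
       (\<Sum>\<^sub>\<infinity>i\<in>{i. enat i \<le> \<kappa>}. ennreal (lam i ^ Suc k)) = (\<integral>\<^sup>+u. step_density Q q (Suc k) u u \<partial>Q)"
proof -
  obtain E where E: "orthonormal_basis Q E" "countable E"
    and eigen: "\<And>g. g \<in> E \<Longrightarrow> AE u in Q. B (A g) u = of_real (L2_sq R (A g)) * g u"
    using ex_eigenbasis[OF HS Q] by blast
  define l where "l g = L2_sq R (A g)" for g
  have on: "orthonormal Q E" using E(1) by (simp add: orthonormal_basis_iff)
  note E_L2 = orthonormal_L2[OF on]
  have sum: "(\<Sum>\<^sub>\<infinity>g\<in>E. ennreal (l g)) = HS"
    unfolding l_def by (rule infsum_L2_sq_A_basis[OF E(1) Q])
  have fin: "finite {g \<in> E. t \<le> l g}" if t: "0 < t" for t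
  proof (rule finite_if_finite_subsets_card_bdd[THEN conjunct1])
    \<comment> \<open>Chebyshev's bound: each element of \<open>F\<close> contributes at least
      \<open>t\<close> to a sum that is at most \<open>HS\<close>.\<close>
    show "card F \<le> nat \<lceil>enn2real HS / t\<rceil>" if F: "F \<subseteq> {g \<in> E. t \<le> l g}" "finite F" for F
    proof -
      have "ennreal (real (card F) * t) \<le> ennreal (\<Sum>g\<in>F. l g)"
        using sum_bounded_below[of F t l] F by (intro ennreal_leI) auto
      also have "\<dots> = (\<Sum>g\<in>F. ennreal (l g))"
        by (rule sum_ennreal[symmetric]) (simp add: l_def)
      also have "\<dots> \<le> HS"
        unfolding sum[symmetric] nonneg_infsum_complete[OF zero_le] using F by (intro SUP_upper) auto
      also have "\<dots> = ennreal (enn2real HS)" using HS by simp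
      finally have "real (card F) \<le> enn2real HS / t" using t by (simp add: pos_le_divide_eq)
      then show ?thesis by linarith
    qed
  qed
  have mult: "multiplicity_of Q T t = enat (card {g \<in> E. l g = t})" if t: "0 < t" for t
  proof (rule multiplicity_of_eigenbasis[OF E(1)])
    show T_eigen: "AE u in Q. T g u = of_real (l g) * g u" if "g \<in> E" for g
      using T(2)[OF E_L2[OF that]] eigen[OF that] by eventually_elim (simp add: l_def)
    show "T x \<in> borel_measurable Q" if "x \<in> L2 Q" for x using T(1) that .
    show "finite {g \<in> E. l g = t}"
      by (rule finite_subset[OF _ fin[OF t]]) auto
    show "L2_inner Q (T x) g = of_real (l g) * L2_inner Q x g" if x: "x \<in> L2 Q" and g: "g \<in> E" for x g
    proof -
      note gL = E_L2[OF g]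
      have "L2_inner Q (T x) g = L2_inner Q (B (A x)) g"
        by (intro L2_inner_cong_AE T x L2D(1)[OF B_A_L2[OF x]] L2D(1)[OF gL]) simp
      also have "\<dots> = L2_inner Q x (B (A g))" by (rule B_A_selfadjoint[OF x gL])
      also have "\<dots> = L2_inner Q x (\<lambda>u. of_real (l g) * g u)"
        unfolding l_def using eigen[OF g]
        by (intro L2_inner_cong_AE L2D(1)[OF x] L2D(1)[OF L2_scale[OF gL]] L2D(1)[OF B_A_L2[OF gL]]) auto
      finally show ?thesis by (simp add: L2_inner_scale_right)
    qed
  qed
  \<comment> \<open>If all eigenvalues were 0, then \<open>HS\<close> = 0 and \<open>h\<close> would
    vanish almost everywhere, against its marginals being 1.\<close>
  have ex: "\<exists>g\<in>E. 0 < l g"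
  proof (rule ccontr)
    assume "\<not> (\<exists>g\<in>E. 0 < l g)"
    then have l0: "l g = 0" if "g \<in> E" for g
      using that L2_sq_nonneg[of R "A g"] by (fastforce simp: l_def not_less intro: antisym)
    have one: "(\<lambda>u. 1) \<in> L2 Q" by (simp add: L2_def)
    have "(\<integral>\<^sup>+v. \<integral>\<^sup>+u. ennreal ((h u v)\<^sup>2) \<partial>Q \<partial>R) = 0"
      using sum l0 unfolding HS_def by (simp cong: infsum_cong)
    then have "AE v in R. (\<integral>\<^sup>+u. ennreal ((h u v)\<^sup>2) \<partial>Q) = 0"
      by (subst (asm) nn_integral_0_iff_AE) auto
    then have "AE v in R. False"
      using h_marginal_R AE_space
    proof eventually_elim
      case (elim v)
      note [measurable] = elim(3)
      have "AE u in Q. ennreal ((h u v)\<^sup>2) = 0"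
        using elim(1) by (subst (asm) nn_integral_0_iff_AE) auto
      then have "(\<integral>\<^sup>+u. ennreal (h u v) \<partial>Q) = (\<integral>\<^sup>+u. 0 \<partial>Q)"
        by (intro nn_integral_cong_AE) (auto simp: ennreal_eq_0_iff)
      with elim(2) show False by simp
    qed
    then show False using R.AE_False by simp
  qed
  show "\<exists>\<kappa> lam. enumerates_positive_eigenvalues Q T \<kappa> lam"
    by (rule ex_enumeration_of_eigenvalues[OF E(2) fin ex mult])
  assume enum: "enumerates_positive_eigenvalues Q T \<kappa> lam"
  have "(\<Sum>\<^sub>\<infinity>i\<in>{i. enat i \<le> \<kappa>}. ennreal (lam i ^ Suc k)) = (\<Sum>\<^sub>\<infinity>g\<in>E. ennreal (l g ^ Suc k))"
    by (rule infsum_enumerated_eigenvalues[OF fin _ mult enum]) (auto simp: l_def)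
  also have "\<dots> = (\<integral>\<^sup>+u. step_density Q q (Suc k) u u \<partial>Q)"
    unfolding l_def by (rule nn_integral_step_density_diagonal[OF HS Q E eigen, symmetric])
  finally show "(\<Sum>\<^sub>\<infinity>i\<in>{i. enat i \<le> \<kappa>}. ennreal (lam i ^ Suc k)) = (\<integral>\<^sup>+u. step_density Q q (Suc k) u u \<partial>Q)" .
qed

end

section \<open>The data augmentation kernel\<close>

text \<open>Positivity of the marginals expresses that the conditional densities are well defined
  almost everywhere; finiteness almost everywhere follows from the total mass 1.\<close>

locale da_setup = pair_sigma_finite M N
  for M :: "'a measure" and N :: "'b measure" +
  fixes f :: "'a \<times> 'b \<Rightarrow> ennreal"
  assumes f_borel: "f \<in> borel_measurable (M \<Otimes>\<^sub>M N)"
    and f_prob: "(\<integral>\<^sup>+z. f z \<partial>(M \<Otimes>\<^sub>M N)) = 1"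
    and marginals_pos: "AE z in M \<Otimes>\<^sub>M N. 0 < marginal_U N f (fst z) \<and> 0 < marginal_V M f (snd z)"
begin

lemma f_measurable [measurable (raw)]:
  assumes "g \<in> L \<rightarrow>\<^sub>M M" "k \<in> L \<rightarrow>\<^sub>M N"
  shows "(\<lambda>w. f (g w, k w)) \<in> borel_measurable L"
  using measurable_compose[OF measurable_Pair[OF assms] f_borel] .

abbreviation mU where "mU \<equiv> marginal_U N f"
abbreviation mV where "mV \<equiv> marginal_V M f"

lemma mU_measurable [measurable]: "mU \<in> borel_measurable M"
  unfolding marginal_U_def by measurable

lemma mV_measurable [measurable]: "mV \<in> borel_measurable N"
  unfolding marginal_V_def by measurable

lemma nn_integral_mU: "(\<integral>\<^sup>+u. mU u \<partial>M) = 1"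
  unfolding marginal_U_def M2.nn_integral_fst[OF f_borel] by (rule f_prob)

lemma nn_integral_mV: "(\<integral>\<^sup>+v. mV v \<partial>N) = 1"
  unfolding marginal_V_def nn_integral_snd[OF f_borel] by (rule f_prob)

definition Q where "Q = density M mU"
definition R where "R = density N mV"

lemma sets_Q [measurable_cong, simp]: "sets Q = sets M" and space_Q [simp]: "space Q = space M"
  by (simp_all add: Q_def)

lemma sets_R [measurable_cong, simp]: "sets R = sets N" and space_R [simp]: "space R = space N"
  by (simp_all add: R_def)

sublocale Q: prob_space Q
  by (rule prob_spaceI) (simp add: Q_def emeasure_density nn_integral_mU cong: nn_integral_cong)

sublocale R: prob_space R
  by (rule prob_spaceI) (simp add: R_def emeasure_density nn_integral_mV cong: nn_integral_cong)

text \<open>The points at which dividing by the marginal is meaningful. Their complement is null for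
  \<open>M\<close> itself and not only for the law of U, so integrals over \<open>M\<close> can be
  restricted to them.\<close>

definition good_U where "good_U u \<longleftrightarrow> u \<in> space M \<and> 0 < mU u \<and> mU u < \<infinity>"
definition good_V where "good_V v \<longleftrightarrow> v \<in> space N \<and> 0 < mV v \<and> mV v < \<infinity>"

lemma AE_good_U: "AE u in M. good_U u"
proof -
  have "AE u in M. mU u \<noteq> \<infinity>"
    by (rule nn_integral_PInf_AE) (simp_all add: nn_integral_mU)
  moreover have "AE u in M. 0 < mU u"
  proof -
    have "AE u in M. AE v in N. 0 < mU u \<and> 0 < mV v"
      using AE_pair[OF marginals_pos] by simp
    then show ?thesis
    proof eventually_elim
      case (elim u)
      show ?case
      proof (rule ccontr)
        assume "\<not> 0 < mU u"
        \<comment> \<open>If the marginal vanished at such a point, \<open>N\<close> would be the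
          null measure and the joint law would have total mass 0.\<close>
        then have "AE v in N. False" by (intro eventually_mono[OF elim]) simp
        then have "mU w = (\<integral>\<^sup>+v. 0 \<partial>N)" for w
          unfolding marginal_U_def by (intro nn_integral_cong_AE) auto
        then show False using nn_integral_mU by simp
      qed
    qed
  qed
  ultimately show ?thesis using AE_space
    by eventually_elim (simp add: good_U_def less_top)
qed

lemma AE_good_V: "AE v in N. good_V v"
proof -
  have "AE v in N. mV v \<noteq> \<infinity>"
    by (rule nn_integral_PInf_AE) (simp_all add: nn_integral_mV)
  moreover have "AE v in N. 0 < mV v"
  proof -
    have "AE u in M. AE v in N. 0 < mU u \<and> 0 < mV v"
      using AE_pair[OF marginals_pos] by simp
    then have "AE v in N. AE u in M. 0 < mU u \<and> 0 < mV v"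
      by (subst (asm) AE_commute) auto
    then show ?thesis
    proof eventually_elim
      case (elim v)
      show ?case
      proof (rule ccontr)
        assume "\<not> 0 < mV v"
        then have "AE u in M. False" by (intro eventually_mono[OF elim]) simp
        then have "mV w = (\<integral>\<^sup>+u. 0 \<partial>M)" for w
          unfolding marginal_V_def by (intro nn_integral_cong_AE) auto
        then show False using nn_integral_mV by simp
      qed
    qed
  qed
  ultimately show ?thesis using AE_space
    by eventually_elim (simp add: good_V_def less_top)
qed

lemma AE_f_finite_V:
  assumes "good_U u"
  shows "AE v in N. f (u, v) < \<infinity>"
proof -
  have [measurable]: "u \<in> space M" using assms by (simp add: good_U_def)
  have "AE v in N. f (u, v) \<noteq> \<infinity>"
    using assms by (intro nn_integral_PInf_AE) (auto simp: good_U_def marginal_U_def)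
  then show ?thesis by eventually_elim (simp add: less_top)
qed

lemma AE_f_finite_U:
  assumes "good_V v"
  shows "AE u in M. f (u, v) < \<infinity>"
proof -
  have [measurable]: "v \<in> space N" using assms by (simp add: good_V_def)
  have "AE u in M. f (u, v) \<noteq> \<infinity>"
    using assms by (intro nn_integral_PInf_AE) (auto simp: good_V_def marginal_V_def)
  then show ?thesis by eventually_elim (simp add: less_top)
qed

lemma AE_QI: "(AE u in M. P u) \<Longrightarrow> AE u in Q. P u"
  unfolding Q_def by (subst AE_density) (auto elim: eventually_mono)

lemma AE_RI: "(AE v in N. P v) \<Longrightarrow> AE v in R. P v"
  unfolding R_def by (subst AE_density) (auto elim: eventually_mono)

lemma nn_integral_Q: "g \<in> borel_measurable M \<Longrightarrow> (\<integral>\<^sup>+u. g u \<partial>Q) = (\<integral>\<^sup>+u. mU u * g u \<partial>M)"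
  unfolding Q_def by (rule nn_integral_density) auto

lemma nn_integral_R: "g \<in> borel_measurable N \<Longrightarrow> (\<integral>\<^sup>+v. g v \<partial>R) = (\<integral>\<^sup>+v. mV v * g v \<partial>N)"
  unfolding R_def by (rule nn_integral_density) auto

text \<open>Real-valued for the sake of Bochner integration; the conventions for
  \<open>enn2real\<close> and division make it 0 where \<open>f\<close> is infinite or a marginal is
  0 or infinite.\<close>

definition h :: "'a \<Rightarrow> 'b \<Rightarrow> real" where
  "h u v = enn2real (f (u, v)) / (enn2real (mU u) * enn2real (mV v))"

lemma h_measurable_MN [measurable (raw)]:
  assumes [measurable]: "g \<in> L \<rightarrow>\<^sub>M M" "k \<in> L \<rightarrow>\<^sub>M N"
  shows "(\<lambda>w. h (g w) (k w)) \<in> borel_measurable L"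
  unfolding h_def by measurable

lemma ennreal_posE:
  assumes "0 < a" "a < \<infinity>"
  obtains r where "0 < r" "a = ennreal r"
  using assms by (cases a) auto

text \<open>Multiplying \<open>h\<close> by one marginal gives back the conditional density of that
  variable given the other.\<close>

lemma ennreal_h:
  assumes "good_U u" "good_V v" "f (u, v) < \<infinity>"
  shows "mU u * ennreal (h u v) = f (u, v) / mV v" "mV v * ennreal (h u v) = f (u, v) / mU u"
proof -
  obtain a where a: "0 < a" "mU u = ennreal a" using assms(1) ennreal_posE by (auto simp: good_U_def)
  obtain b where b: "0 < b" "mV v = ennreal b" using assms(2) ennreal_posE by (auto simp: good_V_def)
  obtain c where c: "0 \<le> c" "f (u, v) = ennreal c" using assms(3) by (cases "f (u, v)") auto
  have "h u v = c / (a * b)" using a b c by (simp add: h_def)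
  then show "mU u * ennreal (h u v) = f (u, v) / mV v" "mV v * ennreal (h u v) = f (u, v) / mU u"
    using a b c by (simp_all add: divide_ennreal ennreal_mult[symmetric])
qed

sublocale K: kernel_pair Q R h
proof unfold_locales
  show "(\<lambda>w. h (fst w) (snd w)) \<in> borel_measurable (Q \<Otimes>\<^sub>M R)" by measurable
  show "0 \<le> h u v" for u v by (simp add: h_def)
  show "AE v in R. (\<integral>\<^sup>+u. ennreal (h u v) \<partial>Q) = 1"
  proof (rule AE_RI)
    show "AE v in N. (\<integral>\<^sup>+u. ennreal (h u v) \<partial>Q) = 1"
      using AE_good_V
    proof eventually_elim
      case (elim v)
      have [measurable]: "v \<in> space N" using elim by (simp add: good_V_def)
      have "(\<integral>\<^sup>+u. ennreal (h u v) \<partial>Q) = (\<integral>\<^sup>+u. mU u * ennreal (h u v) \<partial>M)"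
        by (rule nn_integral_Q) measurable
      also have "\<dots> = (\<integral>\<^sup>+u. f (u, v) / mV v \<partial>M)"
        using AE_good_U AE_f_finite_U[OF elim] ennreal_h(1)[OF _ elim]
        by (intro nn_integral_cong_AE) auto
      also have "\<dots> = mV v / mV v"
        by (subst nn_integral_divide) (auto simp: marginal_V_def)
      also have "\<dots> = 1" using elim by (auto simp: good_V_def less_top intro!: ennreal_divide_self)
      finally show ?case .
    qed
  qed
  show "AE u in Q. (\<integral>\<^sup>+v. ennreal (h u v) \<partial>R) = 1"
  proof (rule AE_QI)
    show "AE u in M. (\<integral>\<^sup>+v. ennreal (h u v) \<partial>R) = 1"
      using AE_good_U
    proof eventually_elim
      case (elim u)
      have [measurable]: "u \<in> space M" using elim by (simp add: good_U_def)
      have "(\<integral>\<^sup>+v. ennreal (h u v) \<partial>R) = (\<integral>\<^sup>+v. mV v * ennreal (h u v) \<partial>N)"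
        by (rule nn_integral_R) measurable
      also have "\<dots> = (\<integral>\<^sup>+v. f (u, v) / mU u \<partial>N)"
        using AE_good_V AE_f_finite_V[OF elim] ennreal_h(2)[OF elim]
        by (intro nn_integral_cong_AE) auto
      also have "\<dots> = mU u / mU u"
        by (subst nn_integral_divide) (auto simp: marginal_U_def)
      also have "\<dots> = 1" using elim by (auto simp: good_U_def less_top intro!: ennreal_divide_self)
      finally show ?case .
    qed
  qed
qed

section \<open>The transition density as a kernel with respect to the law of U\<close>

abbreviation p where "p \<equiv> da_density M N f"

lemma p_measurable [measurable (raw)]:
  assumes [measurable]: "g \<in> L \<rightarrow>\<^sub>M M" "k \<in> L \<rightarrow>\<^sub>M M"
  shows "(\<lambda>z. p (g z) (k z)) \<in> borel_measurable L"
  unfolding da_density_def cond_U_given_V_def cond_V_given_U_def by measurable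

text \<open>The reversibility of the chain in terms of kernels: apart from the weight of the target
  point, the transition density is symmetric.\<close>

lemma da_density_eq:
  assumes u: "good_U u" and w: "good_U w"
  shows "p u w = mU w * K.q u w"
proof -
  have [measurable]: "u \<in> space M" "w \<in> space M" using u w by (simp_all add: good_U_def)
  have "mU w * K.q u w = (\<integral>\<^sup>+v. mU w * (mV v * (ennreal (h u v) * ennreal (h w v))) \<partial>N)"
    unfolding K.q_def by (subst nn_integral_R) (auto intro: nn_integral_cmult[symmetric])
  also have "\<dots> = p u w"
    unfolding da_density_def cond_U_given_V_def cond_V_given_U_def
  proof (rule nn_integral_cong_AE)
    show "AE v in N. mU w * (mV v * (ennreal (h u v) * ennreal (h w v)))
        = f (w, v) / mV v * (f (u, v) / mU u)"
      using AE_good_V AE_f_finite_V[OF u] AE_f_finite_V[OF w]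
      by eventually_elim
        (simp add: ennreal_h(1)[OF w, symmetric] ennreal_h(2)[OF u, symmetric] ac_simps)
  qed
  finally show ?thesis by simp
qed

text \<open>The weight \<open>mU z\<close> of each intermediate point turns integration over
  \<open>M\<close> into integration over \<open>Q\<close>; only the weight of the final point
  remains.\<close>

lemma step_density_eq:
  assumes "good_U u" "good_U w"
  shows "step_density M p (Suc n) u w = mU w * step_density Q K.q (Suc n) u w"
  using assms(2)
proof (induction n arbitrary: w)
  case 0
  then show ?case using da_density_eq[OF assms(1)] by simp
next
  case (Suc n)
  have [measurable]: "u \<in> space Q" "w \<in> space Q" using assms(1) Suc.prems by (simp_all add: good_U_def)
  have "step_density M p (Suc (Suc n)) u w
      = (\<integral>\<^sup>+z. mU w * (mU z * (step_density Q K.q (Suc n) u z * K.q z w)) \<partial>M)"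
    unfolding step_density.simps
  proof (rule nn_integral_cong_AE)
    show "AE z in M. step_density M p (Suc n) u z * p z w
        = mU w * (mU z * (step_density Q K.q (Suc n) u z * K.q z w))"
      using AE_good_U
      by eventually_elim (simp add: Suc.IH da_density_eq Suc.prems ac_simps)
  qed
  also have "\<dots> = mU w * (\<integral>\<^sup>+z. mU z * (step_density Q K.q (Suc n) u z * K.q z w) \<partial>M)"
  proof (rule nn_integral_cmult)
    have "(\<lambda>z. mU z * (step_density Q K.q (Suc n) u z * K.q z w)) \<in> borel_measurable Q"
      by measurable
    then show "(\<lambda>z. mU z * (step_density Q K.q (Suc n) u z * K.q z w)) \<in> borel_measurable M"
      by simp
  qed
  also have "(\<integral>\<^sup>+z. mU z * (step_density Q K.q (Suc n) u z * K.q z w) \<partial>M)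
      = (\<integral>\<^sup>+z. step_density Q K.q (Suc n) u z * K.q z w \<partial>Q)"
  proof (rule nn_integral_Q[symmetric])
    have "(\<lambda>z. step_density Q K.q (Suc n) u z * K.q z w) \<in> borel_measurable Q" by measurable
    then show "(\<lambda>z. step_density Q K.q (Suc n) u z * K.q z w) \<in> borel_measurable M" by simp
  qed
  finally show ?case by simp
qed

lemma nn_integral_step_density_eq:
  "(\<integral>\<^sup>+u. step_density M p (Suc n) u u \<partial>M) = (\<integral>\<^sup>+u. step_density Q K.q (Suc n) u u \<partial>Q)"
proof -
  have "(\<lambda>u. step_density Q K.q (Suc n) u u) \<in> borel_measurable Q" by measurable
  then have "(\<integral>\<^sup>+u. step_density Q K.q (Suc n) u u \<partial>Q) = (\<integral>\<^sup>+u. mU u * step_density Q K.q (Suc n) u u \<partial>M)"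
    by (intro nn_integral_Q) simp
  also have "\<dots> = (\<integral>\<^sup>+u. step_density M p (Suc n) u u \<partial>M)"
    using AE_good_U by (intro nn_integral_cong_AE) (auto elim!: eventually_mono simp: step_density_eq)
  finally show ?thesis by simp
qed

lemma kernel_operator_measurable:
  assumes "x \<in> L2 Q"
  shows "kernel_operator M p x \<in> borel_measurable Q"
proof -
  have [measurable]: "x \<in> borel_measurable M" using L2D(1)[OF assms] by simp
  have "kernel_operator M p x \<in> borel_measurable M"
    unfolding kernel_operator_def by measurable
  then show ?thesis by simp
qed

lemma AE_kernel_operator_eq:
  assumes x: "x \<in> L2 Q"
  shows "AE u in Q. kernel_operator M p x u = K.B (K.A x) u"
proof -
  have [measurable]: "x \<in> borel_measurable M" using L2D(1)[OF x] by simp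
  \<comment> \<open>The change of density for Bochner integrals takes a real-valued density, while
    the marginal is \<open>ennreal\<close>-valued.\<close>
  have Q_real: "Q = density M (\<lambda>u. ennreal (enn2real (mU u)))"
    unfolding Q_def
  proof (rule density_cong)
    show "AE u in M. mU u = ennreal (enn2real (mU u))"
      using AE_good_U by eventually_elim (simp add: good_U_def)
  qed measurable
  have "AE u in Q. kernel_operator M p x u = kernel_operator Q K.q x u"
  proof (rule AE_QI)
    show "AE u in M. kernel_operator M p x u = kernel_operator Q K.q x u"
      using AE_good_U
    proof eventually_elim
      case (elim u)
      have [measurable]: "u \<in> space Q" "u \<in> space M" using elim by (simp_all add: good_U_def)
      have "(\<lambda>w. K.q u w) \<in> borel_measurable Q" by measurable
      then have [measurable]: "(\<lambda>w. K.q u w) \<in> borel_measurable M" by simp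
      have "kernel_operator Q K.q x u
          = (\<integral>w. enn2real (mU w) *\<^sub>R (of_real (enn2real (K.q u w)) * x w) \<partial>M)"
        unfolding kernel_operator_def by (subst Q_real, subst integral_density) auto
      also have "\<dots> = kernel_operator M p x u"
        unfolding kernel_operator_def
      proof (rule integral_cong_AE)
        show "AE w in M. enn2real (mU w) *\<^sub>R (of_real (enn2real (K.q u w)) * x w)
            = of_real (enn2real (p u w)) * x w"
          using AE_good_U
          by eventually_elim (simp add: da_density_eq[OF elim] enn2real_mult scaleR_conv_of_real)
      qed measurable
      finally show ?case by simp
    qed
  qed
  with K.AE_kernel_operator_q[OF x] show ?thesis by eventually_elim simp
qed

end

theorem theorem2:
  fixes M :: "'a measure" and N :: "'b measure"
    and W :: "'w measure" and U :: "'w \<Rightarrow> 'a" and V :: "'w \<Rightarrow> 'b"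
    and f :: "'a \<times> 'b \<Rightarrow> ennreal"
    and K :: "'a \<Rightarrow> 'a measure"
  defines "Q \<equiv> density M (marginal_U N f)"
    and "p \<equiv> da_density M N f"
    and "P \<equiv> kernel_operator M (da_density M N f)"
  assumes "sigma_finite_measure M" and "countably_generated M"
    and "sigma_finite_measure N" and "countably_generated N"
    and "prob_space W"
    and "distributed W (M \<Otimes>\<^sub>M N) (\<lambda>\<omega>. (U \<omega>, V \<omega>)) f"
    and "AE z in M \<Otimes>\<^sub>M N. marginal_U N f (fst z) > 0 \<and> marginal_V M f (snd z) > 0"
    and "is_kernel_of_density M p K"
    and "Harris_ergodic_kernel M Q K"
  shows "(trace_class Q P \<longleftrightarrow> (\<integral>\<^sup>+ u. p u u \<partial>M) < \<infinity>) \<and>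
         ((\<integral>\<^sup>+ u. p u u \<partial>M) < \<infinity> \<longrightarrow>
            (\<exists>\<kappa> lam. enumerates_positive_eigenvalues Q P \<kappa> lam) \<and>
            (\<forall>\<kappa> lam. enumerates_positive_eigenvalues Q P \<kappa> lam \<longrightarrow>
               (\<forall>k::nat. k \<ge> 1 \<longrightarrow>
                  (\<Sum>\<^sub>\<infinity>i\<in>{i. enat i \<le> \<kappa>}. ennreal (lam i ^ k)) =
                  (\<integral>\<^sup>+ u. step_density M p k u u \<partial>M))))"
proof -
  interpret M: sigma_finite_measure M by fact
  interpret N: sigma_finite_measure N by fact
  interpret W: prob_space W by fact
  note dist = \<open>distributed W (M \<Otimes>\<^sub>M N) (\<lambda>\<omega>. (U \<omega>, V \<omega>)) f\<close>
  interpret da: da_setup M N f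
  proof unfold_locales
    show "f \<in> borel_measurable (M \<Otimes>\<^sub>M N)"
      by (rule distributed_borel_measurable[OF dist])
    have "(\<integral>\<^sup>+z. f z \<partial>(M \<Otimes>\<^sub>M N)) = emeasure (density (M \<Otimes>\<^sub>M N) f) (space (M \<Otimes>\<^sub>M N))"
      by (subst emeasure_density) (auto simp: distributed_borel_measurable[OF dist] intro!: nn_integral_cong)
    also have "\<dots> = emeasure (distr W (M \<Otimes>\<^sub>M N) (\<lambda>\<omega>. (U \<omega>, V \<omega>))) (space (M \<Otimes>\<^sub>M N))"
      by (simp add: distributed_distr_eq_density[OF dist])
    also have "\<dots> = 1"
      using prob_space.emeasure_space_1[OF W.prob_space_distr[OF distributed_measurable[OF dist]]]
      by simp
    finally show "(\<integral>\<^sup>+z. f z \<partial>(M \<Otimes>\<^sub>M N)) = 1" .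
  qed fact
  have Q: "Q = da.Q" by (simp add: da.Q_def Q_def)
  have cg: "countably_generated da.Q"
    using \<open>countably_generated M\<close> by (simp add: countably_generated_def)
  have P: "P x \<in> borel_measurable da.Q" "AE u in da.Q. P x u = da.K.B (da.K.A x) u" if "x \<in> L2 da.Q" for x
    unfolding P_def using da.kernel_operator_measurable[OF that] da.AE_kernel_operator_eq[OF that] .
  \<comment> \<open>The index 0 stands for the one-step density, whose diagonal integral is that of
    \<open>q\<close> over the law of U.\<close>
  have trace: "(\<integral>\<^sup>+u. p u u \<partial>M) = da.K.HS"
    using da.nn_integral_step_density_eq[of 0] da.K.nn_integral_q_diagonal by (simp add: p_def)
  note eigenvalues = da.K.positive_eigenvalues[OF _ cg P]
  have "trace_class da.Q P \<longleftrightarrow> da.K.HS < \<infinity>"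
    by (rule da.K.trace_class_iff[OF cg P])
  moreover have "(\<Sum>\<^sub>\<infinity>i\<in>{i. enat i \<le> \<kappa>}. ennreal (lam i ^ k)) = (\<integral>\<^sup>+ u. step_density M p k u u \<partial>M)"
    if fin: "da.K.HS < \<infinity>" and enum: "enumerates_positive_eigenvalues da.Q P \<kappa> lam" and "k \<ge> 1" for \<kappa> lam k
  proof -
    obtain n where k: "k = Suc n" using \<open>k \<ge> 1\<close> by (cases k) auto
    show ?thesis
      unfolding k p_def da.nn_integral_step_density_eq
      by (rule eigenvalues(2)[OF fin _ _ enum])
  qed
  ultimately show ?thesis
    unfolding trace Q using eigenvalues(1) by blast
qed

end
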